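(* Let $p>2$ and let $\Omega,\Omega^*\subset\mathbb{R}^n$ be open balls in one of the configurations listed in the context. For any positive density functions $f^+\in C(\overline{\Omega})$ and $f^-\in C(\overline{\Omega^*})$ satisfying the normalized balance condition $\int_\Omega f^+dx=\int_{\Omega^*}f^-dx=1$, there exists a unique solution $\bar u_p\in\mathscr{A}$ of the Euler-Lagrange equation $$\mathrm{div}(|\nabla u_p|^{p-2}\nabla u_p)+f=0\quad\text{in } U\setminus\overline{\Omega\cap\Omega^*},$$ equipped with the Dirichlet boundary condition, and $\bar u_p$ is at the same time a global minimizer for the approximation problem $(\mathcal{P}^{(p)})$: $\min_{w_p\in\mathscr{A}} I^{(p)}[w_p]$. In particular, let $E_p(x):=x^{(2p-2)/(p-2)}$ for $x\in[0,1]$ and let $E_p^{-1}$ be the inverse of $E_p$. Then: (i) If $\Omega=\mathbb{B}(O_1,R_1)$, $\Omega^*=\mathbb{B}(O_2,R_2)$, $\Omega\cap\Omega^*=\emptyset$, then $\bar u_p$ is represented explicitly as $$\bar u_p(r)=\int_{R_1}^{r}\frac{F(\rho)\rho}{E_p^{-1}(F^2(\rho)\rho^2)}\,d\rho,\quad r\in[0,R_1]\ \ (\text{in }\Omega),\qquad \bar u_p(r)=\int_{R_2}^{r}\frac{G(\rho)\rho}{E_p^{-1}(G^2(\rho)\rho^2)}\,d\rho,\quad r\in[0,R_2]\ \ (\text{in }\Omega^* ),$$ where $$F(r):=-\frac{\Gamma(n/2)}{2\pi^{n/2}r^n}+\int_r^{R_1}\frac{f^+(\rho)\rho^{n-1}}{r^n}\,d\rho,\quad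 r\in[0,R_1],$$ $$G(r):=\frac{\Gamma(n/2)}{2\pi^{n/2}r^n}-\int_r^{R_2}\frac{f^-(\rho)\rho^{n-1}}{r^n}\,d\rho,\quad r\in[0,R_2].$$ (ii) If $\Omega=\mathbb{B}(O_1,R_1)$, $\Omega^*=\mathbb{B}(O_1,R_2)$, $R_1>R_2>0$, then $\bar u_p$ is represented explicitly as $$\bar u_p(r)=\int_{R_2}^{r}\frac{F_p(\rho)\rho}{E_p^{-1}(F_p^2(\rho)\rho^2)}\,d\rho,\quad r\in[R_2,R_1],$$ where $$F_p(r):=\frac{C_pR_2^n}{r^n}-\int_{R_2}^{r}\frac{f^+(\rho)\rho^{n-1}}{r^n}\,d\rho$$ and $C_p$ is a constant with $C_p\in\big(0,\Gamma(n/2)/(2\pi^{n/2}R_2^n)\big)$. (iii) If $\Omega=\mathbb{B}(O_1,R_1)$, $\Omega^*=\mathbb{B}(O_1,R_2)$, $R_2>R_1>0$, then $\bar u_p$ is represented explicitly as $$\bar u_p(r)=\int_{R_1}^{r}\frac{G_p(\rho)\rho}{E_p^{-1}(G_p^2(\rho)\rho^2)}\,d\rho,\quad r\in[R_1,R_2],$$ where $$G_p(r):=-\frac{D_pR_1^n}{r^n}+\int_{R_1}^{r}\frac{f^-(\rho)\rho^{n-1}}{r^n}\,d\rho$$ and $D_p$ is a constant with $D_p\in\big(0,\Gamma(n/2)/(2\pi^{n/2}R_1^n)\big)$.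
   Context: $\mathbb{B}(O,R)$ is the open ball in $\mathbb{R}^n$ with center $O$ and radius $R>0$. Two configurations are considered: (a) $\Omega=\mathbb{B}(O_1,R_1)$, $\Omega^*=\mathbb{B}(O_2,R_2)$ with $\Omega\cap\Omega^*=\emptyset$; (b) $\Omega=\mathbb{B}(O_1,R_1)$, $\Omega^*=\mathbb{B}(O_1,R_2)$ with $R_1\neq R_2$. Put $U:=\Omega\cup\Omega^*$. $f^+$ and $f^-$ are density functions on $\Omega$ and $\Omega^*$ respectively, and $f:=f^+-f^-$ (each density extended by zero outside its ball). In the explicit formulas $f^\pm$ are radial functions, written as functions of the radius. $r$ denotes the distance to the center of the ball concerned. The admissible set is $$\mathscr{A}:=\Big\{\phi\in W_0^{1,\infty}(U)\cap C(\overline U)\ \Big|\ \|\nabla\phi\|_{L^\infty}\le 1,\ \phi\text{ radially symmetric},\ \phi=0\text{ on }\overline{\Omega\cap\Omega^*}\Big\}.$$ In configuration (a), "radially symmetric" means radially symmetric about $O_1$ in $\Omega$ and about $O_2$ in $\Omega^*$; in configuration (b), about $O_1$. The potential energy functional is $$I^{(p)}[w]:=\int_U\Big(\frac{|\nabla w|^p}{p}-wf\Big)dx.$$ The Dirichlet boundary condition is $u_p=0$ on the boundary of $U\setminus\overline{\Omega\cap\Omega^*}$.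
   Formalization: The densities are taken radial, and the arguments F²ρ², G²ρ², F_p²ρ², G_p²ρ² of E_p^{-1} are assumed to lie in [0,1] (for the constant making the profile vanish on the outer sphere); otherwise no solution satisfies |∇u| ≤ 1, e.g. for uniform densities on small discs. *)

theory Defs
  imports "HOL-Analysis.Analysis"
begin

section \<open>Sobolev spaces\<close>

text \<open>The test class is $C^1_c(V)$, with the gradient carried along explicitly; it yields the same
  weak derivatives and spaces as $C^\infty_c(V)$.\<close>

definition test_function :: "'a::euclidean_space set \<Rightarrow> ('a \<Rightarrow> real) \<Rightarrow> ('a \<Rightarrow> 'a) \<Rightarrow> bool" where
  "test_function V \<psi> d\<psi> \<longleftrightarrow>
     (\<forall>x. GDERIV \<psi> x :> d\<psi> x) \<and> continuous_on UNIV d\<psi> \<and>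
     (\<exists>K. compact K \<and> K \<subseteq> V \<and> (\<forall>x. x \<notin> K \<longrightarrow> \<psi> x = 0))"

definition locally_integrable ::
  "'a::euclidean_space set \<Rightarrow> ('a \<Rightarrow> 'b::{banach, second_countable_topology}) \<Rightarrow> bool" where
  "locally_integrable V h \<longleftrightarrow> (\<forall>K. compact K \<and> K \<subseteq> V \<longrightarrow> set_integrable lebesgue K h)"

definition weak_gradient :: "'a::euclidean_space set \<Rightarrow> ('a \<Rightarrow> real) \<Rightarrow> ('a \<Rightarrow> 'a) \<Rightarrow> bool" where
  "weak_gradient V u g \<longleftrightarrow>
     locally_integrable V u \<and> locally_integrable V g \<and>
     (\<forall>\<psi> d\<psi>. test_function V \<psi> d\<psi> \<longrightarrow>
        (LINT x:V|lebesgue. u x *\<^sub>R d\<psi> x) = - (LINT x:V|lebesgue. \<psi> x *\<^sub>R g x))"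

text \<open>A chosen representative; on \<open>V\<close> the weak gradient is determined up to null sets.\<close>

definition wgrad :: "'a::euclidean_space set \<Rightarrow> ('a \<Rightarrow> real) \<Rightarrow> 'a \<Rightarrow> 'a" where
  "wgrad V u = (SOME g. weak_gradient V u g)"

definition W1_inf :: "'a::euclidean_space set \<Rightarrow> ('a \<Rightarrow> real) set" where
  "W1_inf V = {u. \<exists>g. weak_gradient V u g \<and>
     (\<exists>B. AE x\<in>V in lebesgue. \<bar>u x\<bar> \<le> B \<and> norm (g x) \<le> B)}"

text \<open>$W_0^{1,1}(V)$: the closure of the test functions in the $W^{1,1}$ norm.\<close>

definition W011 :: "'a::euclidean_space set \<Rightarrow> ('a \<Rightarrow> real) set" where
  "W011 V = {u. \<exists>g. weak_gradient V u g \<and> set_integrable lebesgue V u \<and> set_integrable lebesgue V g \<and>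
     (\<exists>\<psi> d\<psi>. (\<forall>k::nat. test_function V (\<psi> k) (d\<psi> k)) \<and>
        (\<lambda>k. LINT x:V|lebesgue. \<bar>\<psi> k x - u x\<bar>) \<longlonglongrightarrow> 0 \<and>
        (\<lambda>k. LINT x:V|lebesgue. norm (d\<psi> k x - g x)) \<longlonglongrightarrow> 0)}"

text \<open>The usual convention $W_0^{1,\infty} = W^{1,\infty} \cap W_0^{1,1}$. (The norm closure of the
  test functions in $W^{1,\infty}$ would contain only $C^1$ functions.)\<close>

definition W01_inf :: "'a::euclidean_space set \<Rightarrow> ('a \<Rightarrow> real) set" where
  "W01_inf V = W1_inf V \<inter> W011 V"

section \<open>The variational problem\<close>

definition radial_on :: "'a::euclidean_space set \<Rightarrow> 'a \<Rightarrow> ('a \<Rightarrow> real) \<Rightarrow> bool" where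
  "radial_on S c \<phi> \<longleftrightarrow> (\<forall>x\<in>S. \<forall>y\<in>S. dist c x = dist c y \<longrightarrow> \<phi> x = \<phi> y)"

text \<open>Members of the admissible set are functions on the closure of \<open>U\<close>; their values elsewhere are
  arbitrary. For concentric balls the two radiality conditions together say that \<open>\<phi>\<close> is radial
  on \<open>U\<close>, since \<open>U\<close> is then the larger ball.\<close>

definition admissible ::
  "'a::euclidean_space \<Rightarrow> real \<Rightarrow> 'a \<Rightarrow> real \<Rightarrow> ('a \<Rightarrow> real) set" where
  "admissible O1 R1 O2 R2 =
     (let U = ball O1 R1 \<union> ball O2 R2 in
      {\<phi>. \<phi> \<in> W01_inf U \<and> continuous_on (closure U) \<phi> \<and>
          (AE x\<in>U in lebesgue. norm (wgrad U \<phi> x) \<le> 1) \<and>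
          radial_on (ball O1 R1) O1 \<phi> \<and> radial_on (ball O2 R2) O2 \<phi> \<and>
          (\<forall>x\<in>closure (ball O1 R1 \<inter> ball O2 R2). \<phi> x = 0)})"

definition net_density ::
  "'a set \<Rightarrow> 'a set \<Rightarrow> ('a \<Rightarrow> real) \<Rightarrow> ('a \<Rightarrow> real) \<Rightarrow> 'a \<Rightarrow> real" where
  "net_density \<Omega> \<Omega>s fplus fminus x =
     (if x \<in> \<Omega> then fplus x else 0) - (if x \<in> \<Omega>s then fminus x else 0)"

definition energy ::
  "real \<Rightarrow> 'a::euclidean_space set \<Rightarrow> ('a \<Rightarrow> real) \<Rightarrow> ('a \<Rightarrow> real) \<Rightarrow> real" where
  "energy p U f w = (LINT x:U|lebesgue. norm (wgrad U w x) powr p / p - w x * f x)"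

text \<open>$\mathrm{div}(|\nabla u|^{p-2}\nabla u) + f = 0$ in \<open>V\<close>, in the weak sense.\<close>

definition p_laplace_solution ::
  "real \<Rightarrow> 'a::euclidean_space set \<Rightarrow> ('a \<Rightarrow> real) \<Rightarrow> ('a \<Rightarrow> real) \<Rightarrow> bool" where
  "p_laplace_solution p V f u \<longleftrightarrow>
     (\<exists>g. weak_gradient V u g \<and> locally_integrable V (\<lambda>x. norm (g x) powr (p - 1)) \<and>
        (\<forall>\<psi> d\<psi>. test_function V \<psi> d\<psi> \<longrightarrow>
           (LINT x:V|lebesgue. (norm (g x) powr (p - 2) *\<^sub>R g x) \<bullet> d\<psi> x) =
           (LINT x:V|lebesgue. f x * \<psi> x)))"

definition euler_lagrange_dirichlet ::
  "real \<Rightarrow> 'a::euclidean_space set \<Rightarrow> ('a \<Rightarrow> real) \<Rightarrow> ('a \<Rightarrow> real) \<Rightarrow> bool" where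
  "euler_lagrange_dirichlet p V f u \<longleftrightarrow> p_laplace_solution p V f u \<and> (\<forall>x\<in>frontier V. u x = 0)"

section \<open>The explicit formulas\<close>

definition Ep :: "real \<Rightarrow> real \<Rightarrow> real" where
  "Ep p x = x powr ((2 * p - 2) / (p - 2))"

text \<open>Only meaningful for arguments in \<open>{0..1}\<close>.\<close>

definition Ep_inv :: "real \<Rightarrow> real \<Rightarrow> real" where
  "Ep_inv p = the_inv_into {0..1} (Ep p)"

text \<open>The reciprocal of the surface area of the unit sphere in dimension \<open>n\<close>.\<close>

definition inv_sphere_area :: "nat \<Rightarrow> real" where
  "inv_sphere_area n = Gamma (real n / 2) / (2 * pi powr (real n / 2))"

text \<open>The formulas below are only used for \<open>r > 0\<close>; their junk value at the centre \<open>r = 0\<close>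
  does not affect any integral.\<close>

definition F_fun :: "nat \<Rightarrow> real \<Rightarrow> (real \<Rightarrow> real) \<Rightarrow> real \<Rightarrow> real" where
  "F_fun n R1 fp r = - inv_sphere_area n / r ^ n
     + (LBINT \<rho>=ereal r..ereal R1. fp \<rho> * \<rho> ^ (n - 1) / r ^ n)"

definition G_fun :: "nat \<Rightarrow> real \<Rightarrow> (real \<Rightarrow> real) \<Rightarrow> real \<Rightarrow> real" where
  "G_fun n R2 fm r = inv_sphere_area n / r ^ n
     - (LBINT \<rho>=ereal r..ereal R2. fm \<rho> * \<rho> ^ (n - 1) / r ^ n)"

definition Fp_fun :: "nat \<Rightarrow> real \<Rightarrow> (real \<Rightarrow> real) \<Rightarrow> real \<Rightarrow> real \<Rightarrow> real" where
  "Fp_fun n R2 fp C r = C * R2 ^ n / r ^ n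
     - (LBINT \<rho>=ereal R2..ereal r. fp \<rho> * \<rho> ^ (n - 1) / r ^ n)"

definition Gp_fun :: "nat \<Rightarrow> real \<Rightarrow> (real \<Rightarrow> real) \<Rightarrow> real \<Rightarrow> real \<Rightarrow> real" where
  "Gp_fun n R1 fm D r = - D * R1 ^ n / r ^ n
     + (LBINT \<rho>=ereal R1..ereal r. fm \<rho> * \<rho> ^ (n - 1) / r ^ n)"

text \<open>The integral is oriented, so \<open>r < a\<close> is allowed. Where \<open>\<Phi>\<close> vanishes the integrand is
  $0/0$, whose value \<open>0\<close> in HOL is also its limit.\<close>

definition profile :: "real \<Rightarrow> (real \<Rightarrow> real) \<Rightarrow> real \<Rightarrow> real \<Rightarrow> real" where
  "profile p \<Phi> a r = (LBINT \<rho>=ereal a..ereal r. \<Phi> \<rho> * \<rho> / Ep_inv p ((\<Phi> \<rho>)\<^sup>2 * \<rho>\<^sup>2))"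

text \<open>The arguments to which the formula applies $E_p^{-1}$ lie in the domain of $E_p^{-1}$. For the
  profile \<open>\<Phi>\<close> of a solution this is exactly the gradient bound in \<^const>\<open>admissible\<close>.\<close>

definition in_Ep_inv_domain :: "(real \<Rightarrow> real) \<Rightarrow> real set \<Rightarrow> bool" where
  "in_Ep_inv_domain \<Phi> S \<longleftrightarrow> (\<forall>\<rho>\<in>S. (\<Phi> \<rho>)\<^sup>2 * \<rho>\<^sup>2 \<in> {0..1})"

text \<open>The slope \<open>s\<close> solving $|s|^{p-2}s = t$. It agrees with $t / E_p^{-1}(t^2)$ when
  $|t| \le 1$, but makes sense for all \<open>t\<close>.\<close>

definition slope :: "real \<Rightarrow> real \<Rightarrow> real" where
  "slope p t = sgn t * \<bar>t\<bar> powr (1 / (p - 1))"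

text \<open>The profile starting with value \<open>0\<close> at \<open>a\<close> returns to \<open>0\<close> at \<open>b\<close>. In the concentric
  configurations this determines the constant in \<^const>\<open>Fp_fun\<close> and \<^const>\<open>Gp_fun\<close>.\<close>

definition returns_to_zero :: "real \<Rightarrow> (real \<Rightarrow> real) \<Rightarrow> real \<Rightarrow> real \<Rightarrow> bool" where
  "returns_to_zero p \<Phi> a b \<longleftrightarrow> (LBINT \<rho>=ereal a..ereal b. slope p (\<Phi> \<rho> * \<rho>)) = 0"

end

theory Submission
  imports Defs
begin

text \<open>Let \<open>V\<close> be the region where admissible functions may be nonzero: two disjoint balls, or the shell
  between two concentric spheres. The solution is found by integrating the radial equation. If \<open>k\<close> is
  the signed radial density, the flux of a radial solution at distance \<open>r\<close> is
  \<open>H r = - (\<integral>\<^sub>0\<^sup>r k \<rho> * \<rho> ^ (n - 1) d\<rho>) / r ^ (n - 1)\<close>, its slope is the root of \<open>|s| ^ (p - 2) * s = H r\<close>,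
  and the explicit formulas integrate this slope. On a ball the
  normalization of the mass brings this flux into the stated form. On a shell the flux contains a constant, which is found by shooting: the potential starting with
  value \<open>0\<close> on the inner sphere must return to \<open>0\<close> on the outer one (\<open>shooting_constant\<close>).

  Everything about arbitrary competitors rests on one divergence identity. For bounded \<open>F\<close>, the field \<open>- (\<integral>\<^sub>0\<^sup>1 t ^ (n - 1) * F (c + t * (x - c)) dt) * (x - c)\<close> has divergence \<open>- F\<close>
  (\<open>ray_field_divergence\<close>), by substitution and integration along rays. For radial \<open>F\<close> it
  is the radial field of strength \<open>H\<close>, hence the \<open>p\<close>-flux of the candidate. This gives the equation
  without a discussion of the centre. It also gives more: on a shell, the constant in the flux
  is produced by a uniform source on the inner ball, so that the flux extends to a bounded field on
  the larger ball with bounded divergence. Since admissible functions vanish on the inner ball, the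
  identity may be tested with every admissible function, although these are only known to be limits of
  test functions on the larger ball. With the convexity of \<open>|a| ^ p\<close>, minimality follows
  (locale \<open>calibration\<close>).

  For uniqueness, another solution \<open>v\<close> has to be used as a test function in its own equation, which
  is posed on \<open>V\<close> only. It vanishes on the boundary of \<open>V\<close> and is continuous, and there are cutoffs
  whose gradients have bounded total mass (\<open>shell_cutoffs\<close>); so cutting \<open>v\<close> off costs an error that
  tends to \<open>0\<close> (\<open>cutoff_boundary_layer\<close>). The same cutoffs show that the candidate is admissible. By strict
  monotonicity of the flux the gradients of both solutions agree, and a last use of the ray fields, now with
  \<open>F = v - u\<close>, yields \<open>v = u\<close>.\<close>

section \<open>Calculus of test functions\<close>

lemma test_function_mono:
  assumes "test_function V \<psi> d\<psi>" "V \<subseteq> W"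
  shows "test_function W \<psi> d\<psi>"
  using assms unfolding test_function_def by blast

lemma GDERIV_unique:
  assumes "GDERIV f x :> a" "GDERIV f x :> b"
  shows "a = b"
proof -
  have "(\<lambda>h. inner h a) = (\<lambda>h. inner h b)"
    using assms has_derivative_unique unfolding gderiv_def by blast
  then have "inner (a - b) a = inner (a - b) b" by meson
  then have "inner (a - b) (a - b) = 0" by (simp add: inner_diff_right)
  then show ?thesis by simp
qed

lemma GDERIV_continuous: "GDERIV f x :> D \<Longrightarrow> isCont f x"
  unfolding gderiv_def by (rule has_derivative_continuous)

lemma GDERIV_transform_open:
  assumes "GDERIV f x :> D" "open S" "x \<in> S" "\<And>y. y \<in> S \<Longrightarrow> f y = g y"
  shows "GDERIV g x :> D"
  using assms unfolding gderiv_def by (rule has_derivative_transform_within_open)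

text \<open>Where a function vanishes locally, so does its gradient; hence both live on the same compact set, and
  continuity bounds them.\<close>

lemma test_functionE:
  fixes \<psi> :: "'a::euclidean_space \<Rightarrow> real"
  assumes "test_function V \<psi> d\<psi>"
  obtains K B where "compact K" "K \<subseteq> V" "\<And>x. x \<notin> K \<Longrightarrow> \<psi> x = 0" "\<And>x. x \<notin> K \<Longrightarrow> d\<psi> x = 0"
    "\<And>x. \<bar>\<psi> x\<bar> \<le> B" "\<And>x. norm (d\<psi> x) \<le> B" "0 \<le> B"
proof -
  obtain K where K: "compact K" "K \<subseteq> V" "\<And>x. x \<notin> K \<Longrightarrow> \<psi> x = 0"
    and D: "\<And>x. GDERIV \<psi> x :> d\<psi> x" and cd: "continuous_on UNIV d\<psi>"
    using assms unfolding test_function_def by blast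
  have d0: "d\<psi> x = 0" if "x \<notin> K" for x
  proof -
    have "GDERIV (\<lambda>_. 0) x :> d\<psi> x"
      by (rule GDERIV_transform_open[OF D, of "- K"])
        (use that K in \<open>auto simp: compact_imp_closed open_Compl\<close>)
    then show ?thesis using GDERIV_unique[OF _ GDERIV_const] by blast
  qed
  have c: "continuous_on UNIV \<psi>"
    using D GDERIV_continuous by (metis continuous_at_imp_continuous_on)
  have "bounded (\<psi> ` K)" "bounded (d\<psi> ` K)"
    using K(1) c cd compact_continuous_image compact_imp_bounded continuous_on_subset subset_UNIV by metis+
  then obtain B1 B2 where B: "\<And>x. x \<in> K \<Longrightarrow> \<bar>\<psi> x\<bar> \<le> B1" "\<And>x. x \<in> K \<Longrightarrow> norm (d\<psi> x) \<le> B2"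
    unfolding bounded_iff by (metis image_eqI real_norm_def)
  let ?B = "max 0 (max B1 B2)"
  show thesis
  proof (rule that[of K ?B])
    show "\<bar>\<psi> x\<bar> \<le> ?B" for x using B(1)[of x] K(3)[of x] by (cases "x \<in> K") auto
    show "norm (d\<psi> x) \<le> ?B" for x using B(2)[of x] d0[of x] by (cases "x \<in> K") auto
  qed (use K d0 in auto)
qed

lemma test_function_continuous:
  assumes "test_function V \<psi> d\<psi>"
  shows "continuous_on UNIV \<psi>" "continuous_on UNIV d\<psi>"
    "\<psi> \<in> borel_measurable borel" "d\<psi> \<in> borel_measurable borel"
proof -
  show 1: "continuous_on UNIV \<psi>"
    using assms GDERIV_continuous unfolding test_function_def by (metis continuous_at_imp_continuous_on)
  show 2: "continuous_on UNIV d\<psi>" using assms unfolding test_function_def by blast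
  show "\<psi> \<in> borel_measurable borel" "d\<psi> \<in> borel_measurable borel"
    using 1 2 by (auto intro: borel_measurable_continuous_onI)
qed

lemma integrable_bounded_support:
  fixes f :: "'a::euclidean_space \<Rightarrow> 'b::{banach,second_countable_topology}"
  assumes "f \<in> borel_measurable borel" "bounded S" "\<And>x. norm (f x) \<le> B" "\<And>x. x \<notin> S \<Longrightarrow> f x = 0"
  shows "integrable lborel f"
proof -
  obtain r where r: "S \<subseteq> cball 0 r" using bounded_subset_ballD[OF assms(2), of 0] ball_subset_cball by (metis subset_trans)
  show ?thesis
  proof (rule integrableI_bounded_set[where A="cball 0 r" and B=B])
    show "emeasure lborel (cball (0::'a) r) < \<infinity>" by (rule emeasure_bounded_finite) simp
    show "AE x in lborel. x \<in> cball 0 r \<longrightarrow> norm (f x) \<le> B" using assms(3) by simp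
    show "AE x in lborel. x \<notin> cball 0 r \<longrightarrow> f x = 0" using assms(4) r by blast
  qed (use assms(1) in simp_all)
qed

text \<open>The factor \<open>u\<close> need only be differentiable on \<open>V\<close>: off the compact support of \<open>\<eta>\<close> the product is
  locally zero, so its extension by zero is again of class $C^1$.\<close>

lemma test_function_mult:
  assumes "test_function V \<eta> d\<eta>" "open V"
    and D: "\<And>x. x \<in> V \<Longrightarrow> GDERIV u x :> g x" and cg: "continuous_on V g"
  shows "test_function V (\<lambda>x. if x \<in> V then \<eta> x * u x else 0)
           (\<lambda>x. if x \<in> V then \<eta> x *\<^sub>R g x + u x *\<^sub>R d\<eta> x else 0)"
proof -
  obtain K B where K: "compact K" "K \<subseteq> V" "\<And>x. x \<notin> K \<Longrightarrow> \<eta> x = 0" "\<And>x. x \<notin> K \<Longrightarrow> d\<eta> x = 0"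
    using assms(1) by (rule test_functionE) blast
  let ?f = "\<lambda>x. if x \<in> V then \<eta> x * u x else 0"
  let ?g = "\<lambda>x. if x \<in> V then \<eta> x *\<^sub>R g x + u x *\<^sub>R d\<eta> x else 0"
  have oK: "open (- K)" using K(1) compact_imp_closed by blast
  have cov: "x \<in> V \<or> x \<in> - K" for x using K(2) by blast
  have D\<eta>: "GDERIV \<eta> x :> d\<eta> x" for x using assms(1) unfolding test_function_def by blast
  have zero: "?f x = 0 \<and> ?g x = 0" if "x \<in> - K" for x using that K by auto
  have "GDERIV ?f x :> ?g x" for x
  proof (cases "x \<in> V")
    case True
    have "GDERIV ?f x :> \<eta> x *\<^sub>R g x + u x *\<^sub>R d\<eta> x"
      by (rule GDERIV_transform_open[OF GDERIV_mult[OF D\<eta> D[OF True]] assms(2) True]) auto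
    then show ?thesis using True by simp
  next
    case False
    have "GDERIV ?f x :> 0"
      by (rule GDERIV_transform_open[OF GDERIV_const oK, of _ 0]) (use False K zero in auto)
    then show ?thesis using False by simp
  qed
  moreover have "continuous_on UNIV ?g"
  proof -
    have u: "continuous_on V u" using D GDERIV_continuous continuous_at_imp_continuous_on by metis
    have 1: "continuous_on V ?g"
    proof -
      have "continuous_on V (\<lambda>x. \<eta> x *\<^sub>R g x + u x *\<^sub>R d\<eta> x)"
        using test_function_continuous[OF assms(1)] u cg
        by (intro continuous_intros) (auto intro: continuous_on_subset)
      then show ?thesis by (rule continuous_on_eq) auto
    qed
    have 2: "continuous_on (- K) ?g"
      by (rule continuous_on_eq[of _ "\<lambda>_. 0"]) (use zero in auto)
    have "continuous_on (V \<union> - K) ?g"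
      using continuous_on_open_Un[OF assms(2) oK 1 2] .
    moreover have "V \<union> - K = UNIV" using cov by blast
    ultimately show ?thesis by simp
  qed
  moreover have "\<forall>x. x \<notin> K \<longrightarrow> ?f x = 0" using K by auto
  ultimately show ?thesis unfolding test_function_def using K by blast
qed

text \<open>Translation by a unit vector \<open>e\<close> does not change the integral of \<open>\<psi>\<close>, and the increment of \<open>\<psi>\<close> is
  the integral of its derivative along the segment; exchange the integrals.\<close>

lemma integral_gradient_zero:
  fixes \<psi> :: "'a::euclidean_space \<Rightarrow> real"
  assumes T: "test_function V \<psi> d\<psi>"
  shows "(\<integral>x. d\<psi> x \<partial>lborel) = 0"
proof (rule euclidean_eqI)
  fix e :: 'a assume "e \<in> Basis"
  obtain K B where K: "compact K" "\<And>x. x \<notin> K \<Longrightarrow> \<psi> x = 0" "\<And>x. x \<notin> K \<Longrightarrow> d\<psi> x = 0"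
    "\<And>x. \<bar>\<psi> x\<bar> \<le> B" "\<And>x. norm (d\<psi> x) \<le> B" "0 \<le> B"
    using T by (rule test_functionE) blast
  note c = test_function_continuous[OF T]
  note [measurable] = c(3,4)
  have bK: "bounded K" using K(1) compact_imp_bounded by blast
  then obtain M where M: "\<And>x. x \<in> K \<Longrightarrow> norm x \<le> M" unfolding bounded_iff by blast
  have int\<psi>: "integrable lborel \<psi>"
    by (rule integrable_bounded_support[where S=K and B=B]) (use K bK in auto)
  have intd: "integrable lborel d\<psi>"
    by (rule integrable_bounded_support[where S=K and B=B]) (use K bK in auto)
  have tr: "(\<integral>x. f (a + x) \<partial>lborel) = (\<integral>x. f x \<partial>lborel)" if "f \<in> borel_measurable borel" for f :: "'a \<Rightarrow> real" and a
    using that by (subst (2) lborel_distr_plus[symmetric, of a]) (subst integral_distr, auto)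
  have tri: "integrable lborel (\<lambda>x. f (a + x))" if "integrable lborel f" for f :: "'a \<Rightarrow> real" and a
    using that borel_measurable_integrable[OF that]
    by (subst (asm) (1) lborel_distr_plus[symmetric, of a]) (subst (asm) integrable_distr_eq, auto)
  define G where "G = (\<lambda>(t::real, x). indicator {0..1} t * (d\<psi> (t *\<^sub>R e + x) \<bullet> e))"
  have Gm[measurable]: "G \<in> borel_measurable borel"
  proof -
    have "(\<lambda>p::real\<times>'a. d\<psi> (fst p *\<^sub>R e + snd p) \<bullet> e) \<in> borel_measurable borel"
      by (intro borel_measurable_continuous_onI continuous_intros continuous_on_compose2[OF c(2)]) auto
    moreover have "(\<lambda>p::real\<times>'a. indicator {0..1} (fst p) :: real) \<in> borel_measurable borel"
      by (simp add: borel_prod[symmetric])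
    ultimately show ?thesis unfolding G_def split_beta by (intro borel_measurable_times)
  qed
  have Gi: "integrable (lborel \<Otimes>\<^sub>M lborel) G"
    unfolding lborel_prod
  proof (rule integrable_bounded_support[where S="{0..1} \<times> cball 0 (M + norm e)" and B="B * norm e"])
    show "G \<in> borel_measurable borel" by measurable
    show "bounded ({0..1::real} \<times> cball (0::'a) (M + norm e))" by (simp add: bounded_Times)
    show "norm (G p) \<le> B * norm e" for p
    proof -
      have "\<bar>d\<psi> y \<bullet> e\<bar> \<le> B * norm e" for y
        using order_trans[OF Cauchy_Schwarz_ineq2 mult_right_mono[OF K(5)]] by auto
      moreover have "0 \<le> B * norm e" using K(6) by simp
      ultimately show ?thesis by (cases p) (auto simp: G_def indicator_def)
    qed
    show "G p = 0" if "p \<notin> {0..1} \<times> cball 0 (M + norm e)" for p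
    proof -
      obtain t x where p: "p = (t, x)" by fastforce
      show ?thesis
      proof (cases "t \<in> {0..1}")
        case True
        then have "norm x > M + norm e" using that p by auto
        moreover have "norm (t *\<^sub>R e) \<le> norm e" using True by (simp add: mult_left_le_one_le)
        moreover have "norm x \<le> norm (t *\<^sub>R e + x) + norm (t *\<^sub>R e)"
          by (metis add_diff_cancel_left' norm_triangle_ineq4)
        ultimately have "norm (t *\<^sub>R e + x) > M" by linarith
        then have "t *\<^sub>R e + x \<notin> K" using M by force
        then show ?thesis using K(3) by (simp add: p G_def)
      qed (simp add: p G_def)
    qed
  qed
  have inner1: "(\<integral>t. G (t, x) \<partial>lborel) = \<psi> (e + x) - \<psi> x" for x
  proof -
    have "((\<lambda>t. \<psi> (t *\<^sub>R e + x)) has_real_derivative d\<psi> (t *\<^sub>R e + x) \<bullet> e) (at t)" for t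
    proof -
      have D: "(\<psi> has_derivative (\<lambda>h. h \<bullet> d\<psi> (t *\<^sub>R e + x))) (at (t *\<^sub>R e + x))"
        using T unfolding test_function_def gderiv_def by blast
      have "((\<lambda>t. t *\<^sub>R e + x) has_derivative (\<lambda>h. h *\<^sub>R e)) (at t)"
        by (auto intro!: derivative_eq_intros)
      from has_derivative_compose[OF this D]
      show ?thesis unfolding has_field_derivative_def
        by (rule has_derivative_subst) (auto simp: inner_commute)
    qed
    then have "(\<integral>t. (d\<psi> (t *\<^sub>R e + x) \<bullet> e) * indicator {0..1} t \<partial>lborel) = \<psi> (1 *\<^sub>R e + x) - \<psi> (0 *\<^sub>R e + x)"
      by (intro integral_FTC_Icc_real)
        (auto intro!: continuous_intros continuous_on_compose2[OF c(2)] simp: continuous_on_eq_continuous_at[symmetric]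
           intro: continuous_on_interior)
    then show ?thesis by (simp add: G_def mult.commute)
  qed
  have inner2: "(\<integral>x. G (t, x) \<partial>lborel) = indicator {0..1} t * (\<integral>x. d\<psi> x \<bullet> e \<partial>lborel)" for t
    unfolding G_def using tr[of "\<lambda>x. d\<psi> x \<bullet> e" "t *\<^sub>R e"] by simp
  have "(\<integral>x. d\<psi> x \<bullet> e \<partial>lborel) = (\<integral>t. \<integral>x. G (t, x) \<partial>lborel \<partial>lborel)"
    unfolding inner2 by simp
  also have "\<dots> = (\<integral>x. \<integral>t. G (t, x) \<partial>lborel \<partial>lborel)"
    using lborel_pair.Fubini_integral[of "\<lambda>t x. G (t, x)"] Gi by simp
  also have "\<dots> = 0"
    unfolding inner1 by (subst Bochner_Integration.integral_diff) (use int\<psi> tri tr c in auto)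
  finally show "(\<integral>x. d\<psi> x \<partial>lborel) \<bullet> e = 0 \<bullet> e"
    using intd by simp
qed

lemma test_function_integrable:
  fixes \<psi> :: "'a::euclidean_space \<Rightarrow> real"
  assumes T: "test_function V \<psi> d\<psi>"
  shows "integrable lborel \<psi>" "integrable lborel d\<psi>"
    "X \<in> borel_measurable borel \<Longrightarrow> (\<And>x. \<bar>X x\<bar> \<le> M) \<Longrightarrow> integrable lborel (\<lambda>x. X x * \<psi> x)"
    "X \<in> borel_measurable borel \<Longrightarrow> (\<And>x. \<bar>X x\<bar> \<le> M) \<Longrightarrow> integrable lborel (\<lambda>x. X x *\<^sub>R d\<psi> x)"
proof -
  obtain K B where K: "compact K" "\<And>x. x \<notin> K \<Longrightarrow> \<psi> x = 0" "\<And>x. x \<notin> K \<Longrightarrow> d\<psi> x = 0"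
    "\<And>x. \<bar>\<psi> x\<bar> \<le> B" "\<And>x. norm (d\<psi> x) \<le> B" "0 \<le> B"
    using T by (rule test_functionE) blast
  note [measurable] = test_function_continuous(3,4)[OF T]
  have bK: "bounded K" using K(1) compact_imp_bounded by blast
  show "integrable lborel \<psi>"
    by (rule integrable_bounded_support[where S=K and B=B]) (use K bK in auto)
  show "integrable lborel d\<psi>"
    by (rule integrable_bounded_support[where S=K and B=B]) (use K bK in auto)
  assume [measurable]: "X \<in> borel_measurable borel" and M: "\<And>x. \<bar>X x\<bar> \<le> M"
  have "0 \<le> M" using M[of 0] by linarith
  then show "integrable lborel (\<lambda>x. X x * \<psi> x)"
    by (intro integrable_bounded_support[where S=K and B="M * B"])
      (use K bK M in \<open>auto simp: abs_mult intro!: mult_mono\<close>)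
  show "integrable lborel (\<lambda>x. X x *\<^sub>R d\<psi> x)"
    by (intro integrable_bounded_support[where S=K and B="M * B"])
      (use K bK M \<open>0 \<le> M\<close> in \<open>auto intro!: mult_mono\<close>)
qed

lemma integration_by_parts:
  fixes \<psi> :: "'a::euclidean_space \<Rightarrow> real"
  assumes "test_function V \<psi> d\<psi>" "test_function W \<phi> d\<phi>"
  shows "(\<integral>x. \<phi> x *\<^sub>R d\<psi> x \<partial>lborel) = - (\<integral>x. \<psi> x *\<^sub>R d\<phi> x \<partial>lborel)"
proof -
  have T: "test_function UNIV \<psi> d\<psi>" using assms(1) test_function_mono by blast
  obtain B1 where B1: "\<And>x. \<bar>\<psi> x\<bar> \<le> B1" using assms(1) by (rule test_functionE) blast
  obtain B2 where B2: "\<And>x. \<bar>\<phi> x\<bar> \<le> B2" using assms(2) by (rule test_functionE) blast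
  have "test_function UNIV (\<lambda>x. \<psi> x * \<phi> x) (\<lambda>x. \<psi> x *\<^sub>R d\<phi> x + \<phi> x *\<^sub>R d\<psi> x)"
    using test_function_mult[OF T, of \<phi> d\<phi>] assms(2) unfolding test_function_def by simp
  from integral_gradient_zero[OF this]
  show ?thesis
    by (subst (asm) Bochner_Integration.integral_add)
      (use test_function_integrable(4)[OF assms(1) _ B2] test_function_integrable(4)[OF assms(2) _ B1]
          test_function_continuous[OF assms(1)] test_function_continuous[OF assms(2)] in \<open>auto simp: eq_neg_iff_add_eq_0 add.commute\<close>)
qed

lemma real_polynomial_function_GDERIV:
  fixes f :: "'a::euclidean_space \<Rightarrow> real"
  assumes "real_polynomial_function f"
  shows "\<exists>df. (\<forall>x. GDERIV f x :> df x) \<and> continuous_on UNIV df"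
  using assms
proof induction
  case (linear f)
  let ?v = "\<Sum>b\<in>Basis. f b *\<^sub>R b"
  have "f h = h \<bullet> ?v" for h
  proof -
    have "f h = f (\<Sum>b\<in>Basis. (h \<bullet> b) *\<^sub>R b)" by (simp add: euclidean_representation)
    also have "\<dots> = (\<Sum>b\<in>Basis. (h \<bullet> b) * f b)"
      using linear by (simp add: linear_sum bounded_linear.linear linear_scale)
    finally show ?thesis by (simp add: inner_sum_right mult.commute)
  qed
  then have eq: "f = (\<lambda>h. h \<bullet> ?v)" by blast
  have "GDERIV f x :> ?v" for x
    unfolding gderiv_def using bounded_linear_imp_has_derivative[OF linear] eq by metis
  then show ?case by (intro exI[of _ "\<lambda>_. ?v"]) auto
next
  case (const c)
  show ?case by (intro exI[of _ "\<lambda>_. 0"]) (auto intro: GDERIV_const)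
next
  case (add f g)
  then obtain df dg where "\<forall>x. GDERIV f x :> df x" "continuous_on UNIV df"
    "\<forall>x. GDERIV g x :> dg x" "continuous_on UNIV dg" by blast
  then show ?case
    by (intro exI[of _ "\<lambda>x. df x + dg x"]) (auto intro!: GDERIV_add continuous_intros)
next
  case (mult f g)
  then obtain df dg where *: "\<forall>x. GDERIV f x :> df x" "continuous_on UNIV df"
    "\<forall>x. GDERIV g x :> dg x" "continuous_on UNIV dg" by blast
  have "continuous_on UNIV f" "continuous_on UNIV g"
    using * GDERIV_continuous continuous_at_imp_continuous_on by metis+
  then show ?case using *
    by (intro exI[of _ "\<lambda>x. f x *\<^sub>R dg x + g x *\<^sub>R df x"]) (auto intro!: GDERIV_mult continuous_intros)
qed

lemma DERIV_positive_part_square: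
  "((\<lambda>t::real. (max 0 t)\<^sup>2) has_real_derivative 2 * max 0 t) (at t)"
proof -
  consider "t < 0" | "t > 0" | "t = 0" by linarith
  then show ?thesis
  proof cases
    case 1
    have "((\<lambda>t::real. (max 0 t)\<^sup>2) has_real_derivative 0) (at t)"
      by (rule DERIV_cong_ev[THEN iffD2, OF refl _ refl, of _ "\<lambda>_. 0"])
        (use 1 in \<open>auto intro!: eventually_mono[OF eventually_nhds_in_open[of "{..<0}"]]\<close>)
    then show ?thesis using 1 by simp
  next
    case 2
    have "((\<lambda>t::real. (max 0 t)\<^sup>2) has_real_derivative 2 * t) (at t)"
      by (rule DERIV_cong_ev[THEN iffD2, OF refl _ refl, of _ "\<lambda>t. t\<^sup>2"])
        (use 2 in \<open>auto intro!: derivative_eq_intros eventually_mono[OF eventually_nhds_in_open[of "{0<..}"]]\<close>)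
    then show ?thesis using 2 by simp
  next
    case 3
    have "(\<lambda>h::real. ((max 0 (0 + h))\<^sup>2 - (max 0 0)\<^sup>2) / h) \<midarrow>0\<rightarrow> 0"
    proof (rule tendsto_sandwich[of "\<lambda>h. - \<bar>h\<bar>" _ _ "\<lambda>h. \<bar>h\<bar>"])
      show "\<forall>\<^sub>F h in at 0. - \<bar>h\<bar> \<le> ((max 0 (0 + h))\<^sup>2 - (max 0 0)\<^sup>2) / (h::real)"
        by (intro always_eventually allI) (auto simp: max_def power2_eq_square)
      show "\<forall>\<^sub>F h in at 0. ((max 0 (0 + h))\<^sup>2 - (max 0 0)\<^sup>2) / (h::real) \<le> \<bar>h\<bar>"
        by (intro always_eventually allI) (auto simp: max_def power2_eq_square)
    qed (auto intro!: tendsto_eq_intros)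
    then show ?thesis using 3 by (simp add: DERIV_def)
  qed
qed

lemma GDERIV_dist_square: "GDERIV (\<lambda>x::'a::euclidean_space. (dist c x)\<^sup>2) x :> 2 *\<^sub>R (x - c)"
  unfolding gderiv_def dist_norm power2_norm_eq_inner
  by (auto intro!: derivative_eq_intros simp: inner_diff_left inner_diff_right inner_commute algebra_simps)

text \<open>The square of a positive part is of class $C^1$, so no smooth gluing is required.\<close>

lemma test_function_bump:
  fixes c :: "'a::euclidean_space"
  assumes "cball c r \<subseteq> V" "0 < r"
  shows "test_function V (\<lambda>x. (max 0 (r\<^sup>2 - (dist c x)\<^sup>2))\<^sup>2)
           (\<lambda>x. (2 * max 0 (r\<^sup>2 - (dist c x)\<^sup>2)) *\<^sub>R (0 - 2 *\<^sub>R (x - c)))"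
  unfolding test_function_def
proof (intro conjI allI exI[of _ "cball c r"])
  show "GDERIV (\<lambda>x. (max 0 (r\<^sup>2 - (dist c x)\<^sup>2))\<^sup>2) x :> (2 * max 0 (r\<^sup>2 - (dist c x)\<^sup>2)) *\<^sub>R (0 - 2 *\<^sub>R (x - c))" for x
    by (rule GDERIV_DERIV_compose[OF GDERIV_diff[OF GDERIV_const GDERIV_dist_square] DERIV_positive_part_square])
  show "continuous_on UNIV (\<lambda>x. (2 * max 0 (r\<^sup>2 - (dist c x)\<^sup>2)) *\<^sub>R (0 - 2 *\<^sub>R (x - c)))"
    by (intro continuous_intros)
  have "r\<^sup>2 \<le> (dist c x)\<^sup>2" if "x \<notin> cball c r" for x
    using that assms(2) by (intro power_mono) auto
  then show "x \<notin> cball c r \<longrightarrow> (max 0 (r\<^sup>2 - (dist c x)\<^sup>2))\<^sup>2 = 0" for x by auto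
qed (use assms in auto)

section \<open>Weak gradients\<close>

lemma set_integral_eq_integral_if_vanishing:
  fixes F :: "'a \<Rightarrow> 'b::{banach, second_countable_topology}"
  assumes "\<And>x. x \<notin> V \<Longrightarrow> F x = 0"
  shows "(LINT x:V|M. F x) = (LINT x|M. F x)"
  unfolding set_lebesgue_integral_def
  by (intro Bochner_Integration.integral_cong) (use assms in \<open>auto simp: indicator_def\<close>)

lemma test_function_vanishes:
  fixes \<psi> :: "'a::euclidean_space \<Rightarrow> real"
  assumes "test_function V \<psi> d\<psi>" "x \<notin> V"
  shows "\<psi> x = 0" "d\<psi> x = 0"
proof -
  obtain K where "K \<subseteq> V" "\<And>x. x \<notin> K \<Longrightarrow> \<psi> x = 0" "\<And>x. x \<notin> K \<Longrightarrow> d\<psi> x = 0"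
    using assms(1) by (rule test_functionE) blast
  then show "\<psi> x = 0" "d\<psi> x = 0" using assms(2) by blast+
qed

lemma test_function_LINT:
  fixes h :: "'a::euclidean_space \<Rightarrow> 'b::{banach, second_countable_topology}"
  assumes "test_function V \<psi> d\<psi>"
  shows "(LINT x:V|lebesgue. \<psi> x *\<^sub>R h x) = (LINT x|lebesgue. \<psi> x *\<^sub>R h x)"
    "(LINT x:V|lebesgue. u x *\<^sub>R d\<psi> x) = (LINT x|lebesgue. u x *\<^sub>R d\<psi> x)"
proof -
  have "\<psi> x = 0 \<and> d\<psi> x = 0" if "x \<notin> V" for x
    using test_function_vanishes[OF assms that] by blast
  then show "(LINT x:V|lebesgue. \<psi> x *\<^sub>R h x) = (LINT x|lebesgue. \<psi> x *\<^sub>R h x)"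
    "(LINT x:V|lebesgue. u x *\<^sub>R d\<psi> x) = (LINT x|lebesgue. u x *\<^sub>R d\<psi> x)"
    by (auto intro!: set_integral_eq_integral_if_vanishing)
qed

lemma lebesgue_measurable_borel: "f \<in> borel_measurable borel \<Longrightarrow> f \<in> borel_measurable lebesgue"
  by (simp add: measurable_completion)

lemma locally_integrable_test:
  fixes h :: "'a::euclidean_space \<Rightarrow> 'b::{banach, second_countable_topology}"
  assumes h: "locally_integrable V h" and T: "test_function V \<psi> d\<psi>"
  shows "integrable lebesgue (\<lambda>x. \<psi> x *\<^sub>R h x)"
proof -
  obtain K B where K: "compact K" "K \<subseteq> V" "\<And>x. x \<notin> K \<Longrightarrow> \<psi> x = 0" "\<And>x. \<bar>\<psi> x\<bar> \<le> B" "0 \<le> B"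
    using T by (rule test_functionE) blast
  have i: "integrable lebesgue (\<lambda>x. indicator K x *\<^sub>R h x)"
    using h K(1,2) unfolding locally_integrable_def set_integrable_def by blast
  have m: "\<psi> \<in> borel_measurable lebesgue"
    using test_function_continuous(3)[OF T] by (rule lebesgue_measurable_borel)
  have eq: "\<psi> x *\<^sub>R h x = \<psi> x *\<^sub>R (indicator K x *\<^sub>R h x)" for x
    using K(3)[of x] by (cases "x \<in> K") auto
  have "integrable lebesgue (\<lambda>x. \<psi> x *\<^sub>R (indicator K x *\<^sub>R h x))"
  proof (rule Bochner_Integration.integrable_bound)
    show "integrable lebesgue (\<lambda>x. B *\<^sub>R norm (indicator K x *\<^sub>R h x))"
      by (intro integrable_scaleR_right integrable_norm i)
    show "(\<lambda>x. \<psi> x *\<^sub>R (indicator K x *\<^sub>R h x)) \<in> borel_measurable lebesgue"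
      using m borel_measurable_integrable[OF i] by (rule borel_measurable_scaleR)
    show "AE x in lebesgue. norm (\<psi> x *\<^sub>R (indicator K x *\<^sub>R h x)) \<le> norm (B *\<^sub>R norm (indicator K x *\<^sub>R h x))"
      using K(4,5) by (intro AE_I2) (auto simp: indicator_def intro!: mult_right_mono)
  qed
  then show ?thesis unfolding eq[symmetric] .
qed

text \<open>By Lindelof's theorem countably many balls suffice to cover \<open>V\<close>.\<close>

lemma AE_open_from_balls:
  fixes V :: "'a::euclidean_space set"
  assumes "open V" "\<And>c r. 0 < r \<Longrightarrow> cball c r \<subseteq> V \<Longrightarrow> AE x\<in>ball c r in lebesgue. P x"
  shows "AE x\<in>V in lebesgue. P x"
proof -
  let ?F = "{ball c r | c r. 0 < r \<and> cball c r \<subseteq> V}"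
  have un: "\<Union>?F = V"
  proof
    show "V \<subseteq> \<Union>?F"
    proof
      fix x assume "x \<in> V"
      then obtain r where "r > 0" "cball x r \<subseteq> V" using assms(1) open_contains_cball by blast
      then show "x \<in> \<Union>?F" by (intro UnionI[of "ball x r"]) auto
    qed
  qed (use ball_subset_cball in blast)
  obtain F' where F': "F' \<subseteq> ?F" "countable F'" "\<Union>F' = \<Union>?F"
    by (rule Lindelof[of ?F]) auto
  have "AE x in lebesgue. \<forall>S\<in>F'. x \<in> S \<longrightarrow> P x"
    using F'(1,2) assms(2) by (subst AE_ball_countable) blast+
  then show ?thesis
    by (rule AE_mp) (use F'(3) un in \<open>auto intro!: AE_I2\<close>)
qed

text \<open>The fundamental lemma of the calculus of variations. On a ball the sign of \<open>h\<close> is an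
  almost everywhere limit of continuous functions, hence of polynomials; multiplied by a bump these
  are test functions.\<close>

lemma fundamental_lemma_real:
  fixes h :: "'a::euclidean_space \<Rightarrow> real"
  assumes V: "open V" and h: "locally_integrable V h"
    and zero: "\<And>\<psi> d\<psi>. test_function V \<psi> d\<psi> \<Longrightarrow> (LINT x|lebesgue. \<psi> x * h x) = 0"
  shows "AE x\<in>V in lebesgue. h x = 0"
proof (rule AE_open_from_balls[OF V])
  fix c :: 'a and r :: real assume r: "0 < r" "cball c r \<subseteq> V"
  let ?K = "cball c r"
  define H where "H = (\<lambda>x. indicator ?K x * h x)"
  have Hi: "integrable lebesgue H"
    using h r unfolding locally_integrable_def set_integrable_def H_def by simp
  then have Hm: "H \<in> borel_measurable lebesgue" by simp
  define b where "b = (\<lambda>x. (max 0 (r\<^sup>2 - (dist c x)\<^sup>2))\<^sup>2)"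
  obtain db where b: "test_function V b db" using test_function_bump[OF r(2,1)] unfolding b_def by blast
  obtain B where B: "\<And>x. \<bar>b x\<bar> \<le> B" "0 \<le> B" using b by (rule test_functionE) blast
  have b0: "b x = 0" if "x \<notin> ?K" for x
  proof -
    have "r\<^sup>2 \<le> (dist c x)\<^sup>2" using that r by (intro power_mono) auto
    then show ?thesis by (simp add: b_def)
  qed
  have bm: "b \<in> borel_measurable lebesgue"
    using test_function_continuous(3)[OF b] by (rule lebesgue_measurable_borel)
  have "(\<lambda>x. sgn (H x)) \<in> borel_measurable lebesgue" using Hm by simp
  then have "(\<lambda>x. sgn (H x)) measurable_on UNIV"
    using measurable_on_iff_borel_measurable[of UNIV "\<lambda>x. sgn (H x)"] by simp
  then obtain N g where N: "negligible N" and g: "\<And>n. continuous_on UNIV (g n)"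
    and lim: "\<And>x. x \<notin> N \<Longrightarrow> (\<lambda>n. g n x) \<longlonglongrightarrow> sgn (H x)"
    unfolding measurable_on_def by auto
  define G where "G = (\<lambda>n x. max (-1) (min 1 (g n x)))"
  have Gc: "continuous_on ?K (G n)" for n
    unfolding G_def using continuous_on_subset[OF g[of n]] by (intro continuous_intros) auto
  (* after truncation to [-1, 1] the approximating polynomials are bounded by 2 on the ball *)
  have "\<forall>n. \<exists>q. real_polynomial_function q \<and> (\<forall>x\<in>?K. \<bar>G n x - q x\<bar> < 1 / real (Suc n))"
    using Stone_Weierstrass_real_polynomial_function[OF compact_cball Gc]
    by (metis of_nat_0_less_iff zero_less_Suc zero_less_divide_1_iff)
  then obtain q where q: "\<And>n. real_polynomial_function (q n)"
      "\<And>n x. x \<in> ?K \<Longrightarrow> \<bar>G n x - q n x\<bar> < 1 / real (Suc n)" by metis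
  have qm: "q n \<in> borel_measurable lebesgue" for n
    using q(1) continuous_on_polymonial_function real_polynomial_function_eq
    by (metis borel_measurable_continuous_onI lebesgue_measurable_borel)
  have int0: "(LINT x|lebesgue. (b x * q n x) * H x) = 0" for n
  proof -
    obtain dq where dq: "\<And>x. GDERIV (q n) x :> dq x" "continuous_on UNIV dq"
      using real_polynomial_function_GDERIV[OF q(1)] by blast
    obtain d where "test_function V (\<lambda>x. if x \<in> V then b x * q n x else 0) d"
      using test_function_mult[OF b V, of "q n" dq] dq continuous_on_subset by blast
    moreover have "(\<lambda>x. if x \<in> V then b x * q n x else 0) = (\<lambda>x. b x * q n x)"
      using b0 r(2) by fastforce
    ultimately have "(LINT x|lebesgue. (b x * q n x) * h x) = 0" using zero by metis
    moreover have "(b x * q n x) * h x = (b x * q n x) * H x" for x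
      unfolding H_def using b0[of x] by (cases "x \<in> ?K") auto
    ultimately show ?thesis by simp
  qed
  have "(\<lambda>n. LINT x|lebesgue. (b x * q n x) * H x) \<longlonglongrightarrow> (LINT x|lebesgue. b x * \<bar>H x\<bar>)"
  proof (rule integral_dominated_convergence[where w="\<lambda>x. (B * 2) * \<bar>H x\<bar>"])
    show "(\<lambda>x. b x * \<bar>H x\<bar>) \<in> borel_measurable lebesgue" using bm Hm by measurable
    show "(\<lambda>x. (b x * q n x) * H x) \<in> borel_measurable lebesgue" for n using bm Hm qm by measurable
    show "integrable lebesgue (\<lambda>x. (B * 2) * \<bar>H x\<bar>)" using Hi by simp
    show "AE x in lebesgue. norm ((b x * q n x) * H x) \<le> (B * 2) * \<bar>H x\<bar>" for n
    proof (rule AE_I2)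
      fix x
      show "norm ((b x * q n x) * H x) \<le> (B * 2) * \<bar>H x\<bar>"
      proof (cases "x \<in> ?K")
        case True
        have "\<bar>G n x\<bar> \<le> 1" unfolding G_def by auto
        moreover have "1 / real (Suc n) \<le> 1" by simp
        ultimately have "\<bar>q n x\<bar> \<le> 2" using q(2)[OF True, of n] by linarith
        then have "\<bar>b x\<bar> * \<bar>q n x\<bar> \<le> B * 2" using B by (intro mult_mono) auto
        then show ?thesis by (auto simp: abs_mult intro!: mult_right_mono)
      qed (simp add: H_def)
    qed
    have "AE x in lebesgue. x \<notin> N"
      using N by (simp add: AE_not_in negligible_iff_null_sets)
    then show "AE x in lebesgue. (\<lambda>n. (b x * q n x) * H x) \<longlonglongrightarrow> b x * \<bar>H x\<bar>"
    proof (rule AE_mp, intro AE_I2 impI)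
      fix x assume x: "x \<notin> N"
      show "(\<lambda>n. (b x * q n x) * H x) \<longlonglongrightarrow> b x * \<bar>H x\<bar>"
      proof (cases "x \<in> ?K")
        case True
        have "(\<lambda>n. G n x) \<longlonglongrightarrow> max (-1) (min 1 (sgn (H x)))"
          unfolding G_def by (intro tendsto_intros lim x)
        moreover have "max (-1) (min 1 (sgn (H x))) = sgn (H x)" by (auto simp: sgn_if)
        ultimately have G: "(\<lambda>n. G n x) \<longlonglongrightarrow> sgn (H x)" by simp
        have "(\<lambda>n. G n x - q n x) \<longlonglongrightarrow> 0"
        proof (rule tendsto_rabs_zero_cancel, rule tendsto_sandwich[of "\<lambda>_. 0"])
          show "\<forall>\<^sub>F n in sequentially. \<bar>G n x - q n x\<bar> \<le> 1 / real (Suc n)"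
            using q(2)[OF True] by (intro always_eventually) (auto intro: less_imp_le)
          show "(\<lambda>n. 1 / real (Suc n)) \<longlonglongrightarrow> 0" by real_asymp
        qed auto
        from tendsto_diff[OF G this] have "(\<lambda>n. q n x) \<longlonglongrightarrow> sgn (H x)" by simp
        then have "(\<lambda>n. (b x * q n x) * H x) \<longlonglongrightarrow> (b x * sgn (H x)) * H x"
          by (intro tendsto_intros)
        moreover have "(b x * sgn (H x)) * H x = b x * \<bar>H x\<bar>" by (simp add: abs_sgn mult.commute mult.left_commute)
        ultimately show ?thesis by simp
      qed (simp add: H_def)
    qed
  qed
  then have eq0: "(LINT x|lebesgue. b x * \<bar>H x\<bar>) = 0"
    using int0 by (simp add: LIMSEQ_const_iff)
  have "integrable lebesgue (\<lambda>x. b x * \<bar>H x\<bar>)"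
    by (rule Bochner_Integration.integrable_bound[where f="\<lambda>x. B * \<bar>H x\<bar>"])
      (use Hi Hm bm B in \<open>auto simp: abs_mult intro!: mult_right_mono\<close>)
  moreover have "AE x in lebesgue. 0 \<le> b x * \<bar>H x\<bar>" by (simp add: b_def)
  ultimately have "AE x in lebesgue. b x * \<bar>H x\<bar> = 0"
    using eq0 integral_nonneg_eq_0_iff_AE by blast
  then show "AE x\<in>ball c r in lebesgue. h x = 0"
  proof (rule AE_mp, intro AE_I2 impI)
    fix x assume "b x * \<bar>H x\<bar> = 0" "x \<in> ball c r"
    moreover from this(2) have "(dist c x)\<^sup>2 < r\<^sup>2" by (intro power_strict_mono) auto
    ultimately show "h x = 0" by (auto simp: b_def H_def)
  qed
qed

lemma locally_integrable_inner:
  fixes h :: "'a::euclidean_space \<Rightarrow> 'b::euclidean_space"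
  assumes "locally_integrable V h" shows "locally_integrable V (\<lambda>x. h x \<bullet> e)"
proof -
  have "integrable lebesgue (\<lambda>x. indicator K x *\<^sub>R (h x \<bullet> e))" if "compact K" "K \<subseteq> V" for K
  proof -
    have "integrable lebesgue (\<lambda>x. (indicator K x *\<^sub>R h x) \<bullet> e)"
      using assms that unfolding locally_integrable_def set_integrable_def
      by (intro integrable_inner_left) blast
    then show ?thesis by simp
  qed
  then show ?thesis unfolding locally_integrable_def set_integrable_def by blast
qed

lemma fundamental_lemma:
  fixes h :: "'a::euclidean_space \<Rightarrow> 'b::euclidean_space"
  assumes V: "open V" and h: "locally_integrable V h"
    and zero: "\<And>\<psi> d\<psi>. test_function V \<psi> d\<psi> \<Longrightarrow> (LINT x|lebesgue. \<psi> x *\<^sub>R h x) = 0"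
  shows "AE x\<in>V in lebesgue. h x = 0"
proof -
  have "AE x\<in>V in lebesgue. h x \<bullet> e = 0" for e
  proof (rule fundamental_lemma_real[OF V locally_integrable_inner[OF h]])
    fix \<psi> d\<psi> assume T: "test_function V \<psi> d\<psi>"
    have "(LINT x|lebesgue. \<psi> x * (h x \<bullet> e)) = (LINT x|lebesgue. (\<psi> x *\<^sub>R h x) \<bullet> e)" by simp
    also have "\<dots> = (LINT x|lebesgue. \<psi> x *\<^sub>R h x) \<bullet> e"
      using locally_integrable_test[OF h T] by (intro integral_inner_left) auto
    finally show "(LINT x|lebesgue. \<psi> x * (h x \<bullet> e)) = 0" using zero[OF T] by simp
  qed
  then have "AE x in lebesgue. \<forall>e\<in>Basis. x \<in> V \<longrightarrow> h x \<bullet> e = 0"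
    by (subst AE_ball_countable) (auto intro: countable_finite)
  then show ?thesis
    by (rule AE_mp) (auto intro!: AE_I2 simp: euclidean_eq_iff[where x="h _"])
qed

lemma locally_integrable_diff:
  assumes "locally_integrable V f" "locally_integrable V g"
  shows "locally_integrable V (\<lambda>x. f x - g x)"
  using assms unfolding locally_integrable_def by (auto intro: set_integral_diff)

lemma locally_integrable_mono:
  "locally_integrable V f \<Longrightarrow> W \<subseteq> V \<Longrightarrow> locally_integrable W f"
  unfolding locally_integrable_def by blast

lemma weak_gradient_iff:
  "weak_gradient V u g \<longleftrightarrow> locally_integrable V u \<and> locally_integrable V g \<and>
     (\<forall>\<psi> d\<psi>. test_function V \<psi> d\<psi> \<longrightarrow>
        (LINT x|lebesgue. u x *\<^sub>R d\<psi> x) = - (LINT x|lebesgue. \<psi> x *\<^sub>R g x))"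
  unfolding weak_gradient_def
  by (intro conj_cong refl all_cong1 imp_cong) (simp only: test_function_LINT(1,2))

lemma weak_gradient_mono:
  assumes "weak_gradient U u g" "V \<subseteq> U"
  shows "weak_gradient V u g"
  using assms locally_integrable_mono test_function_mono unfolding weak_gradient_iff by metis

lemma weak_gradient_unique:
  assumes "open V" "weak_gradient V u g" "weak_gradient V v g'" "\<And>x. x \<in> V \<Longrightarrow> u x = v x"
  shows "AE x\<in>V in lebesgue. g x = g' x"
proof -
  have lg: "locally_integrable V g" "locally_integrable V g'"
    using assms unfolding weak_gradient_iff by auto
  have "AE x\<in>V in lebesgue. g x - g' x = 0"
  proof (rule fundamental_lemma[OF assms(1) locally_integrable_diff[OF lg]])
    fix \<psi> d\<psi> assume T: "test_function V \<psi> d\<psi>"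
    have uv: "(LINT x|lebesgue. u x *\<^sub>R d\<psi> x) = (LINT x|lebesgue. v x *\<^sub>R d\<psi> x)"
    proof (intro Bochner_Integration.integral_cong refl)
      fix x show "u x *\<^sub>R d\<psi> x = v x *\<^sub>R d\<psi> x"
      proof (cases "x \<in> V")
        case False
        then have "d\<psi> x = 0" using test_function_vanishes[OF T] by blast
        then show ?thesis by simp
      qed (simp add: assms(4))
    qed
    have "(LINT x|lebesgue. \<psi> x *\<^sub>R g x) = (LINT x|lebesgue. \<psi> x *\<^sub>R g' x)"
    proof -
      have "(LINT x|lebesgue. u x *\<^sub>R d\<psi> x) = - (LINT x|lebesgue. \<psi> x *\<^sub>R g x)"
        "(LINT x|lebesgue. v x *\<^sub>R d\<psi> x) = - (LINT x|lebesgue. \<psi> x *\<^sub>R g' x)"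
        using assms(2,3) T unfolding weak_gradient_iff by blast+
      then show ?thesis using uv by simp
    qed
    then show "(LINT x|lebesgue. \<psi> x *\<^sub>R (g x - g' x)) = 0"
      using locally_integrable_test[OF lg(1) T] locally_integrable_test[OF lg(2) T]
      by (simp add: scaleR_diff_right)
  qed
  then show ?thesis by simp
qed

lemma weak_gradient_zero: "weak_gradient V (\<lambda>_. 0) (\<lambda>_. 0)"
  unfolding weak_gradient_iff locally_integrable_def set_integrable_def by simp

lemma weak_gradient_wgrad:
  "weak_gradient V u g \<Longrightarrow> weak_gradient V u (wgrad V u)"
  unfolding wgrad_def by (rule someI[of "weak_gradient V u"])

text \<open>Exhaust \<open>V\<close> by compact sets.\<close>

lemma locally_integrable_imp_measurable:
  fixes h :: "'a::euclidean_space \<Rightarrow> 'b::{banach, second_countable_topology}"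
  assumes "open V" "locally_integrable V h"
  shows "(\<lambda>x. indicator V x *\<^sub>R h x) \<in> borel_measurable lebesgue"
proof -
  obtain C where C: "\<And>n. compact (C n)" "\<And>n. C n \<subseteq> V" "\<And>n. C n \<subseteq> interior (C (Suc n))"
    "\<Union>(range C) = V" "\<And>K. \<lbrakk>compact K; K \<subseteq> V\<rbrakk> \<Longrightarrow> \<exists>N. \<forall>n\<ge>N. K \<subseteq> C n"
    using open_Union_compact_subsets[OF assms(1)] by metis
  show ?thesis
  proof (rule borel_measurable_LIMSEQ_metric)
    show "(\<lambda>x. indicator (C n) x *\<^sub>R h x) \<in> borel_measurable lebesgue" for n
      using assms(2) C(1,2) unfolding locally_integrable_def set_integrable_def
      by (metis borel_measurable_integrable)
    fix x
    show "(\<lambda>n. indicator (C n) x *\<^sub>R h x) \<longlonglongrightarrow> indicator V x *\<^sub>R h x"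
    proof (cases "x \<in> V")
      case True
      then obtain N where "\<forall>n\<ge>N. x \<in> C n" using C(5)[of "{x}"] by auto
      then show ?thesis using True
        by (intro tendsto_eventually) (auto simp: eventually_sequentially intro!: exI[of _ N])
    next
      case False
      then have "x \<notin> C n" for n using C(2) by blast
      then show ?thesis using False by simp
    qed
  qed
qed

lemma set_integrable_bounded_lebesgue:
  fixes h :: "'a::euclidean_space \<Rightarrow> 'b::{banach, second_countable_topology}"
  assumes "(\<lambda>x. indicator V x *\<^sub>R h x) \<in> borel_measurable lebesgue" "bounded V" "open V"
    "AE x\<in>V in lebesgue. norm (h x) \<le> B"
  shows "set_integrable lebesgue V h"
  unfolding set_integrable_def
proof (rule integrableI_bounded_set[where A=V and B=B])
  show "emeasure lebesgue V < \<infinity>"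
    using assms(2,3) emeasure_bounded_finite by auto
  show "AE x in lebesgue. x \<in> V \<longrightarrow> norm (indicator V x *\<^sub>R h x) \<le> B"
    using assms(4) by eventually_elim auto
qed (use assms(1,3) in auto)

section \<open>Bounded functions are divergences of ray fields\<close>

text \<open>The field along the rays through \<open>c\<close> that transports the mass of \<open>F\<close> met between \<open>c\<close> and \<open>x\<close>,
  diluted by the widening of the cone. It is bounded near \<open>c\<close>, however \<open>F\<close> varies from ray to ray.\<close>

definition ray_field :: "'a::euclidean_space \<Rightarrow> ('a \<Rightarrow> real) \<Rightarrow> 'a \<Rightarrow> 'a" where
  "ray_field c F x =
     - (\<integral>t. indicator {0..1} t * (t ^ (DIM('a) - 1) * F (c + t *\<^sub>R (x - c))) \<partial>lborel) *\<^sub>R (x - c)"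

lemma lborel_integral_affine:
  fixes f :: "'a::euclidean_space \<Rightarrow> real"
  assumes [measurable]: "f \<in> borel_measurable borel" and t: "t \<noteq> 0"
  shows "(\<integral>x. f x \<partial>lborel) = \<bar>t\<bar> ^ DIM('a) * (\<integral>x. f (a + t *\<^sub>R x) \<partial>lborel)"
  by (subst lborel_affine[OF t, of a]) (simp add: integral_density integral_distr)

lemma test_function_radial_derivative:
  assumes T: "test_function V \<psi> d\<psi>" and "t \<noteq> 0"
  shows "((\<lambda>t. \<psi> (c + (1 / t) *\<^sub>R (y - c))) has_real_derivative
            - (1 / t\<^sup>2) * ((y - c) \<bullet> d\<psi> (c + (1 / t) *\<^sub>R (y - c)))) (at t)"
proof -
  have D: "(\<psi> has_derivative (\<lambda>h. h \<bullet> d\<psi> (c + (1 / t) *\<^sub>R (y - c)))) (at (c + (1 / t) *\<^sub>R (y - c)))"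
    using T unfolding test_function_def gderiv_def by blast
  have "((\<lambda>t. 1 / t) has_derivative (\<lambda>h. - (1 / t\<^sup>2) * h)) (at t)"
    using assms(2) by (auto intro!: derivative_eq_intros simp: power2_eq_square)
  from has_derivative_add[OF has_derivative_const has_derivative_scaleR_left[OF this]]
  have "((\<lambda>t. c + (1 / t) *\<^sub>R (y - c)) has_derivative (\<lambda>h. (- (1 / t\<^sup>2) * h) *\<^sub>R (y - c))) (at t)"
    by simp
  from has_derivative_compose[OF this D]
  show ?thesis unfolding has_field_derivative_def
    by (rule has_derivative_subst) (auto simp: mult.commute mult.left_commute)
qed

text \<open>Away from the tip \<open>t = 0\<close> of the rays all integrands are bounded with bounded support, so Fubini's
  theorem applies. For fixed \<open>t\<close> substitute \<open>y = c + t (x - c)\<close>; what is then integrated along the ray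
  is the derivative of \<open>t \<mapsto> \<psi> (c + (y - c) / t)\<close>, up to the factor \<open>- F y\<close>.\<close>

lemma ray_integral_truncated:
  fixes \<psi> :: "'a::euclidean_space \<Rightarrow> real"
  assumes T: "test_function V \<psi> d\<psi>" and Fm[measurable]: "F \<in> borel_measurable borel"
    and FM: "\<And>x. \<bar>F x\<bar> \<le> M" and e: "0 < e" "e < 1"
  shows "(\<integral>x. (\<integral>t. indicator {e..1} t * (t ^ (DIM('a) - 1) * F (c + t *\<^sub>R (x - c))) \<partial>lborel) * ((x - c) \<bullet> d\<psi> x) \<partial>lborel)
     = (\<integral>y. F y * \<psi> (c + (1 / e) *\<^sub>R (y - c)) \<partial>lborel) - (\<integral>y. F y * \<psi> y \<partial>lborel)"
proof -
  obtain K B where K: "compact K" "\<And>x. x \<notin> K \<Longrightarrow> \<psi> x = 0" "\<And>x. x \<notin> K \<Longrightarrow> d\<psi> x = 0"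
    "\<And>x. \<bar>\<psi> x\<bar> \<le> B" "\<And>x. norm (d\<psi> x) \<le> B" "0 \<le> B"
    using T by (rule test_functionE) blast
  note cont = test_function_continuous[OF T]
  note [measurable] = cont(3,4)
  obtain r where r0: "\<And>x. x \<in> K \<Longrightarrow> dist c x \<le> r"
    using compact_imp_bounded[OF K(1)] bounded_any_center[of K c] by blast
  define R where "R = max r 0"
  have R: "0 \<le> R" "\<And>x. x \<in> K \<Longrightarrow> norm (x - c) \<le> R"
    using r0 by (force simp: R_def dist_norm norm_minus_commute)+
  have M0: "0 \<le> M" using FM[of 0] by linarith
  have dp: "\<bar>(x - c) \<bullet> d\<psi> x\<bar> \<le> R * B" for x
  proof (cases "x \<in> K")
    case True
    then have "norm (x - c) * norm (d\<psi> x) \<le> R * B" using R K(5,6) by (intro mult_mono) auto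
    then show ?thesis using Cauchy_Schwarz_ineq2[of "x - c" "d\<psi> x"] by linarith
  next
    case False then show ?thesis using K(3) R K(6) by simp
  qed
  define G where "G = (\<lambda>(t::real, x). indicator {e..1} t * (t ^ (DIM('a) - 1) * F (c + t *\<^sub>R (x - c))) * ((x - c) \<bullet> d\<psi> x))"
  define H where "H = (\<lambda>(t::real, y). indicator {e..1} t * (1 / t\<^sup>2) * (F y * ((y - c) \<bullet> d\<psi> (c + (1 / t) *\<^sub>R (y - c)))))"
  have Gi: "integrable (lborel \<Otimes>\<^sub>M lborel) G"
    unfolding lborel_prod
  proof (rule integrable_bounded_support[where S="{e..1} \<times> K" and B="M * (R * B)"])
    have "G \<in> borel_measurable (borel \<Otimes>\<^sub>M borel)" unfolding G_def by measurable
    then show "G \<in> borel_measurable borel" by (simp only: borel_prod)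
    show "bounded ({e..1} \<times> K)" using K(1) by (simp add: bounded_Times compact_imp_bounded)
    show "norm (G p) \<le> M * (R * B)" for p
    proof -
      obtain t x where p: "p = (t, x)" by fastforce
      show ?thesis
      proof (cases "t \<in> {e..1}")
        case True
        then have "\<bar>t ^ (DIM('a) - 1) * F (c + t *\<^sub>R (x - c))\<bar> \<le> 1 * M"
          unfolding abs_mult using e FM by (intro mult_mono) (auto simp: power_le_one)
        then have "\<bar>t ^ (DIM('a) - 1) * F (c + t *\<^sub>R (x - c))\<bar> * \<bar>(x - c) \<bullet> d\<psi> x\<bar> \<le> M * (R * B)"
          using dp M0 by (intro mult_mono) auto
        then show ?thesis using True by (simp add: p G_def abs_mult)
      qed (use M0 R K(6) in \<open>simp add: p G_def\<close>)
    qed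
    show "G p = 0" if "p \<notin> {e..1} \<times> K" for p
      using that K(3) by (cases p) (auto simp: G_def indicator_def)
  qed
  have Hi: "integrable (lborel \<Otimes>\<^sub>M lborel) H"
    unfolding lborel_prod
  proof (rule integrable_bounded_support[where S="{e..1} \<times> cball c R" and B="(1 / e\<^sup>2) * (M * (R * B))"])
    have "H \<in> borel_measurable (borel \<Otimes>\<^sub>M borel)" unfolding H_def by measurable
    then show "H \<in> borel_measurable borel" by (simp only: borel_prod)
    show "bounded ({e..1} \<times> cball c R)" by (simp add: bounded_Times)
    have key: "\<bar>(y - c) \<bullet> d\<psi> (c + (1 / t) *\<^sub>R (y - c))\<bar> \<le> R * B" if "t \<in> {e..1}" for t y
    proof -
      have "(y - c) \<bullet> d\<psi> (c + (1 / t) *\<^sub>R (y - c)) = t * (((c + (1 / t) *\<^sub>R (y - c)) - c) \<bullet> d\<psi> (c + (1 / t) *\<^sub>R (y - c)))"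
        using that e by simp
      moreover have "\<bar>t * (((c + (1 / t) *\<^sub>R (y - c)) - c) \<bullet> d\<psi> (c + (1 / t) *\<^sub>R (y - c)))\<bar> \<le> 1 * (R * B)"
        unfolding abs_mult[of t] by (rule mult_mono[OF _ dp]) (use that e in auto)
      ultimately show ?thesis by simp
    qed
    show "norm (H p) \<le> (1 / e\<^sup>2) * (M * (R * B))" for p
    proof -
      obtain t y where p: "p = (t, y)" by fastforce
      show ?thesis
      proof (cases "t \<in> {e..1}")
        case True
        have "1 / t\<^sup>2 \<le> 1 / e\<^sup>2" using True e by (intro divide_left_mono power_mono) auto
        moreover have "\<bar>F y * ((y - c) \<bullet> d\<psi> (c + (1 / t) *\<^sub>R (y - c)))\<bar> \<le> M * (R * B)"
          unfolding abs_mult using key[OF True] FM M0 by (intro mult_mono) auto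
        ultimately have "(1 / t\<^sup>2) * \<bar>F y * ((y - c) \<bullet> d\<psi> (c + (1 / t) *\<^sub>R (y - c)))\<bar> \<le> (1 / e\<^sup>2) * (M * (R * B))"
          by (intro mult_mono) auto
        then show ?thesis using True by (simp add: p H_def abs_mult)
      qed (use M0 R K(6) in \<open>simp add: p H_def\<close>)
    qed
    show "H p = 0" if "p \<notin> {e..1} \<times> cball c R" for p
    proof -
      obtain t y where p: "p = (t, y)" by fastforce
      show ?thesis
      proof (cases "t \<in> {e..1}")
        case True
        then have "norm (y - c) > R" using that by (auto simp: p dist_norm norm_minus_commute)
        moreover have "norm (y - c) \<le> (1 / t) * norm (y - c)"
          using True e by (simp add: mult_right_mono[of 1 "1/t", simplified] field_simps mult_left_le_one_le)
        ultimately have "\<not> norm ((c + (1 / t) *\<^sub>R (y - c)) - c) \<le> R" using True e by simp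
        then have "c + (1 / t) *\<^sub>R (y - c) \<notin> K" using R(2) by blast
        then show ?thesis using K(3) by (simp add: p H_def)
      qed (simp add: p H_def)
    qed
  qed
  have scale: "(\<integral>x. G (t, x) \<partial>lborel) = (\<integral>y. H (t, y) \<partial>lborel)" for t
  proof (cases "t \<in> {e..1}")
    case True
    then have t: "t > 0" using e by simp
    have "(\<integral>y. H (t, y) \<partial>lborel) = \<bar>t\<bar> ^ DIM('a) * (\<integral>x. H (t, (c - t *\<^sub>R c) + t *\<^sub>R x) \<partial>lborel)"
      by (rule lborel_integral_affine) (use t in \<open>auto simp: H_def\<close>)
    also have "\<dots> = (\<integral>x. \<bar>t\<bar> ^ DIM('a) * H (t, (c - t *\<^sub>R c) + t *\<^sub>R x) \<partial>lborel)" by simp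
    also have "\<dots> = (\<integral>x. G (t, x) \<partial>lborel)"
    proof (intro Bochner_Integration.integral_cong refl)
      fix x :: 'a
      have 1: "(c - t *\<^sub>R c) + t *\<^sub>R x = c + t *\<^sub>R (x - c)" by (simp add: algebra_simps)
      have 2: "c + (1 / t) *\<^sub>R ((c + t *\<^sub>R (x - c)) - c) = x" using t by simp
      have 3: "\<bar>t\<bar> ^ DIM('a) * (1 / t\<^sup>2 * t) = t ^ (DIM('a) - 1)"
      proof -
        have "t ^ DIM('a) = t ^ (DIM('a) - 1) * t"
          by (metis DIM_positive power_minus_mult)
        then show ?thesis using t by (simp add: power2_eq_square)
      qed
      have "\<bar>t\<bar> ^ DIM('a) * H (t, c + t *\<^sub>R (x - c))
          = (\<bar>t\<bar> ^ DIM('a) * (1 / t\<^sup>2 * t)) * (F (c + t *\<^sub>R (x - c)) * ((x - c) \<bullet> d\<psi> x))"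
        unfolding H_def prod.case 2 using True by simp
      also have "\<dots> = G (t, x)" unfolding 3 G_def using True by simp
      finally show "\<bar>t\<bar> ^ DIM('a) * H (t, (c - t *\<^sub>R c) + t *\<^sub>R x) = G (t, x)" unfolding 1 .
    qed
    finally show ?thesis by simp
  qed (simp add: G_def H_def)
  have FTC: "(\<integral>t. H (t, y) \<partial>lborel) = F y * \<psi> (c + (1 / e) *\<^sub>R (y - c)) - F y * \<psi> y" for y
  proof -
    have "(\<integral>t. (- (1 / t\<^sup>2) * ((y - c) \<bullet> d\<psi> (c + (1 / t) *\<^sub>R (y - c)))) * indicator {e..1} t \<partial>lborel)
        = \<psi> (c + (1 / 1) *\<^sub>R (y - c)) - \<psi> (c + (1 / e) *\<^sub>R (y - c))"
    proof (rule integral_FTC_Icc_real)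
      fix t assume t: "e \<le> t" "t \<le> 1"
      then have "t \<noteq> 0" using e by auto
      then show "((\<lambda>t. \<psi> (c + (1 / t) *\<^sub>R (y - c))) has_real_derivative
            - (1 / t\<^sup>2) * ((y - c) \<bullet> d\<psi> (c + (1 / t) *\<^sub>R (y - c)))) (at t)"
        by (rule test_function_radial_derivative[OF T])
      have "isCont d\<psi> z" for z using cont(2) continuous_on_eq_continuous_at by blast
      moreover have "isCont (\<lambda>t. c + (1 / t) *\<^sub>R (y - c)) t"
        using \<open>t \<noteq> 0\<close> by (intro continuous_intros) auto
      ultimately have "isCont (\<lambda>t. d\<psi> (c + (1 / t) *\<^sub>R (y - c))) t"
        using isCont_o2[where f="\<lambda>t. c + (1 / t) *\<^sub>R (y - c)" and g=d\<psi>] by blast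
      then show "isCont (\<lambda>t. - (1 / t\<^sup>2) * ((y - c) \<bullet> d\<psi> (c + (1 / t) *\<^sub>R (y - c)))) t"
        using \<open>t \<noteq> 0\<close> by (intro continuous_intros) auto
    qed (rule less_imp_le[OF e(2)])
    then have *: "(\<integral>t. (- (1 / t\<^sup>2) * ((y - c) \<bullet> d\<psi> (c + (1 / t) *\<^sub>R (y - c)))) * indicator {e..1} t \<partial>lborel)
        = \<psi> y - \<psi> (c + (1 / e) *\<^sub>R (y - c))" by simp
    have "(\<integral>t. H (t, y) \<partial>lborel) = (\<integral>t. - F y * ((- (1 / t\<^sup>2) * ((y - c) \<bullet> d\<psi> (c + (1 / t) *\<^sub>R (y - c)))) * indicator {e..1} t) \<partial>lborel)"
      unfolding H_def prod.case by (intro Bochner_Integration.integral_cong refl) (simp add: algebra_simps)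
    also have "\<dots> = - F y * (\<psi> y - \<psi> (c + (1 / e) *\<^sub>R (y - c)))"
      by (subst integral_mult_right_zero) (simp only: *)
    finally show ?thesis by (simp add: algebra_simps)
  qed
  have "(\<integral>x. (\<integral>t. indicator {e..1} t * (t ^ (DIM('a) - 1) * F (c + t *\<^sub>R (x - c))) \<partial>lborel) * ((x - c) \<bullet> d\<psi> x) \<partial>lborel)
      = (\<integral>x. \<integral>t. G (t, x) \<partial>lborel \<partial>lborel)"
    unfolding G_def prod.case by simp
  also have "\<dots> = (\<integral>t. \<integral>x. G (t, x) \<partial>lborel \<partial>lborel)"
    using lborel_pair.Fubini_integral[of "\<lambda>t x. G (t, x)"] Gi by simp
  also have "\<dots> = (\<integral>t. \<integral>y. H (t, y) \<partial>lborel \<partial>lborel)" unfolding scale ..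
  also have "\<dots> = (\<integral>y. \<integral>t. H (t, y) \<partial>lborel \<partial>lborel)"
    using lborel_pair.Fubini_integral[of "\<lambda>t y. H (t, y)"] Hi by simp
  also have "\<dots> = (\<integral>y. F y * \<psi> (c + (1 / e) *\<^sub>R (y - c)) - F y * \<psi> y \<partial>lborel)"
    unfolding FTC ..
  also have "\<dots> = (\<integral>y. F y * \<psi> (c + (1 / e) *\<^sub>R (y - c)) \<partial>lborel) - (\<integral>y. F y * \<psi> y \<partial>lborel)"
  proof (rule Bochner_Integration.integral_diff)
    show "integrable lborel (\<lambda>y. F y * \<psi> y)" by (rule test_function_integrable(3)[OF T Fm FM])
    show "integrable lborel (\<lambda>y. F y * \<psi> (c + (1 / e) *\<^sub>R (y - c)))"
    proof (rule integrable_bounded_support[where S="cball c R" and B="M * B"])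
      fix y
      show "norm (F y * \<psi> (c + (1 / e) *\<^sub>R (y - c))) \<le> M * B"
        using FM K(4) M0 by (auto simp: abs_mult intro!: mult_mono)
      assume "y \<notin> cball c R"
      then have "norm (y - c) > R" by (auto simp: dist_norm norm_minus_commute)
      moreover have "norm (y - c) \<le> (1 / e) * norm (y - c)" using e by (simp add: field_simps mult_left_le_one_le)
      ultimately have "\<not> norm ((c + (1 / e) *\<^sub>R (y - c)) - c) \<le> R" using e by simp
      then have "c + (1 / e) *\<^sub>R (y - c) \<notin> K" using R(2) by blast
      then show "F y * \<psi> (c + (1 / e) *\<^sub>R (y - c)) = 0" using K(2) by simp
    qed auto
  qed
  finally show ?thesis .
qed

lemma ray_weight_bound:
  fixes F :: "'a::euclidean_space \<Rightarrow> real"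
  assumes Fm[measurable]: "F \<in> borel_measurable borel" and FM: "\<And>x. \<bar>F x\<bar> \<le> M" and e: "0 \<le> e"
  shows "\<bar>\<integral>t. indicator {e..1} t * (t ^ (DIM('a) - 1) * F (c + t *\<^sub>R x)) \<partial>lborel\<bar> \<le> M"
    and "\<bar>indicator {e..1} t * (t ^ (DIM('a) - 1) * F (c + t *\<^sub>R x))\<bar> \<le> M * indicator {0..1} t"
proof -
  have M0: "0 \<le> M" using FM[of 0] by linarith
  show b: "\<bar>indicator {e..1} t * (t ^ (DIM('a) - 1) * F (c + t *\<^sub>R x))\<bar> \<le> M * indicator {0..1} t" for t
  proof (cases "t \<in> {e..1}")
    case True
    then have "\<bar>t ^ (DIM('a) - 1) * F (c + t *\<^sub>R x)\<bar> \<le> 1 * M"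
      unfolding abs_mult using e FM by (intro mult_mono) (auto simp: power_le_one)
    then show ?thesis using True e by (auto simp: indicator_def)
  qed (use M0 in \<open>auto simp: indicator_def\<close>)
  have i: "integrable lborel (\<lambda>t::real. M * indicator {0..1} t)" by simp
  have "norm (\<integral>t. indicator {e..1} t * (t ^ (DIM('a) - 1) * F (c + t *\<^sub>R x)) \<partial>lborel) \<le> (\<integral>t. M * indicator {0..1::real} t \<partial>lborel)"
  proof (rule Bochner_Integration.integral_norm_bound_integral[OF _ i])
    show "integrable lborel (\<lambda>t. indicator {e..1} t * (t ^ (DIM('a) - 1) * F (c + t *\<^sub>R x)))"
      by (rule Bochner_Integration.integrable_bound[OF i])
        (use order_trans[OF b abs_ge_self] in \<open>auto simp del: abs_mult\<close>)
  qed (use b in auto)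
  also have "\<dots> = M" by simp
  finally show "\<bar>\<integral>t. indicator {e..1} t * (t ^ (DIM('a) - 1) * F (c + t *\<^sub>R x)) \<partial>lborel\<bar> \<le> M" by simp
qed

lemma ray_field_measurable [measurable]:
  fixes F :: "'a::euclidean_space \<Rightarrow> real"
  assumes [measurable]: "F \<in> borel_measurable borel"
  shows "ray_field c F \<in> borel_measurable borel"
  unfolding ray_field_def
  by (intro borel_measurable_scaleR borel_measurable_uminus lborel.borel_measurable_lebesgue_integral) simp_all

lemma ray_field_bound:
  fixes F :: "'a::euclidean_space \<Rightarrow> real"
  assumes "F \<in> borel_measurable borel" "\<And>x. \<bar>F x\<bar> \<le> M"
  shows "norm (ray_field c F x) \<le> M * dist c x"
  unfolding ray_field_def using ray_weight_bound(1)[OF assms, of 0]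
  by (auto simp: dist_norm norm_minus_commute intro!: mult_right_mono)

text \<open>In the sense of distributions the divergence of the ray field is \<open>- F\<close>. When the truncation
  parameter \<open>e\<close> tends to \<open>0\<close>, the term with \<open>\<psi> (c + (y - c) / e)\<close> disappears, because the supports
  shrink to \<open>c\<close>.\<close>

theorem ray_field_divergence:
  fixes \<psi> :: "'a::euclidean_space \<Rightarrow> real"
  assumes T: "test_function V \<psi> d\<psi>" and Fm[measurable]: "F \<in> borel_measurable borel"
    and FM: "\<And>x. \<bar>F x\<bar> \<le> M"
  shows "(\<integral>x. ray_field c F x \<bullet> d\<psi> x \<partial>lborel) = (\<integral>x. F x * \<psi> x \<partial>lborel)"
proof -
  obtain K B where K: "compact K" "\<And>x. x \<notin> K \<Longrightarrow> \<psi> x = 0" "\<And>x. x \<notin> K \<Longrightarrow> d\<psi> x = 0"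
    "\<And>x. \<bar>\<psi> x\<bar> \<le> B" "\<And>x. norm (d\<psi> x) \<le> B" "0 \<le> B"
    using T by (rule test_functionE) blast
  note cont = test_function_continuous[OF T]
  note [measurable] = cont(3,4)
  obtain r where r0: "\<And>x. x \<in> K \<Longrightarrow> dist c x \<le> r"
    using compact_imp_bounded[OF K(1)] bounded_any_center[of K c] by blast
  define R where "R = max r 0"
  have R: "0 \<le> R" "\<And>x. x \<in> K \<Longrightarrow> norm (x - c) \<le> R"
    using r0 by (force simp: R_def dist_norm norm_minus_commute)+
  have M0: "0 \<le> M" using FM[of 0] by linarith
  define e where "e = (\<lambda>k::nat. 1 / (real k + 2))"
  have e: "0 < e k" "e k < 1" for k by (auto simp: e_def)
  have e0: "e \<longlonglongrightarrow> 0" unfolding e_def by real_asymp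
  let ?w = "\<lambda>e x. \<integral>t. indicator {e..1} t * (t ^ (DIM('a) - 1) * F (c + t *\<^sub>R (x - c))) \<partial>lborel"
  have wm: "?w e \<in> borel_measurable borel" for e
    by (intro lborel.borel_measurable_lebesgue_integral) simp_all
  have wlim: "(\<lambda>k. ?w (e k) x) \<longlonglongrightarrow> ?w 0 x" for x
  proof (rule integral_dominated_convergence[where w="\<lambda>t. M * indicator {0..1} t"])
    show "AE t in lborel. norm (indicator {e k..1} t * (t ^ (DIM('a) - 1) * F (c + t *\<^sub>R (x - c)))) \<le> M * indicator {0..1} t" for k
      using ray_weight_bound(2)[OF Fm FM less_imp_le[OF e(1)]] by simp
    have "AE t in lborel. t \<noteq> (0::real)" by (rule AE_lborel_singleton)
    then show "AE t in lborel. (\<lambda>k. indicator {e k..1} t * (t ^ (DIM('a) - 1) * F (c + t *\<^sub>R (x - c))))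
        \<longlonglongrightarrow> indicator {0..1} t * (t ^ (DIM('a) - 1) * F (c + t *\<^sub>R (x - c)))"
    proof eventually_elim
      fix t :: real assume "t \<noteq> 0"
      have "\<forall>\<^sub>F k in sequentially. (indicator {e k..1} t :: real) = indicator {0..1} t"
      proof (cases "t > 0")
        case True
        have "\<forall>\<^sub>F k in sequentially. e k < t" using e0 True by (rule order_tendstoD)
        then show ?thesis by eventually_elim (use True in \<open>auto simp: indicator_def\<close>)
      next
        case False
        then have "t < 0" using \<open>t \<noteq> 0\<close> by simp
        then have "\<not> e k \<le> t" for k using e(1)[of k] by linarith
        then show ?thesis using \<open>t < 0\<close> by (auto simp: indicator_def)
      qed
      then show "(\<lambda>k. indicator {e k..1} t * (t ^ (DIM('a) - 1) * F (c + t *\<^sub>R (x - c))))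
        \<longlonglongrightarrow> indicator {0..1} t * (t ^ (DIM('a) - 1) * F (c + t *\<^sub>R (x - c)))"
        by (intro tendsto_intros tendsto_eventually)
    qed
  qed auto
  have dp: "\<bar>(x - c) \<bullet> d\<psi> x\<bar> \<le> (R * B) * indicator K x" for x
  proof (cases "x \<in> K")
    case True
    then have "norm (x - c) * norm (d\<psi> x) \<le> R * B" using R K(5,6) by (intro mult_mono) auto
    then show ?thesis using Cauchy_Schwarz_ineq2[of "x - c" "d\<psi> x"] True by simp
  next
    case False then show ?thesis using K(3) by simp
  qed
  have Kb: "K \<in> sets borel" using K(1) by (simp add: compact_imp_closed)
  have Ki: "integrable lborel (\<lambda>x. C * indicator K x :: real)" for C
    by (intro integrable_mult_right integrable_real_indicator) (use Kb emeasure_compact_finite[OF K(1)] in auto)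
  have lim1: "(\<lambda>k. \<integral>x. ?w (e k) x * ((x - c) \<bullet> d\<psi> x) \<partial>lborel) \<longlonglongrightarrow> (\<integral>x. ?w 0 x * ((x - c) \<bullet> d\<psi> x) \<partial>lborel)"
  proof (rule integral_dominated_convergence[where w="\<lambda>x. (M * (R * B)) * indicator K x"])
    show "integrable lborel (\<lambda>x. (M * (R * B)) * indicator K x)" by (rule Ki)
    show "AE x in lborel. (\<lambda>k. ?w (e k) x * ((x - c) \<bullet> d\<psi> x)) \<longlonglongrightarrow> ?w 0 x * ((x - c) \<bullet> d\<psi> x)"
      by (intro AE_I2 tendsto_mult tendsto_const wlim)
    show "AE x in lborel. norm (?w (e k) x * ((x - c) \<bullet> d\<psi> x)) \<le> (M * (R * B)) * indicator K x" for k
    proof (rule AE_I2)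
      fix x
      have "\<bar>?w (e k) x\<bar> * \<bar>(x - c) \<bullet> d\<psi> x\<bar> \<le> M * ((R * B) * indicator K x)"
        by (rule mult_mono[OF ray_weight_bound(1)[OF Fm FM less_imp_le[OF e(1)]] dp M0]) simp
      then show "norm (?w (e k) x * ((x - c) \<bullet> d\<psi> x)) \<le> (M * (R * B)) * indicator K x"
        by (simp add: abs_mult mult.assoc)
    qed
  qed (use wm in \<open>auto intro!: borel_measurable_times\<close>)
  have lim2: "(\<lambda>k. \<integral>y. F y * \<psi> (c + (1 / e k) *\<^sub>R (y - c)) \<partial>lborel) \<longlonglongrightarrow> (\<integral>y. (0::real) \<partial>(lborel::'a measure))"
  proof (rule integral_dominated_convergence[where w="\<lambda>x. (M * B) * indicator (cball c R) x"])
    show "integrable lborel (\<lambda>x. (M * B) * indicator (cball c R) x)"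
      by (intro integrable_mult_right integrable_real_indicator) (use emeasure_lborel_cball_finite in auto)
    have out: "F y * \<psi> (c + (1 / e k) *\<^sub>R (y - c)) = 0" if "norm (y - c) > e k * R" for y k
    proof -
      have "R < (1 / e k) * norm (y - c)" using e[of k] that by (simp add: field_simps)
      then have "\<not> norm ((c + (1 / e k) *\<^sub>R (y - c)) - c) \<le> R" using e[of k] by simp
      then have "c + (1 / e k) *\<^sub>R (y - c) \<notin> K" using R(2) by blast
      then show ?thesis using K(2) by simp
    qed
    show "AE y in lborel. norm (F y * \<psi> (c + (1 / e k) *\<^sub>R (y - c))) \<le> (M * B) * indicator (cball c R) y" for k
    proof (rule AE_I2)
      fix y
      show "norm (F y * \<psi> (c + (1 / e k) *\<^sub>R (y - c))) \<le> (M * B) * indicator (cball c R) y"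
      proof (cases "y \<in> cball c R")
        case True then show ?thesis using FM K(4) M0 by (auto simp: abs_mult intro!: mult_mono)
      next
        case False
        have "e k * R \<le> R" using e[of k] R(1) by (simp add: mult_left_le_one_le)
        then have "norm (y - c) > e k * R" using False by (auto simp: dist_norm norm_minus_commute)
        then show ?thesis using out[of k y] False by simp
      qed
    qed
    have "AE y in lborel. y \<noteq> c" by (rule AE_lborel_singleton)
    then show "AE y in lborel. (\<lambda>k. F y * \<psi> (c + (1 / e k) *\<^sub>R (y - c))) \<longlonglongrightarrow> 0"
    proof eventually_elim
      fix y assume "y \<noteq> c"
      have "(\<lambda>k. e k * R) \<longlonglongrightarrow> 0 * R" by (intro tendsto_intros e0)
      then have "\<forall>\<^sub>F k in sequentially. e k * R < norm (y - c)" using \<open>y \<noteq> c\<close> by (intro order_tendstoD) auto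
      then show "(\<lambda>k. F y * \<psi> (c + (1 / e k) *\<^sub>R (y - c))) \<longlonglongrightarrow> 0"
        by (intro tendsto_eventually) (rule eventually_mono, assumption, rule out)
    qed
  qed auto
  have "(\<lambda>k. \<integral>x. ?w (e k) x * ((x - c) \<bullet> d\<psi> x) \<partial>lborel) \<longlonglongrightarrow> 0 - (\<integral>y. F y * \<psi> y \<partial>lborel)"
    unfolding ray_integral_truncated[OF T Fm FM e] using lim2 by (intro tendsto_diff) simp_all
  with lim1 have "(\<integral>x. ?w 0 x * ((x - c) \<bullet> d\<psi> x) \<partial>lborel) = 0 - (\<integral>y. F y * \<psi> y \<partial>lborel)"
    by (rule LIMSEQ_unique)
  moreover have "(\<integral>x. ray_field c F x \<bullet> d\<psi> x \<partial>lborel) = (\<integral>x. - (?w 0 x * ((x - c) \<bullet> d\<psi> x)) \<partial>lborel)"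
    unfolding ray_field_def by (simp only: inner_scaleR_left mult_minus_left inner_minus_left)
  ultimately show ?thesis by simp
qed

section \<open>Functions with zero boundary values\<close>

text \<open>Membership of $W_0^{1,1}(V)$ with gradient \<open>G\<close>, for functions that have been extended by zero; all
  integrals then extend over the whole space.\<close>

definition zero_trace :: "'a::euclidean_space set \<Rightarrow> ('a \<Rightarrow> real) \<Rightarrow> ('a \<Rightarrow> 'a) \<Rightarrow> bool" where
  "zero_trace V w G \<longleftrightarrow> integrable lebesgue w \<and> integrable lebesgue G \<and>
     (\<exists>\<psi> d\<psi>. (\<forall>k::nat. test_function V (\<psi> k) (d\<psi> k)) \<and>
        (\<lambda>k. LINT x|lebesgue. \<bar>\<psi> k x - w x\<bar>) \<longlonglongrightarrow> 0 \<and>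
        (\<lambda>k. LINT x|lebesgue. norm (d\<psi> k x - G x)) \<longlonglongrightarrow> 0)"

lemma integrable_lebesgue_lborel:
  fixes f :: "'a::euclidean_space \<Rightarrow> 'b::{banach, second_countable_topology}"
  shows "integrable lborel f \<Longrightarrow> integrable lebesgue f"
  using integrable_completion[of f lborel] by (simp add: borel_measurable_integrable)

lemma test_function_integrable_lebesgue:
  assumes "test_function V \<psi> d\<psi>"
  shows "integrable lebesgue \<psi>" "integrable lebesgue d\<psi>"
    "\<psi> \<in> borel_measurable lebesgue" "d\<psi> \<in> borel_measurable lebesgue"
  using test_function_integrable(1,2)[OF assms] integrable_lebesgue_lborel borel_measurable_integrable by blast+

lemma zero_traceE:
  assumes "zero_trace V w G"
  obtains \<psi> d\<psi> where "\<And>k::nat. test_function V (\<psi> k) (d\<psi> k)"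
    "(\<lambda>k. LINT x|lebesgue. \<bar>\<psi> k x - w x\<bar>) \<longlonglongrightarrow> 0" "(\<lambda>k. LINT x|lebesgue. norm (d\<psi> k x - G x)) \<longlonglongrightarrow> 0"
    "integrable lebesgue w" "integrable lebesgue G"
    "\<And>k. integrable lebesgue (\<lambda>x. \<bar>\<psi> k x - w x\<bar>)" "\<And>k. integrable lebesgue (\<lambda>x. norm (d\<psi> k x - G x))"
proof -
  obtain \<psi> d\<psi> where a: "\<And>k::nat. test_function V (\<psi> k) (d\<psi> k)"
    "(\<lambda>k. LINT x|lebesgue. \<bar>\<psi> k x - w x\<bar>) \<longlonglongrightarrow> 0" "(\<lambda>k. LINT x|lebesgue. norm (d\<psi> k x - G x)) \<longlonglongrightarrow> 0"
    using assms unfolding zero_trace_def by blast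
  have i: "integrable lebesgue w" "integrable lebesgue G" using assms unfolding zero_trace_def by blast+
  show thesis
  proof (rule that[of \<psi> d\<psi>])
    show "integrable lebesgue (\<lambda>x. \<bar>\<psi> k x - w x\<bar>)" for k
      using test_function_integrable_lebesgue(1)[OF a(1)[of k]] i by simp
    show "integrable lebesgue (\<lambda>x. norm (d\<psi> k x - G x))" for k
      using test_function_integrable_lebesgue(2)[OF a(1)[of k]] i by simp
  qed (use a i in auto)
qed

lemma zero_trace_mono: "zero_trace V w G \<Longrightarrow> V \<subseteq> U \<Longrightarrow> zero_trace U w G"
  unfolding zero_trace_def using test_function_mono by blast

lemma zero_trace_test: "test_function V \<psi> d\<psi> \<Longrightarrow> zero_trace V \<psi> d\<psi>"
  unfolding zero_trace_def using test_function_integrable_lebesgue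
  by (intro conjI exI[of _ "\<lambda>_. \<psi>"] exI[of _ "\<lambda>_. d\<psi>"]) auto

text \<open>The class is closed, being a closure: choose from the \<open>k\<close>-th sequence a test function with error
  below \<open>1 / (k + 1)\<close>.\<close>

lemma zero_trace_limit:
  assumes a: "\<And>k::nat. zero_trace V (w k) (G k)" and i: "integrable lebesgue w'" "integrable lebesgue G'"
    and lim: "(\<lambda>k. LINT x|lebesgue. \<bar>w k x - w' x\<bar>) \<longlonglongrightarrow> 0"
      "(\<lambda>k. LINT x|lebesgue. norm (G k x - G' x)) \<longlonglongrightarrow> 0"
  shows "zero_trace V w' G'"
proof -
  have "\<exists>\<psi> d\<psi>. test_function V \<psi> d\<psi> \<and> (LINT x|lebesgue. \<bar>\<psi> x - w k x\<bar>) < 1 / real (Suc k)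
      \<and> (LINT x|lebesgue. norm (d\<psi> x - G k x)) < 1 / real (Suc k)" for k
  proof -
    obtain \<psi> d\<psi> where z: "\<And>j::nat. test_function V (\<psi> j) (d\<psi> j)"
    "(\<lambda>j. LINT x|lebesgue. \<bar>\<psi> j x - w k x\<bar>) \<longlonglongrightarrow> 0" "(\<lambda>j. LINT x|lebesgue. norm (d\<psi> j x - G k x)) \<longlonglongrightarrow> 0"
      using a[of k] by (rule zero_traceE) blast
    have p: "0 < 1 / real (Suc k)" by simp
    have "\<forall>\<^sub>F j in sequentially. (LINT x|lebesgue. \<bar>\<psi> j x - w k x\<bar>) < 1 / real (Suc k)
        \<and> (LINT x|lebesgue. norm (d\<psi> j x - G k x)) < 1 / real (Suc k)"
      by (intro eventually_conj order_tendstoD(2)[OF z(2) p] order_tendstoD(2)[OF z(3) p])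
    then obtain j where "(LINT x|lebesgue. \<bar>\<psi> j x - w k x\<bar>) < 1 / real (Suc k)
        \<and> (LINT x|lebesgue. norm (d\<psi> j x - G k x)) < 1 / real (Suc k)"
      using eventually_happens'[OF sequentially_bot] by blast
    then show ?thesis using z(1) by blast
  qed
  then have "\<forall>k. \<exists>\<psi> d\<psi>. test_function V \<psi> d\<psi> \<and> (LINT x|lebesgue. \<bar>\<psi> x - w k x\<bar>) < 1 / real (Suc k)
      \<and> (LINT x|lebesgue. norm (d\<psi> x - G k x)) < 1 / real (Suc k)" ..
  then obtain \<psi> d\<psi> where all: "\<forall>k. test_function V (\<psi> k) (d\<psi> k) \<and> (LINT x|lebesgue. \<bar>\<psi> k x - w k x\<bar>) < 1 / real (Suc k)
      \<and> (LINT x|lebesgue. norm (d\<psi> k x - G k x)) < 1 / real (Suc k)"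
    unfolding choice_iff by (elim exE)
  then have T: "\<And>k. test_function V (\<psi> k) (d\<psi> k)"
    and l1: "\<And>k. (LINT x|lebesgue. \<bar>\<psi> k x - w k x\<bar>) < 1 / real (Suc k)"
    and l2: "\<And>k. (LINT x|lebesgue. norm (d\<psi> k x - G k x)) < 1 / real (Suc k)" by blast+
  have wi: "integrable lebesgue (w k)" "integrable lebesgue (G k)" for k using a unfolding zero_trace_def by blast+
  note ti = test_function_integrable_lebesgue(1,2)[OF T]
  have tri: "(LINT x|lebesgue. norm (A x - C x)) \<le> (LINT x|lebesgue. norm (A x - B x)) + (LINT x|lebesgue. norm (B x - C x))"
    if "integrable lebesgue A" "integrable lebesgue B" "integrable lebesgue C" for A B C :: "'a \<Rightarrow> 'b::{banach,second_countable_topology}"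
  proof -
    have "(LINT x|lebesgue. norm (A x - C x)) \<le> (LINT x|lebesgue. norm (A x - B x) + norm (B x - C x))"
      using that by (intro Bochner_Integration.integral_mono)
        (auto intro: order_trans[OF _ norm_triangle_ineq])
    then show ?thesis using that by simp
  qed
  have z: "(\<lambda>k. 1 / real (Suc k)) \<longlonglongrightarrow> 0" by real_asymp
  have sq: "a \<longlonglongrightarrow> 0" if "\<And>k. 0 \<le> a k" "\<And>k. a k \<le> 1 / real (Suc k) + b k" "b \<longlonglongrightarrow> 0" for a b :: "nat \<Rightarrow> real"
  proof (rule tendsto_sandwich[OF _ _ tendsto_const])
    show "(\<lambda>k. 1 / real (Suc k) + b k) \<longlonglongrightarrow> 0" using tendsto_add[OF z that(3)] by simp
  qed (use that in simp_all)
  have "(LINT x|lebesgue. \<bar>\<psi> k x - w' x\<bar>) \<le> 1 / real (Suc k) + (LINT x|lebesgue. \<bar>w k x - w' x\<bar>)" for k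
    using tri[OF ti(1)[of k] wi(1)[of k] i(1)] l1[of k] by simp
  from sq[OF _ this lim(1)] have c1: "(\<lambda>k. LINT x|lebesgue. \<bar>\<psi> k x - w' x\<bar>) \<longlonglongrightarrow> 0" by simp
  have "(LINT x|lebesgue. norm (d\<psi> k x - G' x)) \<le> 1 / real (Suc k) + (LINT x|lebesgue. norm (G k x - G' x))" for k
    using tri[OF ti(2)[of k] wi(2)[of k] i(2)] l2[of k] by simp
  from sq[OF _ this lim(2)] have "(\<lambda>k. LINT x|lebesgue. norm (d\<psi> k x - G' x)) \<longlonglongrightarrow> 0" by simp
  with T i c1 show ?thesis unfolding zero_trace_def by blast
qed

lemma integral_limit_from_L1:
  fixes F :: "nat \<Rightarrow> 'a \<Rightarrow> 'b::{banach, second_countable_topology}"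
  assumes "\<And>k. integrable M (F k)" "integrable M F'" "\<And>k. integrable M (D k)"
    "\<And>k. AE x in M. norm (F k x - F' x) \<le> D k x" "(\<lambda>k. LINT x|M. D k x) \<longlonglongrightarrow> 0"
  shows "(\<lambda>k. LINT x|M. F k x) \<longlonglongrightarrow> (LINT x|M. F' x)"
proof (rule LIM_zero_cancel, rule tendsto_norm_zero_cancel, rule tendsto_sandwich[OF _ _ tendsto_const assms(5)])
  show "\<forall>\<^sub>F k in sequentially. 0 \<le> norm ((LINT x|M. F k x) - (LINT x|M. F' x))" by simp
  show "\<forall>\<^sub>F k in sequentially. norm ((LINT x|M. F k x) - (LINT x|M. F' x)) \<le> (LINT x|M. D k x)"
  proof (intro always_eventually allI)
    fix k
    have "norm (LINT x|M. F k x - F' x) \<le> (LINT x|M. norm (F k x - F' x))" by (rule integral_norm_bound)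
    also have "\<dots> \<le> (LINT x|M. D k x)"
      using assms by (intro integral_mono_AE) auto
    finally show "norm ((LINT x|M. F k x) - (LINT x|M. F' x)) \<le> (LINT x|M. D k x)"
      using assms by simp
  qed
qed

lemma integrable_bounded_mult:
  fixes G :: "'a \<Rightarrow> 'b::{banach,second_countable_topology}"
  assumes "X \<in> borel_measurable M" "AE x in M. \<bar>X x\<bar> \<le> C" "integrable M G"
  shows "integrable M (\<lambda>x. X x *\<^sub>R G x)"
proof (rule Bochner_Integration.integrable_bound[where f="\<lambda>x. C * norm (G x)"])
  show "AE x in M. norm (X x *\<^sub>R G x) \<le> norm (C * norm (G x))"
    using assms(2)
  proof eventually_elim
    case (elim x)
    then have "\<bar>X x\<bar> * norm (G x) \<le> \<bar>C\<bar> * norm (G x)" by (intro mult_right_mono) auto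
    then show ?case by (simp add: abs_mult)
  qed
qed (use assms in auto)

lemma integrable_bounded_inner:
  fixes G :: "'a \<Rightarrow> 'b::euclidean_space"
  assumes "X \<in> borel_measurable M" "AE x in M. norm (X x) \<le> C" "integrable M G"
  shows "integrable M (\<lambda>x. X x \<bullet> G x)"
proof (rule Bochner_Integration.integrable_bound[where f="\<lambda>x. C * norm (G x)"])
  show "AE x in M. norm (X x \<bullet> G x) \<le> norm (C * norm (G x))"
    using assms(2)
  proof eventually_elim
    case (elim x)
    then have "norm (X x) * norm (G x) \<le> \<bar>C\<bar> * norm (G x)" by (intro mult_right_mono) auto
    then show ?case using Cauchy_Schwarz_ineq2[of "X x" "G x"] by (simp add: abs_mult)
  qed
qed (use assms in auto)

text \<open>An identity tested by test functions extends to functions with zero boundary values,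
  since the test functions are \<open>L\<^sup>1\<close>-dense among these and the field is bounded.\<close>

lemma zero_trace_field:
  fixes X :: "'a::euclidean_space \<Rightarrow> 'a"
  assumes z: "zero_trace V w G"
    and X: "X \<in> borel_measurable lebesgue" "AE x in lebesgue. norm (X x) \<le> M"
    and F: "F \<in> borel_measurable lebesgue" "AE x in lebesgue. \<bar>F x\<bar> \<le> N"
    and test: "\<And>\<psi> d\<psi>. test_function V \<psi> d\<psi> \<Longrightarrow> (LINT x|lebesgue. X x \<bullet> d\<psi> x) = (LINT x|lebesgue. F x * \<psi> x)"
  shows "(LINT x|lebesgue. X x \<bullet> G x) = (LINT x|lebesgue. F x * w x)"
proof -
  obtain \<psi> d\<psi> where a: "\<And>k::nat. test_function V (\<psi> k) (d\<psi> k)"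
    "(\<lambda>k. LINT x|lebesgue. \<bar>\<psi> k x - w x\<bar>) \<longlonglongrightarrow> 0" "(\<lambda>k. LINT x|lebesgue. norm (d\<psi> k x - G x)) \<longlonglongrightarrow> 0"
    and i: "integrable lebesgue w" "integrable lebesgue G"
    "\<And>k. integrable lebesgue (\<lambda>x. \<bar>\<psi> k x - w x\<bar>)" "\<And>k. integrable lebesgue (\<lambda>x. norm (d\<psi> k x - G x))"
    using z by (rule zero_traceE) blast
  note ti = test_function_integrable_lebesgue(1,2)[OF a(1)]
  have "(\<lambda>k. LINT x|lebesgue. X x \<bullet> d\<psi> k x) \<longlonglongrightarrow> (LINT x|lebesgue. X x \<bullet> G x)"
  proof (rule integral_limit_from_L1)
    show "(\<lambda>k. LINT x|lebesgue. M * norm (d\<psi> k x - G x)) \<longlonglongrightarrow> 0"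
      using tendsto_mult[OF tendsto_const[of M] a(3)] by simp
    show "AE x in lebesgue. norm (X x \<bullet> d\<psi> k x - X x \<bullet> G x) \<le> M * norm (d\<psi> k x - G x)" for k
      using X(2)
    proof eventually_elim
      case (elim x)
      have "norm (X x \<bullet> d\<psi> k x - X x \<bullet> G x) \<le> norm (X x) * norm (d\<psi> k x - G x)"
        using Cauchy_Schwarz_ineq2[of "X x" "d\<psi> k x - G x"] by (simp add: inner_diff_right)
      also have "\<dots> \<le> M * norm (d\<psi> k x - G x)" using elim by (intro mult_right_mono) auto
      finally show ?case .
    qed
  qed (use i ti X in \<open>auto intro!: integrable_bounded_inner\<close>)
  moreover have "(\<lambda>k. LINT x|lebesgue. F x * \<psi> k x) \<longlonglongrightarrow> (LINT x|lebesgue. F x * w x)"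
  proof (rule integral_limit_from_L1)
    show "(\<lambda>k. LINT x|lebesgue. N * \<bar>\<psi> k x - w x\<bar>) \<longlonglongrightarrow> 0"
      using tendsto_mult[OF tendsto_const[of N] a(2)] by simp
    show "AE x in lebesgue. norm (F x * \<psi> k x - F x * w x) \<le> N * \<bar>\<psi> k x - w x\<bar>" for k
      using F(2)
    proof eventually_elim
      case (elim x)
      have "norm (F x * \<psi> k x - F x * w x) = \<bar>F x\<bar> * \<bar>\<psi> k x - w x\<bar>"
        by (simp add: abs_mult[symmetric] right_diff_distrib)
      also have "\<dots> \<le> N * \<bar>\<psi> k x - w x\<bar>" using elim by (intro mult_right_mono) auto
      finally show ?case .
    qed
  qed (use i ti F integrable_bounded_mult[OF F ti(1)] integrable_bounded_mult[OF F i(1)] in auto)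
  ultimately show ?thesis unfolding test[OF a(1)] by (rule LIMSEQ_unique)
qed

text \<open>The \<open>e\<close>-component of integration by parts against \<open>\<psi>\<close> is an identity tested with \<open>u\<close>: the field is
  \<open>\<psi> e\<close> and the source is minus the derivative of \<open>\<psi>\<close> in direction \<open>e\<close>. For test functions it holds
  by classical integration by parts.\<close>

lemma zero_trace_weak_gradient:
  assumes z: "zero_trace V u g"
  shows "weak_gradient V u g"
  unfolding weak_gradient_iff
proof (intro conjI allI impI)
  have i: "integrable lebesgue u" "integrable lebesgue g" using z unfolding zero_trace_def by blast+
  show "locally_integrable V u" "locally_integrable V g"
    unfolding locally_integrable_def set_integrable_def
    using integrable_mult_indicator[OF _ i(1)] integrable_mult_indicator[OF _ i(2)] lmeasurable_compact fmeasurableD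
    by blast+
  fix \<psi> d\<psi> assume T: "test_function V \<psi> d\<psi>"
  obtain B where B: "\<And>x. \<bar>\<psi> x\<bar> \<le> B" "\<And>x. norm (d\<psi> x) \<le> B" using T by (rule test_functionE) blast
  note m = test_function_integrable_lebesgue[OF T]
  show "(LINT x|lebesgue. u x *\<^sub>R d\<psi> x) = - (LINT x|lebesgue. \<psi> x *\<^sub>R g x)"
  proof (rule euclidean_eqI)
    fix e :: 'a assume "e \<in> Basis"
    have eB: "norm e = 1" using \<open>e \<in> Basis\<close> by simp
    have "(LINT x|lebesgue. (\<psi> x *\<^sub>R e) \<bullet> g x) = (LINT x|lebesgue. - (d\<psi> x \<bullet> e) * u x)"
    proof (rule zero_trace_field[OF z])
      show "AE x in lebesgue. norm (\<psi> x *\<^sub>R e) \<le> B" using B eB by simp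
      show "AE x in lebesgue. \<bar>- (d\<psi> x \<bullet> e)\<bar> \<le> B"
      proof (rule AE_I2)
        fix x show "\<bar>- (d\<psi> x \<bullet> e)\<bar> \<le> B"
          using Cauchy_Schwarz_ineq2[of "d\<psi> x" e] B(2)[of x] eB by simp
      qed
      show "(\<lambda>x. \<psi> x *\<^sub>R e) \<in> borel_measurable lebesgue" "(\<lambda>x. - (d\<psi> x \<bullet> e)) \<in> borel_measurable lebesgue"
        using m by auto
      fix \<phi> d\<phi> assume T2: "test_function V \<phi> d\<phi>"
      obtain B2 where B2: "\<And>x. \<bar>\<phi> x\<bar> \<le> B2" using T2 by (rule test_functionE) blast
      have i1: "integrable lborel (\<lambda>x. \<psi> x *\<^sub>R d\<phi> x)" "integrable lborel (\<lambda>x. \<phi> x *\<^sub>R d\<psi> x)"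
        using test_function_integrable(4)[OF T2 test_function_continuous(3)[OF T] B(1)]
          test_function_integrable(4)[OF T test_function_continuous(3)[OF T2] B2] by auto
      have lb: "(LINT x|lebesgue. Y x \<bullet> e) = (LINT x|lborel. Y x) \<bullet> e" if "integrable lborel Y" for Y :: "'a \<Rightarrow> 'a"
        using integral_inner_left[OF integrable_lebesgue_lborel[OF that]] integral_completion[of Y lborel] borel_measurable_integrable[OF that]
        by simp
      have "(LINT x|lebesgue. (\<psi> x *\<^sub>R e) \<bullet> d\<phi> x) = (LINT x|lebesgue. (\<psi> x *\<^sub>R d\<phi> x) \<bullet> e)"
        by (simp add: inner_commute)
      also have "\<dots> = (LINT x|lborel. \<psi> x *\<^sub>R d\<phi> x) \<bullet> e"
        by (rule lb[OF i1(1)])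
      also have "\<dots> = - (LINT x|lborel. \<phi> x *\<^sub>R d\<psi> x) \<bullet> e"
        using integration_by_parts[OF T2 T] by simp
      also have "\<dots> = - (LINT x|lebesgue. (\<phi> x *\<^sub>R d\<psi> x) \<bullet> e)"
        unfolding lb[OF i1(2)] by simp
      also have "\<dots> = (LINT x|lebesgue. - (d\<psi> x \<bullet> e) * \<phi> x)"
        by (simp add: mult.commute)
      finally show "(LINT x|lebesgue. (\<psi> x *\<^sub>R e) \<bullet> d\<phi> x) = (LINT x|lebesgue. - (d\<psi> x \<bullet> e) * \<phi> x)" .
    qed
    then have eq: "(LINT x|lebesgue. (\<psi> x *\<^sub>R g x) \<bullet> e) = - (LINT x|lebesgue. (u x *\<^sub>R d\<psi> x) \<bullet> e)"
      by (simp add: inner_commute mult.commute)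
    have j1: "integrable lebesgue (\<lambda>x. \<psi> x *\<^sub>R g x)"
      using integrable_bounded_mult[OF m(3) _ i(2)] B(1) by auto
    have j2: "integrable lebesgue (\<lambda>x. u x *\<^sub>R d\<psi> x)"
    proof (rule Bochner_Integration.integrable_bound[where f="\<lambda>x. B * \<bar>u x\<bar>"])
      show "AE x in lebesgue. norm (u x *\<^sub>R d\<psi> x) \<le> norm (B * \<bar>u x\<bar>)"
      proof (rule AE_I2)
        fix x have "\<bar>u x\<bar> * norm (d\<psi> x) \<le> \<bar>u x\<bar> * \<bar>B\<bar>" using B(2)[of x] by (intro mult_left_mono) auto
        then show "norm (u x *\<^sub>R d\<psi> x) \<le> norm (B * \<bar>u x\<bar>)" by (simp add: abs_mult mult.commute)
      qed
    qed (use i m in auto)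
    show "(LINT x|lebesgue. u x *\<^sub>R d\<psi> x) \<bullet> e = - (LINT x|lebesgue. \<psi> x *\<^sub>R g x) \<bullet> e"
      using eq integral_inner_left[OF j1, of e] integral_inner_left[OF j2, of e]
      by (simp only: inner_minus_left minus_minus)
  qed
qed

lemma zero_trace_W011:
  assumes "zero_trace V u g" "open V" "\<And>x. x \<notin> V \<Longrightarrow> u x = 0" "\<And>x. x \<notin> V \<Longrightarrow> g x = 0"
  shows "u \<in> W011 V"
proof -
  obtain \<psi> d\<psi> where a: "\<And>k::nat. test_function V (\<psi> k) (d\<psi> k)"
    "(\<lambda>k. LINT x|lebesgue. \<bar>\<psi> k x - u x\<bar>) \<longlonglongrightarrow> 0" "(\<lambda>k. LINT x|lebesgue. norm (d\<psi> k x - g x)) \<longlonglongrightarrow> 0"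
    and i: "integrable lebesgue u" "integrable lebesgue g"
    using assms(1) by (rule zero_traceE) blast
  have "(LINT x:V|lebesgue. \<bar>\<psi> k x - u x\<bar>) = (LINT x|lebesgue. \<bar>\<psi> k x - u x\<bar>)"
    "(LINT x:V|lebesgue. norm (d\<psi> k x - g x)) = (LINT x|lebesgue. norm (d\<psi> k x - g x))" for k
    using assms(3,4) test_function_vanishes[OF a(1)]
    by (auto intro!: set_integral_eq_integral_if_vanishing)
  then show ?thesis unfolding W011_def
    using a integrable_mult_indicator[OF _ i(1), of V] integrable_mult_indicator[OF _ i(2), of V]
      zero_trace_weak_gradient[OF assms(1)] assms(2)
    by (auto intro!: exI[of _ g] exI[of _ \<psi>] exI[of _ d\<psi>] simp: set_integrable_def)
qed

lemma W011_zero_trace: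
  fixes w :: "'a::euclidean_space \<Rightarrow> real"
  assumes "w \<in> W011 V" "open V"
  shows "zero_trace V (\<lambda>x. indicator V x * w x) (\<lambda>x. indicator V x *\<^sub>R wgrad V w x)"
    and "weak_gradient V w (wgrad V w)"
proof -
  obtain g \<psi> d\<psi> where g: "weak_gradient V w g" "set_integrable lebesgue V w" "set_integrable lebesgue V g"
    and a: "\<And>k::nat. test_function V (\<psi> k) (d\<psi> k)"
      "(\<lambda>k. LINT x:V|lebesgue. \<bar>\<psi> k x - w x\<bar>) \<longlonglongrightarrow> 0" "(\<lambda>k. LINT x:V|lebesgue. norm (d\<psi> k x - g x)) \<longlonglongrightarrow> 0"
    using assms(1) unfolding W011_def by blast
  show wg: "weak_gradient V w (wgrad V w)" by (rule weak_gradient_wgrad[OF g(1)])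
  have ae: "AE x in lebesgue. indicator V x *\<^sub>R g x = indicator V x *\<^sub>R wgrad V w x"
    using weak_gradient_unique[OF assms(2) g(1) wg] by (auto simp: indicator_def elim!: eventually_mono)
  have m: "(\<lambda>x. indicator V x *\<^sub>R wgrad V w x) \<in> borel_measurable lebesgue"
    using wg assms(2) unfolding weak_gradient_iff by (intro locally_integrable_imp_measurable) auto
  have gi: "integrable lebesgue (\<lambda>x. indicator V x *\<^sub>R g x)" using g(3) by (simp add: set_integrable_def)
  have Gi: "integrable lebesgue (\<lambda>x. indicator V x *\<^sub>R wgrad V w x)"
    by (rule integrable_cong_AE_imp[OF gi m ae])
  have 1: "(LINT x:V|lebesgue. \<bar>\<psi> k x - w x\<bar>) = (LINT x|lebesgue. \<bar>\<psi> k x - indicator V x * w x\<bar>)" for k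
    unfolding set_lebesgue_integral_def using test_function_vanishes[OF a(1)[of k]]
    by (intro Bochner_Integration.integral_cong) (auto simp: indicator_def)
  have 2: "(LINT x:V|lebesgue. norm (d\<psi> k x - g x)) = (LINT x|lebesgue. norm (d\<psi> k x - indicator V x *\<^sub>R wgrad V w x))" for k
  proof -
    have "(LINT x:V|lebesgue. norm (d\<psi> k x - g x)) = (LINT x|lebesgue. norm (d\<psi> k x - indicator V x *\<^sub>R g x))"
      unfolding set_lebesgue_integral_def using test_function_vanishes[OF a(1)[of k]]
      by (intro Bochner_Integration.integral_cong) (auto simp: indicator_def)
    also have "\<dots> = (LINT x|lebesgue. norm (d\<psi> k x - indicator V x *\<^sub>R wgrad V w x))"
    proof (rule integral_cong_AE)
      show "AE x in lebesgue. norm (d\<psi> k x - indicator V x *\<^sub>R g x) = norm (d\<psi> k x - indicator V x *\<^sub>R wgrad V w x)"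
        using ae by eventually_elim (simp only:)
    qed (use test_function_integrable_lebesgue(4)[OF a(1)] m borel_measurable_integrable[OF gi] in auto)
    finally show ?thesis .
  qed
  show "zero_trace V (\<lambda>x. indicator V x * w x) (\<lambda>x. indicator V x *\<^sub>R wgrad V w x)"
    unfolding zero_trace_def
    using g(2) Gi a unfolding 1 2 by (auto simp: set_integrable_def)
qed

section \<open>Cutoff functions of bounded variation\<close>

text \<open>The bound on the total mass of the gradients is what keeps the error of a cutoff small for functions
  that are small near the boundary. Balls and shells have such cutoffs because their boundaries have
  finite area.\<close>

definition cutoffs :: "'a::euclidean_space set \<Rightarrow> (nat \<Rightarrow> 'a \<Rightarrow> real) \<Rightarrow> (nat \<Rightarrow> 'a \<Rightarrow> 'a) \<Rightarrow> real \<Rightarrow> bool" where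
  "cutoffs V \<eta> d\<eta> C \<longleftrightarrow> (\<forall>k. test_function V (\<eta> k) (d\<eta> k)) \<and> (\<forall>k x. 0 \<le> \<eta> k x \<and> \<eta> k x \<le> 1) \<and>
     (\<forall>K. compact K \<and> K \<subseteq> V \<longrightarrow> (\<forall>\<^sub>F k in sequentially. \<forall>x\<in>K. \<eta> k x = 1 \<and> d\<eta> k x = 0)) \<and>
     (\<forall>k. (LINT x|lebesgue. norm (d\<eta> k x)) \<le> C)"

text \<open>A cutoff that is compactly supported in \<open>V\<close> turns test functions on \<open>U\<close> into test functions on \<open>V\<close>.\<close>

lemma test_cutoff_zero_trace:
  fixes w :: "'a::euclidean_space \<Rightarrow> real"
  assumes z: "zero_trace U w G" and T: "test_function V \<eta> d\<eta>" and V: "open V"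
  shows "zero_trace V (\<lambda>x. \<eta> x * w x) (\<lambda>x. \<eta> x *\<^sub>R G x + w x *\<^sub>R d\<eta> x)"
proof -
  obtain \<psi> d\<psi> where a: "\<And>k::nat. test_function U (\<psi> k) (d\<psi> k)"
    "(\<lambda>k. LINT x|lebesgue. \<bar>\<psi> k x - w x\<bar>) \<longlonglongrightarrow> 0" "(\<lambda>k. LINT x|lebesgue. norm (d\<psi> k x - G x)) \<longlonglongrightarrow> 0"
    and i: "integrable lebesgue w" "integrable lebesgue G"
    "\<And>k. integrable lebesgue (\<lambda>x. \<bar>\<psi> k x - w x\<bar>)" "\<And>k. integrable lebesgue (\<lambda>x. norm (d\<psi> k x - G x))"
    using z by (rule zero_traceE) blast
  obtain B where B: "\<And>x. \<bar>\<eta> x\<bar> \<le> B" "\<And>x. norm (d\<eta> x) \<le> B" "0 \<le> B" using T by (rule test_functionE) blast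
  note m = test_function_integrable_lebesgue[OF T]
  have wd: "integrable lebesgue (\<lambda>x. w x *\<^sub>R d\<eta> x)"
  proof (rule Bochner_Integration.integrable_bound[where f="\<lambda>x. B * \<bar>w x\<bar>"])
    show "AE x in lebesgue. norm (w x *\<^sub>R d\<eta> x) \<le> norm (B * \<bar>w x\<bar>)"
      using B by (auto intro!: AE_I2 mult_left_mono simp: abs_mult mult.commute[of B])
  qed (use i m in auto)
  have iw: "integrable lebesgue (\<lambda>x. \<eta> x * w x)"
    using integrable_bounded_mult[OF m(3) _ i(1)] B by auto
  have iG: "integrable lebesgue (\<lambda>x. \<eta> x *\<^sub>R G x + w x *\<^sub>R d\<eta> x)"
    by (intro Bochner_Integration.integrable_add wd integrable_bounded_mult[OF m(3) AE_I2[OF B(1)] i(2)])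
  have T': "test_function V (\<lambda>x. \<eta> x * \<psi> k x) (\<lambda>x. \<eta> x *\<^sub>R d\<psi> k x + \<psi> k x *\<^sub>R d\<eta> x)" for k
  proof -
    have "test_function V (\<lambda>x. if x \<in> V then \<eta> x * \<psi> k x else 0) (\<lambda>x. if x \<in> V then \<eta> x *\<^sub>R d\<psi> k x + \<psi> k x *\<^sub>R d\<eta> x else 0)"
      by (intro test_function_mult[OF T V])
        (use a(1)[of k] in \<open>auto simp: test_function_def intro: continuous_on_subset\<close>)
    moreover have "(\<lambda>x. if x \<in> V then \<eta> x * \<psi> k x else 0) = (\<lambda>x. \<eta> x * \<psi> k x)"
      "(\<lambda>x. if x \<in> V then \<eta> x *\<^sub>R d\<psi> k x + \<psi> k x *\<^sub>R d\<eta> x else 0) = (\<lambda>x. \<eta> x *\<^sub>R d\<psi> k x + \<psi> k x *\<^sub>R d\<eta> x)"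
      using test_function_vanishes[OF T] by auto
    ultimately show ?thesis by simp
  qed
  have n1: "\<bar>\<eta> x * \<psi> k x - \<eta> x * w x\<bar> \<le> B * \<bar>\<psi> k x - w x\<bar>" for x k
    using B(1)[of x] by (auto simp: abs_mult right_diff_distrib[symmetric] intro!: mult_right_mono)
  have n2: "norm ((\<eta> x *\<^sub>R d\<psi> k x + \<psi> k x *\<^sub>R d\<eta> x) - (\<eta> x *\<^sub>R G x + w x *\<^sub>R d\<eta> x))
      \<le> B * norm (d\<psi> k x - G x) + B * \<bar>\<psi> k x - w x\<bar>" for x k
  proof -
    have "(\<eta> x *\<^sub>R d\<psi> k x + \<psi> k x *\<^sub>R d\<eta> x) - (\<eta> x *\<^sub>R G x + w x *\<^sub>R d\<eta> x)
       = \<eta> x *\<^sub>R (d\<psi> k x - G x) + (\<psi> k x - w x) *\<^sub>R d\<eta> x" by (simp add: algebra_simps)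
    also have "norm \<dots> \<le> norm (\<eta> x *\<^sub>R (d\<psi> k x - G x)) + norm ((\<psi> k x - w x) *\<^sub>R d\<eta> x)" by (rule norm_triangle_ineq)
    also have "\<dots> \<le> B * norm (d\<psi> k x - G x) + \<bar>\<psi> k x - w x\<bar> * B"
      using B by (intro add_mono) (auto intro!: mult_right_mono mult_left_mono)
    finally show ?thesis by (simp add: mult.commute)
  qed
  show ?thesis unfolding zero_trace_def
  proof (intro conjI exI allI)
    show "(\<lambda>k. LINT x|lebesgue. \<bar>\<eta> x * \<psi> k x - \<eta> x * w x\<bar>) \<longlonglongrightarrow> 0"
    proof (rule integral_limit_from_L1[where F'="\<lambda>_. 0", simplified])
      show "(\<lambda>k. LINT x|lebesgue. B * \<bar>\<psi> k x - w x\<bar>) \<longlonglongrightarrow> 0"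
        using tendsto_mult[OF tendsto_const[of B] a(2)] by simp
      show "integrable lebesgue (\<lambda>x. \<bar>\<eta> x * \<psi> k x - \<eta> x * w x\<bar>)" for k
        using test_function_integrable_lebesgue(1)[OF T'[of k]] iw by simp
    qed (use n1 i in auto)
    let ?D = "\<lambda>k x. B * norm (d\<psi> k x - G x) + B * \<bar>\<psi> k x - w x\<bar>"
    have iD: "integrable lebesgue (?D k)" for k
      by (intro Bochner_Integration.integrable_add integrable_mult_right i)
    have lD: "(\<lambda>k. LINT x|lebesgue. ?D k x) \<longlonglongrightarrow> 0"
      by (subst Bochner_Integration.integral_add)
        (simp_all add: i(3,4) tendsto_add[OF tendsto_mult[OF tendsto_const a(3)] tendsto_mult[OF tendsto_const a(2)], of B B, simplified])
    have iN: "integrable lebesgue (\<lambda>x. norm ((\<eta> x *\<^sub>R d\<psi> k x + \<psi> k x *\<^sub>R d\<eta> x) - (\<eta> x *\<^sub>R G x + w x *\<^sub>R d\<eta> x)))" for k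
      by (intro integrable_norm Bochner_Integration.integrable_diff test_function_integrable_lebesgue(2)[OF T'] iG)
    from integral_limit_from_L1[where F'="\<lambda>_. 0", OF iN _ iD _ lD]
    show "(\<lambda>k. LINT x|lebesgue. norm ((\<eta> x *\<^sub>R d\<psi> k x + \<psi> k x *\<^sub>R d\<eta> x) - (\<eta> x *\<^sub>R G x + w x *\<^sub>R d\<eta> x))) \<longlonglongrightarrow> 0"
      using n2 by simp
  qed (use T' iw iG in auto)
qed

text \<open>The gradients of the cutoffs live where \<open>w\<close> is small, and their total mass is bounded.\<close>

lemma cutoff_boundary_layer:
  fixes w :: "'a::euclidean_space \<Rightarrow> real"
  assumes V: "open V" "bounded V" and c: "cutoffs V \<eta> d\<eta> C"
    and w: "continuous_on (closure V) w" "\<And>x. x \<in> frontier V \<Longrightarrow> w x = 0"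
  shows "(\<lambda>k. LINT x|lebesgue. \<bar>indicator V x * w x\<bar> * norm (d\<eta> k x)) \<longlonglongrightarrow> 0"
    "\<And>k. integrable lebesgue (\<lambda>x. \<bar>indicator V x * w x\<bar> * norm (d\<eta> k x))"
proof -
  have T: "\<And>k. test_function V (\<eta> k) (d\<eta> k)" and C: "\<And>k. (LINT x|lebesgue. norm (d\<eta> k x)) \<le> C"
    and ev: "\<And>K. compact K \<Longrightarrow> K \<subseteq> V \<Longrightarrow> (\<forall>\<^sub>F k in sequentially. \<forall>x\<in>K. \<eta> k x = 1 \<and> d\<eta> k x = 0)"
    using c unfolding cutoffs_def by blast+
  have cl: "compact (closure V)" using V by simp
  have C0: "0 \<le> C" using order_trans[OF _ C[of 0]] by simp
  obtain B where B: "\<And>x. x \<in> closure V \<Longrightarrow> \<bar>w x\<bar> \<le> B"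
    using compact_imp_bounded[OF compact_continuous_image[OF w(1) cl]] unfolding bounded_iff by auto
  have m: "(\<lambda>x. indicator V x * w x) \<in> borel_measurable lebesgue"
    using borel_measurable_continuous_on_indicator[of V w] V w(1) closure_subset
    by (auto intro!: lebesgue_measurable_borel intro: continuous_on_subset)
  show i: "integrable lebesgue (\<lambda>x. \<bar>indicator V x * w x\<bar> * norm (d\<eta> k x))" for k
  proof -
    have "AE x in lebesgue. \<bar>\<bar>indicator V x * w x\<bar>\<bar> \<le> \<bar>B\<bar>"
      using B closure_subset by (intro AE_I2) (force simp: indicator_def)
    from integrable_bounded_mult[OF _ this integrable_norm[OF test_function_integrable_lebesgue(2)[OF T[of k]]]] m
    show ?thesis by simp
  qed
  show "(\<lambda>k. LINT x|lebesgue. \<bar>indicator V x * w x\<bar> * norm (d\<eta> k x)) \<longlonglongrightarrow> 0"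
  proof (rule LIMSEQ_I)
    fix r :: real assume r: "r > 0"
    define e where "e = r / (2 * (C + 1))"
    have e: "e > 0" using r C0 by (simp add: e_def)
    have "e * C \<le> e * (C + 1)" using e by simp
    also have "\<dots> = r / 2" using C0 by (simp add: e_def divide_simps)
    finally have e: "e > 0" "e * C < r" using r e by linarith+
    define K where "K = {x \<in> closure V. e \<le> \<bar>w x\<bar>}"
    have "closed K" unfolding K_def
      by (intro continuous_on_closed_Collect_le continuous_intros w(1)) simp
    moreover have "K \<subseteq> closure V" unfolding K_def by blast
    ultimately have K: "compact K"
      using bounded_subset[OF compact_imp_bounded[OF cl]] compact_eq_bounded_closed by blast
    have "K \<subseteq> V"
    proof
      fix x assume x: "x \<in> K"
      then have "w x \<noteq> 0" "x \<in> closure V" using e(1) by (auto simp: K_def)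
      then have "x \<notin> frontier V" using w(2) by blast
      then show "x \<in> V" using \<open>x \<in> closure V\<close> V(1) by (simp add: frontier_def interior_open)
    qed
    from ev[OF K this] show "\<exists>n0. \<forall>n\<ge>n0. norm ((LINT x|lebesgue. \<bar>indicator V x * w x\<bar> * norm (d\<eta> n x)) - 0) < r"
      unfolding eventually_sequentially
    proof (elim exE, intro exI allI impI)
      fix N n assume N: "\<forall>n\<ge>N. \<forall>x\<in>K. \<eta> n x = 1 \<and> d\<eta> n x = 0" and n: "N \<le> n"
      have "\<bar>indicator V x * w x\<bar> * norm (d\<eta> n x) \<le> e * norm (d\<eta> n x)" for x
      proof (cases "x \<in> K \<or> x \<notin> V")
        case True
        then have "d\<eta> n x = 0" using N n test_function_vanishes[OF T] by blast
        then show ?thesis by simp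
      next
        case False
        then have "\<bar>w x\<bar> \<le> e" using closure_subset by (force simp: K_def)
        then show ?thesis using e(1) by (intro mult_right_mono) (auto simp: indicator_def)
      qed
      then have "(LINT x|lebesgue. \<bar>indicator V x * w x\<bar> * norm (d\<eta> n x)) \<le> (LINT x|lebesgue. e * norm (d\<eta> n x))"
        using i test_function_integrable_lebesgue(2)[OF T]
        by (intro Bochner_Integration.integral_mono) auto
      also have "\<dots> \<le> e * C" using C[of n] e(1) by simp
      finally show "norm ((LINT x|lebesgue. \<bar>indicator V x * w x\<bar> * norm (d\<eta> n x)) - 0) < r"
        using e(2) by simp
    qed
  qed
qed

text \<open>Cut \<open>w\<close> off and let the boundary layer disappear. This converts pointwise vanishing on the frontier
  of \<open>V\<close> into approximability by test functions on \<open>V\<close>.\<close>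

lemma zero_trace_from_cutoffs:
  fixes w :: "'a::euclidean_space \<Rightarrow> real"
  assumes V: "open V" "bounded V" and c: "cutoffs V \<eta> d\<eta> C"
    and w: "continuous_on (closure V) w" "\<And>x. x \<in> frontier V \<Longrightarrow> w x = 0"
    and G: "integrable lebesgue (\<lambda>x. indicator V x *\<^sub>R G x)"
    and z: "\<And>k. zero_trace V (\<lambda>x. \<eta> k x * (indicator V x * w x)) (\<lambda>x. \<eta> k x *\<^sub>R indicator V x *\<^sub>R G x + (indicator V x * w x) *\<^sub>R d\<eta> k x)"
  shows "zero_trace V (\<lambda>x. indicator V x * w x) (\<lambda>x. indicator V x *\<^sub>R G x)"
proof -
  have T: "\<And>k. test_function V (\<eta> k) (d\<eta> k)" and b: "\<And>k x. 0 \<le> \<eta> k x" "\<And>k x. \<eta> k x \<le> 1"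
    and ev: "\<And>K. compact K \<Longrightarrow> K \<subseteq> V \<Longrightarrow> (\<forall>\<^sub>F k in sequentially. \<forall>x\<in>K. \<eta> k x = 1 \<and> d\<eta> k x = 0)"
    using c unfolding cutoffs_def by blast+
  have ev1: "\<forall>\<^sub>F k in sequentially. \<eta> k x = 1" if "x \<in> V" for x
    using ev[of "{x}"] that by (auto elim: eventually_mono)
  have m: "(\<lambda>x. indicator V x * w x) \<in> borel_measurable lebesgue"
    using borel_measurable_continuous_on_indicator[of V w] V w(1) closure_subset
    by (auto intro!: lebesgue_measurable_borel intro: continuous_on_subset)
  have cl: "compact (closure V)" using V by simp
  obtain B where B: "\<And>x. x \<in> closure V \<Longrightarrow> \<bar>w x\<bar> \<le> B"
    using compact_imp_bounded[OF compact_continuous_image[OF w(1) cl]] unfolding bounded_iff by auto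
  have "set_integrable lebesgue V w"
    by (rule set_integrable_bounded_lebesgue[where B=B]) (use m V B closure_subset in auto)
  then have wi: "integrable lebesgue (\<lambda>x. indicator V x * w x)" by (simp add: set_integrable_def)
  have zi: "integrable lebesgue (\<lambda>x. \<eta> k x * (indicator V x * w x))"
    "integrable lebesgue (\<lambda>x. \<eta> k x *\<^sub>R indicator V x *\<^sub>R G x + (indicator V x * w x) *\<^sub>R d\<eta> k x)" for k
    using z[of k] unfolding zero_trace_def by blast+
  have le1: "\<bar>\<eta> k x - 1\<bar> \<le> 1" for k x using b[of k x] by linarith
  have \<eta>m: "\<eta> k \<in> borel_measurable lebesgue" for k using test_function_integrable_lebesgue[OF T] by blast
  have lim0: "(\<lambda>k. LINT x|lebesgue. \<bar>\<eta> k x - 1\<bar> * norm (indicator V x *\<^sub>R H x)) \<longlonglongrightarrow> 0"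
    "\<And>k. integrable lebesgue (\<lambda>x. \<bar>\<eta> k x - 1\<bar> * norm (indicator V x *\<^sub>R H x))"
    if H: "integrable lebesgue (\<lambda>x. indicator V x *\<^sub>R H x)" for H :: "'a \<Rightarrow> 'b::euclidean_space"
  proof -
    have Hm: "(\<lambda>x. indicator V x *\<^sub>R H x) \<in> borel_measurable lebesgue"
      using borel_measurable_integrable[OF H] .
    have "(\<lambda>k. LINT x|lebesgue. \<bar>\<eta> k x - 1\<bar> * norm (indicator V x *\<^sub>R H x)) \<longlonglongrightarrow> (LINT x|(lebesgue::'a measure). (0::real))"
    proof (rule integral_dominated_convergence[where w="\<lambda>x. norm (indicator V x *\<^sub>R H x)"])
      show "AE x in lebesgue. (\<lambda>k. \<bar>\<eta> k x - 1\<bar> * norm (indicator V x *\<^sub>R H x)) \<longlonglongrightarrow> 0"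
      proof (rule AE_I2)
        fix x show "(\<lambda>k. \<bar>\<eta> k x - 1\<bar> * norm (indicator V x *\<^sub>R H x)) \<longlonglongrightarrow> 0"
        proof (cases "x \<in> V")
          case True show ?thesis by (rule tendsto_eventually) (use ev1[OF True] in \<open>auto elim: eventually_mono\<close>)
        qed simp
      qed
      show "AE x in lebesgue. norm (\<bar>\<eta> k x - 1\<bar> * norm (indicator V x *\<^sub>R H x)) \<le> norm (indicator V x *\<^sub>R H x)" for k
        using le1 by (intro AE_I2) (simp add: mult_left_le_one_le)
      show "(\<lambda>x. \<bar>\<eta> k x - 1\<bar> * norm (indicator V x *\<^sub>R H x)) \<in> borel_measurable lebesgue" for k
        by (intro borel_measurable_times borel_measurable_norm borel_measurable_abs borel_measurable_diff \<eta>m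
              measurable_compose[OF Hm borel_measurable_norm]) simp
      show "integrable lebesgue (\<lambda>x. norm (indicator V x *\<^sub>R H x))" using H by (rule integrable_norm)
    qed auto
    then show "(\<lambda>k. LINT x|lebesgue. \<bar>\<eta> k x - 1\<bar> * norm (indicator V x *\<^sub>R H x)) \<longlonglongrightarrow> 0" by simp
    show "integrable lebesgue (\<lambda>x. \<bar>\<eta> k x - 1\<bar> * norm (indicator V x *\<^sub>R H x))" for k
      using integrable_bounded_mult[of "\<lambda>x. \<bar>\<eta> k x - 1\<bar>" lebesgue 1, OF _ _ integrable_norm[OF H]] \<eta>m le1 by simp
  qed
  have wi': "integrable lebesgue (\<lambda>x. indicator V x *\<^sub>R w x)" using wi by simp
  show ?thesis
  proof (rule zero_trace_limit[OF z wi G])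
    have "\<bar>\<eta> k x * (indicator V x * w x) - indicator V x * w x\<bar> = \<bar>\<eta> k x - 1\<bar> * norm (indicator V x *\<^sub>R w x)" for k x
    proof -
      have "\<eta> k x * (indicator V x * w x) - indicator V x * w x = (\<eta> k x - 1) * (indicator V x * w x)"
        by (simp add: algebra_simps)
      then show ?thesis by (simp add: abs_mult)
    qed
    then show "(\<lambda>k. LINT x|lebesgue. \<bar>\<eta> k x * (indicator V x * w x) - indicator V x * w x\<bar>) \<longlonglongrightarrow> 0"
      using lim0(1)[OF wi'] by simp
    let ?D = "\<lambda>k x. \<bar>\<eta> k x - 1\<bar> * norm (indicator V x *\<^sub>R G x) + \<bar>indicator V x * w x\<bar> * norm (d\<eta> k x)"
    have layer: "(\<lambda>k. LINT x|lebesgue. \<bar>indicator V x * w x\<bar> * norm (d\<eta> k x)) \<longlonglongrightarrow> 0"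
      "\<And>k. integrable lebesgue (\<lambda>x. \<bar>indicator V x * w x\<bar> * norm (d\<eta> k x))"
      using cutoff_boundary_layer[OF V c w] by blast+
    have iD: "integrable lebesgue (?D k)" for k
      using lim0(2)[OF G] layer(2) by (rule Bochner_Integration.integrable_add)
    have lD: "(\<lambda>k. LINT x|lebesgue. ?D k x) \<longlonglongrightarrow> 0"
      using tendsto_add[OF lim0(1)[OF G] layer(1)]
      by (subst Bochner_Integration.integral_add[OF lim0(2)[OF G] layer(2)]) simp
    have nD: "norm ((\<eta> k x *\<^sub>R indicator V x *\<^sub>R G x + (indicator V x * w x) *\<^sub>R d\<eta> k x) - indicator V x *\<^sub>R G x) \<le> ?D k x" for k x
    proof -
      have "(\<eta> k x *\<^sub>R indicator V x *\<^sub>R G x + (indicator V x * w x) *\<^sub>R d\<eta> k x) - indicator V x *\<^sub>R G x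
         = (\<eta> k x - 1) *\<^sub>R indicator V x *\<^sub>R G x + (indicator V x * w x) *\<^sub>R d\<eta> k x"
        by (simp add: algebra_simps)
      also have "norm \<dots> \<le> norm ((\<eta> k x - 1) *\<^sub>R indicator V x *\<^sub>R G x) + norm ((indicator V x * w x) *\<^sub>R d\<eta> k x)"
        by (rule norm_triangle_ineq)
      also have "\<dots> = ?D k x" by (simp only: norm_scaleR)
      finally show ?thesis .
    qed
    have "integrable lebesgue (\<lambda>x. norm ((\<eta> k x *\<^sub>R indicator V x *\<^sub>R G x + (indicator V x * w x) *\<^sub>R d\<eta> k x) - indicator V x *\<^sub>R G x))" for k
      by (intro integrable_norm Bochner_Integration.integrable_diff zi G)
    from integral_limit_from_L1[where F'="\<lambda>_. 0", OF this _ iD _ lD]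
    show "(\<lambda>k. LINT x|lebesgue. norm ((\<eta> k x *\<^sub>R indicator V x *\<^sub>R G x + (indicator V x * w x) *\<^sub>R d\<eta> k x) - indicator V x *\<^sub>R G x)) \<longlonglongrightarrow> 0"
      using nD by simp
  qed
qed

section \<open>The monotone structure of the p-Laplacian\<close>

definition p_flux :: "real \<Rightarrow> 'a::euclidean_space \<Rightarrow> 'a" where
  "p_flux p a = norm a powr (p - 2) *\<^sub>R a"

lemma p_flux_zero [simp]: "p_flux p 0 = 0" by (simp add: p_flux_def)

lemma norm_p_flux: "p > 2 \<Longrightarrow> norm (p_flux p a) = norm a powr (p - 1)"
proof (cases "a = 0")
  case False
  then have "norm a powr (p - 2) * norm a = norm a powr (p - 2) * norm a powr 1" by simp
  also have "\<dots> = norm a powr (p - 1)" by (simp only: powr_add[symmetric]) simp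
  finally show ?thesis by (simp add: p_flux_def)
qed simp

lemma norm_p_flux_le_1: "p > 2 \<Longrightarrow> norm a \<le> 1 \<Longrightarrow> norm (p_flux p a) \<le> 1"
  by (simp add: norm_p_flux powr_le1)

lemma p_flux_measurable [measurable]:
  "f \<in> borel_measurable M \<Longrightarrow> (\<lambda>x. p_flux p (f x)) \<in> borel_measurable M"
  unfolding p_flux_def by measurable

lemma p_flux_inner_self:
  assumes "p > 2" shows "p_flux p a \<bullet> a = norm a powr p"
proof (cases "a = 0")
  case False
  then have "p_flux p a \<bullet> a = norm a powr (p - 2) * norm a powr 2"
    by (simp add: p_flux_def power2_norm_eq_inner)
  also have "\<dots> = norm a powr p" by (simp only: powr_add[symmetric]) simp
  finally show ?thesis .
qed (use assms in simp)

text \<open>Tangents lie below the convex function \<open>\<lambda>a. norm a powr p / p\<close>.\<close>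

lemma p_flux_tangent:
  assumes p: "p > 2"
  shows "p_flux p a \<bullet> (b - a) \<le> norm b powr p / p - norm a powr p / p"
proof -
  define q where "q = p / (p - 1)"
  have q: "q > 1" "1 / q = (p - 1) / p" "(p - 1) * q = p" using p by (auto simp: q_def field_simps)
  have "p_flux p a \<bullet> b \<le> norm (p_flux p a) * norm b"
    using Cauchy_Schwarz_ineq2[of "p_flux p a" b] by linarith
  also have "\<dots> = norm a powr (p - 1) * norm b" using p by (simp add: norm_p_flux)
  also have "\<dots> \<le> (norm a powr (p - 1)) powr q / q + norm b powr p / p"
    by (rule Youngs_inequality) (use p q in \<open>auto simp: field_simps\<close>)
  also have "(norm a powr (p - 1)) powr q / q = norm a powr p - norm a powr p / p"
  proof -
    have "norm a powr p / q = norm a powr p * (1 / q)" by simp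
    then show ?thesis unfolding powr_powr q(3) q(2) using p by (simp add: field_simps)
  qed
  finally show ?thesis using p_flux_inner_self[OF p, of a] by (simp add: inner_diff_right)
qed

text \<open>The product splits into \<open>(A + B) / 2 * |a - b|\<^sup>2\<close> and \<open>(A - B) / 2 * (|a|\<^sup>2 - |b|\<^sup>2)\<close>, where \<open>A\<close> and
  \<open>B\<close> are the powers of \<open>|a|\<close> and \<open>|b|\<close> with exponent \<open>p - 2\<close>. Both terms are nonnegative, and the first
  vanishes only for \<open>a = b\<close>.\<close>

lemma p_flux_monotone:
  fixes a b :: "'a::euclidean_space"
  assumes p: "p > 2"
  shows "0 \<le> (p_flux p a - p_flux p b) \<bullet> (a - b)"
    "(p_flux p a - p_flux p b) \<bullet> (a - b) = 0 \<Longrightarrow> a = b"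
proof -
  define A B where "A = norm a powr (p - 2)" and "B = norm b powr (p - 2)"
  have AB: "0 \<le> A" "0 \<le> B" by (auto simp: A_def B_def)
  have id: "(p_flux p a - p_flux p b) \<bullet> (a - b)
     = (A + B) / 2 * (norm (a - b))\<^sup>2 + (A - B) / 2 * ((norm a)\<^sup>2 - (norm b)\<^sup>2)"
    unfolding p_flux_def A_def[symmetric] B_def[symmetric] power2_norm_eq_inner
    by (simp add: inner_diff_left inner_diff_right inner_commute field_simps)
  have s: "0 \<le> (A - B) / 2 * ((norm a)\<^sup>2 - (norm b)\<^sup>2)"
  proof (cases "norm a \<le> norm b")
    case True
    then have "A \<le> B" unfolding A_def B_def using p by (intro powr_mono2) auto
    moreover have "(norm a)\<^sup>2 \<le> (norm b)\<^sup>2" using True by (intro power_mono) auto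
    ultimately show ?thesis by (intro mult_nonpos_nonpos) auto
  next
    case False
    then have "B \<le> A" unfolding A_def B_def using p by (intro powr_mono2) auto
    moreover have "(norm b)\<^sup>2 \<le> (norm a)\<^sup>2" using False by (intro power_mono) auto
    ultimately show ?thesis by (intro mult_nonneg_nonneg) auto
  qed
  have t: "0 \<le> (A + B) / 2 * (norm (a - b))\<^sup>2" using AB by simp
  show "0 \<le> (p_flux p a - p_flux p b) \<bullet> (a - b)" unfolding id using s t by linarith
  assume "(p_flux p a - p_flux p b) \<bullet> (a - b) = 0"
  then have "(A + B) / 2 * (norm (a - b))\<^sup>2 = 0" unfolding id using s t by linarith
  then have "A + B = 0 \<or> a = b" by simp
  then show "a = b"
  proof
    assume "A + B = 0"
    then have "A = 0" "B = 0" using AB by linarith+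
    then show "a = b" by (simp add: A_def B_def)
  qed
qed

section \<open>A calibration criterion for existence and uniqueness\<close>

text \<open>Functions that vanish on an open set have zero weak gradient there, by uniqueness of weak gradients.
  The part of \<open>U\<close> that is neither in \<open>V\<close> nor in \<open>Z\<close> is a null set.\<close>

lemma zero_off_subdomain:
  fixes U V Z :: "'a::euclidean_space set"
  assumes "open U" "open Z" "Z \<subseteq> U" "negligible (U - V - Z)"
    and wg: "weak_gradient U w g" and w0: "\<And>x. x \<in> Z \<Longrightarrow> w x = 0"
  shows "AE x in lebesgue. x \<notin> V \<longrightarrow> indicator U x *\<^sub>R g x = 0"
proof -
  have "AE x\<in>Z in lebesgue. g x = 0"
    by (rule weak_gradient_unique[OF assms(2) weak_gradient_mono[OF wg assms(3)] weak_gradient_zero w0])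
  moreover have "AE x in lebesgue. x \<notin> U - V - Z"
    using assms(4) unfolding negligible_iff_null_sets by (rule AE_not_in)
  ultimately show ?thesis by eventually_elim (auto simp: indicator_def)
qed

text \<open>A member \<open>u\<close> of the class \<open>A\<close> is calibrated by a bounded field \<open>X\<close> that is its \<open>p\<close>-flux on \<open>V\<close> and
  has divergence \<open>- F\<close> on all of \<open>U\<close>, where \<open>F\<close> agrees with \<open>f\<close> on \<open>V\<close>. On the rest of \<open>U\<close>, where the
  class vanishes, the values of \<open>X\<close> do not enter. A competitor is known to be a limit of test functions
  on \<open>U\<close>, not on \<open>V\<close>; the extension of the flux from \<open>V\<close> to \<open>U\<close> is what allows to test with it.\<close>

locale calibration =
  fixes p :: real and U V Z :: "'a::euclidean_space set" and A :: "('a \<Rightarrow> real) set"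
    and u :: "'a \<Rightarrow> real" and g X :: "'a \<Rightarrow> 'a" and f F :: "'a \<Rightarrow> real" and M N C :: real
    and \<eta> :: "nat \<Rightarrow> 'a \<Rightarrow> real" and d\<eta> :: "nat \<Rightarrow> 'a \<Rightarrow> 'a"
  assumes p: "p > 2" and U: "open U" "bounded U" and V: "open V" "V \<subseteq> U"
    and Z: "open Z" "Z \<subseteq> U" "Z \<inter> V = {}" "negligible (U - V - Z)"
    and A_W011: "\<And>w. w \<in> A \<Longrightarrow> w \<in> W011 U"
    and A_cont: "\<And>w. w \<in> A \<Longrightarrow> continuous_on (closure U) w"
    and A_slope: "\<And>w. w \<in> A \<Longrightarrow> AE x\<in>U in lebesgue. norm (wgrad U w x) \<le> 1"
    and A_zero: "\<And>w x. w \<in> A \<Longrightarrow> x \<in> U - V \<Longrightarrow> w x = 0"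
    and cut: "cutoffs V \<eta> d\<eta> C"
    and u: "u \<in> A" "weak_gradient U u g" "\<And>x. x \<in> frontier V \<Longrightarrow> u x = 0" "\<And>x. x \<in> V \<Longrightarrow> norm (g x) \<le> 1"
    and X: "X \<in> borel_measurable lebesgue" "\<And>x. norm (X x) \<le> M"
    and F: "F \<in> borel_measurable lebesgue" "\<And>x. \<bar>F x\<bar> \<le> N"
    and divergence: "\<And>\<psi> d\<psi>. test_function U \<psi> d\<psi> \<Longrightarrow> (LINT x|lebesgue. X x \<bullet> d\<psi> x) = (LINT x|lebesgue. F x * \<psi> x)"
    and X_V: "\<And>x. x \<in> V \<Longrightarrow> X x = p_flux p (g x)" and F_V: "\<And>x. x \<in> V \<Longrightarrow> F x = f x"
    and f: "(\<lambda>x. indicator U x * f x) \<in> borel_measurable lebesgue" "\<And>x. x \<in> U \<Longrightarrow> \<bar>f x\<bar> \<le> N"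
begin

definition ext :: "('a \<Rightarrow> real) \<Rightarrow> 'a \<Rightarrow> real" where "ext w x = indicator U x * w x"
definition grad :: "('a \<Rightarrow> real) \<Rightarrow> 'a \<Rightarrow> 'a" where "grad w x = indicator U x *\<^sub>R wgrad U w x"

lemma ext_f: "ext f \<in> borel_measurable lebesgue" "\<bar>ext f x\<bar> \<le> N"
proof -
  show "ext f \<in> borel_measurable lebesgue" using f(1) by (simp add: ext_def[abs_def])
  have "0 \<le> N" using F(2)[of undefined] by linarith
  then show "\<bar>ext f x\<bar> \<le> N" using f(2) by (auto simp: ext_def indicator_def)
qed

lemma member:
  assumes "w \<in> A"
  shows "zero_trace U (ext w) (grad w)" "integrable lebesgue (ext w)" "integrable lebesgue (grad w)"
    "grad w \<in> borel_measurable lebesgue"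
    "AE x in lebesgue. norm (grad w x) \<le> 1" "AE x in lebesgue. norm (p_flux p (grad w x)) \<le> 1"
    "AE x in lebesgue. x \<notin> V \<longrightarrow> grad w x = 0" "\<And>x. x \<notin> V \<Longrightarrow> ext w x = 0"
    "weak_gradient U w (wgrad U w)"
proof -
  show z: "zero_trace U (ext w) (grad w)"
    using W011_zero_trace(1)[OF A_W011[OF assms] U(1)] by (simp add: ext_def[abs_def] grad_def[abs_def])
  then show i: "integrable lebesgue (ext w)" "integrable lebesgue (grad w)" unfolding zero_trace_def by blast+
  show "grad w \<in> borel_measurable lebesgue" by (rule borel_measurable_integrable[OF i(2)])
  show s: "AE x in lebesgue. norm (grad w x) \<le> 1"
    using A_slope[OF assms] by eventually_elim (auto simp: grad_def indicator_def)
  then show "AE x in lebesgue. norm (p_flux p (grad w x)) \<le> 1"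
    by eventually_elim (rule norm_p_flux_le_1[OF p])
  show wg: "weak_gradient U w (wgrad U w)" by (rule W011_zero_trace(2)[OF A_W011[OF assms] U(1)])
  show "AE x in lebesgue. x \<notin> V \<longrightarrow> grad w x = 0"
    unfolding grad_def using A_zero[OF assms] Z by (intro zero_off_subdomain[OF U(1) Z(1,2,4) wg]) blast
  show "\<And>x. x \<notin> V \<Longrightarrow> ext w x = 0" using A_zero[OF assms] by (auto simp: ext_def indicator_def)
qed

lemma grad_u: "AE x in lebesgue. x \<in> V \<longrightarrow> grad u x = g x"
  using weak_gradient_unique[OF U(1) member(9)[OF u(1)] u(2)]
  by (rule AE_mp) (use V in \<open>auto intro!: AE_I2 simp: grad_def\<close>)

lemma flux_integrable:
  assumes "v \<in> A" "w \<in> A"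
  shows "integrable lebesgue (\<lambda>x. p_flux p (grad v x) \<bullet> grad w x)"
  using member[OF assms(1)] member[OF assms(2)]
  by (intro integrable_bounded_inner) (auto intro: p_flux_measurable)

lemma source_integrable:
  assumes "w \<in> A" shows "integrable lebesgue (\<lambda>x. ext f x * ext w x)"
  using integrable_bounded_mult[OF ext_f(1) AE_I2[OF ext_f(2)] member(2)[OF assms]] by simp

text \<open>The gradient of \<open>w\<close> sees only \<open>V\<close>, where \<open>X\<close> is the flux of \<open>u\<close>.\<close>

lemma u_tested:
  assumes w: "w \<in> A"
  shows "(LINT x|lebesgue. p_flux p (grad u x) \<bullet> grad w x) = (LINT x|lebesgue. ext f x * ext w x)"
proof -
  have "(LINT x|lebesgue. p_flux p (grad u x) \<bullet> grad w x) = (LINT x|lebesgue. X x \<bullet> grad w x)"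
  proof (rule integral_cong_AE)
    show "AE x in lebesgue. p_flux p (grad u x) \<bullet> grad w x = X x \<bullet> grad w x"
      using grad_u member(7)[OF w]
    proof eventually_elim
      case (elim x) then show ?case by (cases "x \<in> V") (simp_all add: X_V)
    qed
  qed (use member(4)[OF w] member(4)[OF u(1)] X(1) in \<open>auto intro: p_flux_measurable\<close>)
  also have "\<dots> = (LINT x|lebesgue. F x * ext w x)"
    by (rule zero_trace_field[OF member(1)[OF w] X(1) AE_I2[OF X(2)] F(1) AE_I2[OF F(2)] divergence])
  also have "\<dots> = (LINT x|lebesgue. ext f x * ext w x)"
  proof (intro Bochner_Integration.integral_cong refl)
    fix x show "F x * ext w x = ext f x * ext w x"
      using member(8)[OF w, of x] F_V V(2) by (cases "x \<in> V") (auto simp: ext_def indicator_def)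
  qed
  finally show ?thesis .
qed

lemma energy_eq:
  "energy p U f w = (LINT x|lebesgue. norm (grad w x) powr p / p - ext f x * ext w x)"
  unfolding energy_def set_lebesgue_integral_def
  by (intro Bochner_Integration.integral_cong) (use p in \<open>auto simp: ext_def grad_def indicator_def\<close>)

lemma p_power_integrable:
  assumes w: "w \<in> A" shows "integrable lebesgue (\<lambda>x. norm (grad w x) powr p / p)"
proof (rule Bochner_Integration.integrable_bound[OF integrable_norm[OF member(3)[OF w]]])
  show "AE x in lebesgue. norm (norm (grad w x) powr p / p) \<le> norm (norm (grad w x))"
    using member(5)[OF w]
  proof eventually_elim
    case (elim x)
    show ?case
    proof (cases "grad w x = 0")
      case False
      have "norm (grad w x) powr p \<le> norm (grad w x) powr 1"
        using p elim False by (intro powr_mono') auto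
      then have "norm (grad w x) powr p / p \<le> norm (grad w x) / 1"
        using p by (intro frac_le) auto
      then show ?thesis using p by simp
    qed (use p in simp)
  qed
qed (use member(4)[OF w] in measurable)

theorem minimal:
  assumes w: "w \<in> A" shows "energy p U f u \<le> energy p U f w"
proof -
  note i = p_power_integrable[OF u(1)] p_power_integrable[OF w] source_integrable[OF u(1)] source_integrable[OF w]
    flux_integrable[OF u(1) u(1)] flux_integrable[OF u(1) w]
  have "(LINT x|lebesgue. p_flux p (grad u x) \<bullet> grad w x - p_flux p (grad u x) \<bullet> grad u x)
      \<le> (LINT x|lebesgue. norm (grad w x) powr p / p - norm (grad u x) powr p / p)"
    using i p_flux_tangent[OF p]
    by (intro Bochner_Integration.integral_mono) (auto simp: inner_diff_right)
  then show ?thesis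
    unfolding energy_eq using i u_tested[OF u(1)] u_tested[OF w] by simp
qed

lemma restricted_zero_trace:
  assumes w: "w \<in> A" and w0: "\<And>x. x \<in> frontier V \<Longrightarrow> w x = 0"
  shows "zero_trace V (\<lambda>x. indicator V x * w x) (\<lambda>x. indicator V x *\<^sub>R wgrad U w x)"
proof (rule zero_trace_from_cutoffs[OF V(1) _ cut _ w0])
  show "bounded V" using U(2) V(2) bounded_subset by blast
  show "continuous_on (closure V) w"
    using A_cont[OF w] closure_mono[OF V(2)] continuous_on_subset by blast
  have eq: "indicator V x *\<^sub>R wgrad U w x = indicator V x *\<^sub>R grad w x" for x
    using V(2) by (auto simp: grad_def indicator_def)
  show "integrable lebesgue (\<lambda>x. indicator V x *\<^sub>R wgrad U w x)"
    unfolding eq using member(3)[OF w] V(1) by (intro integrable_mult_indicator) auto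
  have T: "test_function V (\<eta> k) (d\<eta> k)" for k using cut unfolding cutoffs_def by blast
  show "zero_trace V (\<lambda>x. \<eta> k x * (indicator V x * w x))
          (\<lambda>x. \<eta> k x *\<^sub>R indicator V x *\<^sub>R wgrad U w x + (indicator V x * w x) *\<^sub>R d\<eta> k x)" for k
  proof -
    have "(\<lambda>x. \<eta> k x * (indicator V x * w x)) = (\<lambda>x. \<eta> k x * ext w x)"
      "(\<lambda>x. \<eta> k x *\<^sub>R indicator V x *\<^sub>R wgrad U w x + (indicator V x * w x) *\<^sub>R d\<eta> k x)
       = (\<lambda>x. \<eta> k x *\<^sub>R grad w x + ext w x *\<^sub>R d\<eta> k x)"
      using test_function_vanishes[OF T[of k]] V(2) by (auto simp: fun_eq_iff ext_def grad_def indicator_def)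
    then show ?thesis using test_cutoff_zero_trace[OF member(1)[OF w] T[of k] V(1)] by simp
  qed
qed

text \<open>A weak solution is tested only by test functions on \<open>V\<close>. Members of the class that vanish on the
  frontier of \<open>V\<close> are limits of these.\<close>

lemma solution_tested:
  assumes v: "v \<in> A" and EL: "p_laplace_solution p V f v"
    and w: "w \<in> A" "\<And>x. x \<in> frontier V \<Longrightarrow> w x = 0"
  shows "(LINT x|lebesgue. p_flux p (grad v x) \<bullet> grad w x) = (LINT x|lebesgue. ext f x * ext w x)"
proof -
  obtain h where h: "weak_gradient V v h" and
    eq: "\<And>\<psi> d\<psi>. test_function V \<psi> d\<psi> \<Longrightarrow> (LINT x:V|lebesgue. p_flux p (h x) \<bullet> d\<psi> x) = (LINT x:V|lebesgue. f x * \<psi> x)"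
    using EL unfolding p_laplace_solution_def p_flux_def by blast
  have hv: "AE x\<in>V in lebesgue. h x = wgrad U v x"
    by (rule weak_gradient_unique[OF V(1) h weak_gradient_mono[OF member(9)[OF v] V(2)] refl])
  have hm: "(\<lambda>x. indicator V x *\<^sub>R h x) \<in> borel_measurable lebesgue"
    using h unfolding weak_gradient_iff by (intro locally_integrable_imp_measurable V(1)) blast
  have "(LINT x|lebesgue. p_flux p (grad v x) \<bullet> (indicator V x *\<^sub>R wgrad U w x)) = (LINT x|lebesgue. ext f x * (indicator V x * w x))"
  proof (rule zero_trace_field[OF restricted_zero_trace[OF w] _ member(6)[OF v] ext_f(1) AE_I2[OF ext_f(2)]])
    show "(\<lambda>x. p_flux p (grad v x)) \<in> borel_measurable lebesgue" using member(4)[OF v] by (rule p_flux_measurable)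
    fix \<psi> d\<psi> assume T: "test_function V \<psi> d\<psi>"
    note T0 = test_function_vanishes[OF T]
    have "(LINT x|lebesgue. p_flux p (grad v x) \<bullet> d\<psi> x) = (LINT x|lebesgue. p_flux p (indicator V x *\<^sub>R h x) \<bullet> d\<psi> x)"
    proof (rule integral_cong_AE)
      show "AE x in lebesgue. p_flux p (grad v x) \<bullet> d\<psi> x = p_flux p (indicator V x *\<^sub>R h x) \<bullet> d\<psi> x"
        using hv
      proof eventually_elim
        case (elim x) then show ?case using T0 V(2) by (cases "x \<in> V") (auto simp: grad_def indicator_def)
      qed
    qed (use member(4)[OF v] hm test_function_integrable_lebesgue(4)[OF T] in \<open>auto intro: p_flux_measurable\<close>)
    also have "\<dots> = (LINT x:V|lebesgue. p_flux p (h x) \<bullet> d\<psi> x)"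
      unfolding set_lebesgue_integral_def
      by (intro Bochner_Integration.integral_cong) (use T0 in \<open>auto simp: indicator_def\<close>)
    also have "\<dots> = (LINT x:V|lebesgue. f x * \<psi> x)" by (rule eq[OF T])
    also have "\<dots> = (LINT x|lebesgue. ext f x * \<psi> x)"
      unfolding set_lebesgue_integral_def
      by (intro Bochner_Integration.integral_cong) (use T0 V(2) in \<open>auto simp: indicator_def ext_def\<close>)
    finally show "(LINT x|lebesgue. p_flux p (grad v x) \<bullet> d\<psi> x) = (LINT x|lebesgue. ext f x * \<psi> x)" .
  qed
  moreover have "(LINT x|lebesgue. p_flux p (grad v x) \<bullet> (indicator V x *\<^sub>R wgrad U w x)) = (LINT x|lebesgue. p_flux p (grad v x) \<bullet> grad w x)"
  proof (rule integral_cong_AE)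
    show "AE x in lebesgue. p_flux p (grad v x) \<bullet> (indicator V x *\<^sub>R wgrad U w x) = p_flux p (grad v x) \<bullet> grad w x"
      using member(7)[OF w(1)] by eventually_elim (use V(2) in \<open>auto simp: grad_def indicator_def\<close>)
    have "(\<lambda>x. indicator V x *\<^sub>R wgrad U w x) = (\<lambda>x. indicator V x *\<^sub>R grad w x)"
      using V(2) by (auto simp: grad_def indicator_def fun_eq_iff)
    then have "(\<lambda>x. indicator V x *\<^sub>R wgrad U w x) \<in> borel_measurable lebesgue"
      using member(4)[OF w(1)] V(1) by (simp only:) (intro borel_measurable_scaleR borel_measurable_indicator, auto)
    then show "(\<lambda>x. p_flux p (grad v x) \<bullet> (indicator V x *\<^sub>R wgrad U w x)) \<in> borel_measurable lebesgue"
      using p_flux_measurable[OF member(4)[OF v]] by (intro borel_measurable_inner)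
  qed (use member(4)[OF v] member(4)[OF w(1)] in \<open>auto intro: p_flux_measurable\<close>)
  moreover have "(LINT x|lebesgue. ext f x * (indicator V x * w x)) = (LINT x|lebesgue. ext f x * ext w x)"
  proof (intro Bochner_Integration.integral_cong refl)
    fix x show "ext f x * (indicator V x * w x) = ext f x * ext w x"
      using member(8)[OF w(1), of x] V(2) by (cases "x \<in> V") (auto simp: ext_def indicator_def)
  qed
  ultimately show ?thesis by simp
qed

text \<open>If the gradients agree, then \<open>v - u\<close> is orthogonal to the divergence of every bounded field. It is
  itself such a divergence, namely of a ray field, and so orthogonal to itself.\<close>

lemma equal_if_gradients_equal:
  assumes v: "v \<in> A" and G: "AE x in lebesgue. grad v x = grad u x" and x: "x \<in> closure U"
  shows "v x = u x"
proof -
  have cv: "continuous_on U v" "continuous_on U u"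
    using continuous_on_subset[OF A_cont[OF v] closure_subset] continuous_on_subset[OF A_cont[OF u(1)] closure_subset]
    by blast+
  define D where "D = (\<lambda>x. indicator U x *\<^sub>R (v x - u x))"
  have Dm: "D \<in> borel_measurable borel"
    unfolding D_def using U(1) cv by (intro borel_measurable_continuous_on_indicator continuous_intros) auto
  have "compact (closure U)" using U(2) by simp
  then have "bounded ((\<lambda>x. v x - u x) ` closure U)"
    using A_cont[OF v] A_cont[OF u(1)] by (intro compact_imp_bounded compact_continuous_image continuous_intros)
  then obtain B where B: "\<And>x. x \<in> closure U \<Longrightarrow> \<bar>v x - u x\<bar> \<le> B" unfolding bounded_iff by auto
  have DB: "\<bar>D x\<bar> \<le> \<bar>B\<bar>" for x
    using B[of x] closure_subset[of U] by (cases "x \<in> U") (auto simp: D_def)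
  obtain R where R: "U \<subseteq> ball 0 R" "0 < R" using bounded_subset_ballD[OF U(2), of 0] by blast
  (* the ray field is unbounded on the whole space; test functions on U see only its restriction to U *)
  define Y where "Y = (\<lambda>x. indicator U x *\<^sub>R ray_field 0 D x)"
  have Ym: "Y \<in> borel_measurable borel" unfolding Y_def using U(1)
    by (intro borel_measurable_scaleR borel_measurable_indicator ray_field_measurable Dm) auto
  have YB: "norm (Y x) \<le> \<bar>B\<bar> * R" for x
  proof (cases "x \<in> U")
    case True
    then have "norm (ray_field 0 D x) \<le> \<bar>B\<bar> * dist 0 x" by (intro ray_field_bound Dm DB)
    also have "\<dots> \<le> \<bar>B\<bar> * R" using R True by (intro mult_left_mono) auto
    finally show ?thesis using True by (simp add: Y_def)
  qed (use R in \<open>simp add: Y_def\<close>)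
  have test: "(LINT x|lebesgue. Y x \<bullet> d\<psi> x) = (LINT x|lebesgue. D x * \<psi> x)" if T: "test_function U \<psi> d\<psi>" for \<psi> d\<psi>
  proof -
    note [measurable] = test_function_continuous(3,4)[OF T] Dm Ym
    have "(LINT x|lebesgue. Y x \<bullet> d\<psi> x) = (LINT x|lebesgue. ray_field 0 D x \<bullet> d\<psi> x)"
      by (intro Bochner_Integration.integral_cong refl)
        (use test_function_vanishes[OF T] in \<open>auto simp: Y_def indicator_def\<close>)
    also have "\<dots> = (LINT x|lborel. ray_field 0 D x \<bullet> d\<psi> x)" by (rule integral_completion) measurable
    also have "\<dots> = (LINT x|lborel. D x * \<psi> x)" by (rule ray_field_divergence[OF T Dm DB])
    also have "\<dots> = (LINT x|lebesgue. D x * \<psi> x)" by (rule integral_completion[symmetric]) measurable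
    finally show ?thesis .
  qed
  have t: "(LINT x|lebesgue. Y x \<bullet> grad w x) = (LINT x|lebesgue. D x * ext w x)" if "w \<in> A" for w
    by (rule zero_trace_field[OF member(1)[OF that] lebesgue_measurable_borel[OF Ym] AE_I2[OF YB]
          lebesgue_measurable_borel[OF Dm] AE_I2[OF DB] test])
  have "(LINT x|lebesgue. Y x \<bullet> grad v x) = (LINT x|lebesgue. Y x \<bullet> grad u x)"
  proof (rule integral_cong_AE)
    show "AE x in lebesgue. Y x \<bullet> grad v x = Y x \<bullet> grad u x" using G by eventually_elim simp
  qed (use lebesgue_measurable_borel[OF Ym] member(4)[OF v] member(4)[OF u(1)] in auto)
  then have "(LINT x|lebesgue. D x * ext v x) - (LINT x|lebesgue. D x * ext u x) = 0"
    using t[OF v] t[OF u(1)] by simp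
  moreover have i: "integrable lebesgue (\<lambda>x. D x * ext w x)" if "w \<in> A" for w
    using integrable_bounded_mult[OF lebesgue_measurable_borel[OF Dm] AE_I2[OF DB] member(2)[OF that]] by simp
  moreover have sq: "D x * ext v x - D x * ext u x = (D x)\<^sup>2" for x
    by (auto simp: D_def ext_def indicator_def power2_eq_square algebra_simps)
  ultimately have z: "(LINT x|lebesgue. (D x)\<^sup>2) = 0"
    using v u(1) by (simp add: Bochner_Integration.integral_diff[symmetric] del: Bochner_Integration.integral_diff)
  have "integrable lebesgue (\<lambda>x. (D x)\<^sup>2)"
    using Bochner_Integration.integrable_diff[OF i[OF v] i[OF u(1)]] unfolding sq .
  then have "AE x in lebesgue. (D x)\<^sup>2 = 0" using z by (subst (asm) integral_nonneg_eq_0_iff_AE) auto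
  then have ae: "AE x in lebesgue. x \<notin> {x \<in> U. v x - u x \<in> - {0}}"
    by eventually_elim (auto simp: D_def)
  have "open (U \<inter> (\<lambda>x. v x - u x) -` (- {0}))"
    by (intro continuous_open_preimage continuous_intros cv U(1))
  moreover have "U \<inter> (\<lambda>x. v x - u x) -` (- {0}) = {x \<in> U. v x - u x \<in> - {0}}" by auto
  ultimately have op: "open {x \<in> U. v x - u x \<in> - {0}}" by simp
  then have "{x \<in> U. v x - u x \<in> - {0}} \<in> null_sets lebesgue"
    using ae by (subst AE_iff_null_sets) auto
  then have "negligible {x \<in> U. v x - u x \<in> - {0}}"
    by (simp add: negligible_iff_null_sets)
  with op have "{x \<in> U. v x - u x \<in> - {0}} = {}" using open_not_negligible by blast
  then have "v y - u y = 0" if "y \<in> U" for y using that by blast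
  from continuous_constant_on_closure[of U "\<lambda>x. v x - u x", OF _ this x]
  have "v x - u x = 0" using A_cont[OF v] A_cont[OF u(1)] by (auto intro: continuous_intros)
  then show ?thesis by simp
qed

text \<open>Test the equations of \<open>v\<close> and \<open>u\<close> with both \<open>v\<close> and \<open>u\<close>: the integral of the monotonicity product
  vanishes.\<close>

theorem unique:
  assumes v: "v \<in> A" and EL: "euler_lagrange_dirichlet p V f v" and x: "x \<in> closure U"
  shows "v x = u x"
proof (rule equal_if_gradients_equal[OF v _ x])
  have EL': "p_laplace_solution p V f v" "\<And>x. x \<in> frontier V \<Longrightarrow> v x = 0"
    using EL unfolding euler_lagrange_dirichlet_def by blast+
  note tv = solution_tested[OF v EL'(1) v EL'(2)] solution_tested[OF v EL'(1) u(1,3)]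
  note tu = u_tested[OF v] u_tested[OF u(1)]
  note i = flux_integrable[OF v v] flux_integrable[OF v u(1)] flux_integrable[OF u(1) v] flux_integrable[OF u(1) u(1)]
  let ?I = "\<lambda>x. (p_flux p (grad v x) - p_flux p (grad u x)) \<bullet> (grad v x - grad u x)"
  have eq: "?I x = (p_flux p (grad v x) \<bullet> grad v x - p_flux p (grad v x) \<bullet> grad u x)
     - (p_flux p (grad u x) \<bullet> grad v x - p_flux p (grad u x) \<bullet> grad u x)" for x
    by (simp add: inner_diff_left inner_diff_right)
  have "integrable lebesgue ?I" unfolding eq using i by (intro Bochner_Integration.integrable_diff)
  moreover have "(LINT x|lebesgue. ?I x) = 0" unfolding eq using i tv tu by simp
  ultimately have "AE x in lebesgue. ?I x = 0"
    using p_flux_monotone(1)[OF p] by (subst (asm) integral_nonneg_eq_0_iff_AE) auto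
  then show "AE x in lebesgue. grad v x = grad u x"
    by eventually_elim (rule p_flux_monotone(2)[OF p])
qed

theorem solution: "euler_lagrange_dirichlet p V f u"
  unfolding euler_lagrange_dirichlet_def p_laplace_solution_def
proof (intro conjI exI[of _ g] allI impI ballI)
  show wg: "weak_gradient V u g" by (rule weak_gradient_mono[OF u(2) V(2)])
  have gm: "(\<lambda>x. indicator V x *\<^sub>R g x) \<in> borel_measurable lebesgue"
    using wg unfolding weak_gradient_iff by (intro locally_integrable_imp_measurable V(1)) blast
  have eq: "indicator V x *\<^sub>R norm (g x) powr (p - 1) = norm (indicator V x *\<^sub>R g x) powr (p - 1)" for x
    using p by (auto simp: indicator_def)
  have bV: "bounded V" using U(2) V(2) bounded_subset by blast
  have "set_integrable lebesgue V (\<lambda>x. norm (g x) powr (p - 1))"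
  proof (rule set_integrable_bounded_lebesgue[OF _ bV V(1), where B=1])
    show "(\<lambda>x. indicator V x *\<^sub>R norm (g x) powr (p - 1)) \<in> borel_measurable lebesgue"
      unfolding eq using measurable_compose[OF gm borel_measurable_norm] by measurable
    show "AE x\<in>V in lebesgue. norm (norm (g x) powr (p - 1)) \<le> 1"
      using u(4) p by (auto intro!: AE_I2 powr_le1)
  qed
  then show "locally_integrable V (\<lambda>x. norm (g x) powr (p - 1))"
    unfolding locally_integrable_def by (meson set_integrable_subset lmeasurable_compact fmeasurableD)
  fix \<psi> d\<psi> assume T: "test_function V \<psi> d\<psi>"
  note T0 = test_function_vanishes[OF T]
  have "(LINT x:V|lebesgue. (norm (g x) powr (p - 2) *\<^sub>R g x) \<bullet> d\<psi> x) = (LINT x|lebesgue. X x \<bullet> d\<psi> x)"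
    unfolding set_lebesgue_integral_def
    by (intro Bochner_Integration.integral_cong refl) (use T0 in \<open>auto simp: indicator_def X_V p_flux_def\<close>)
  also have "\<dots> = (LINT x|lebesgue. F x * \<psi> x)" by (rule divergence[OF test_function_mono[OF T V(2)]])
  also have "\<dots> = (LINT x:V|lebesgue. f x * \<psi> x)"
    unfolding set_lebesgue_integral_def
    by (intro Bochner_Integration.integral_cong refl) (use T0 in \<open>auto simp: indicator_def F_V\<close>)
  finally show "(LINT x:V|lebesgue. (norm (g x) powr (p - 2) *\<^sub>R g x) \<bullet> d\<psi> x) = (LINT x:V|lebesgue. f x * \<psi> x)" .
qed (rule u(3))

end

section \<open>Radial potentials\<close>

lemma continuous_slope:
  assumes "p > 2" shows "continuous_on UNIV (slope p)"
proof -
  have "slope p = (\<lambda>t. max 0 t powr (1 / (p - 1)) - max 0 (- t) powr (1 / (p - 1)))"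
    by (auto simp: slope_def fun_eq_iff sgn_if max_def)
  moreover have "continuous_on UNIV \<dots>"
    using assms by (intro continuous_intros continuous_on_powr') auto
  ultimately show ?thesis by simp
qed

lemma slope_minus: "slope p (- t) = - slope p t" by (simp add: slope_def sgn_minus)

lemma slope_zero [simp]: "slope p 0 = 0" by (simp add: slope_def)

lemma slope_bound: "p > 2 \<Longrightarrow> \<bar>t\<bar> \<le> 1 \<Longrightarrow> \<bar>slope p t\<bar> \<le> 1"
  by (auto simp: slope_def abs_mult sgn_if intro: powr_le1)

lemma slope_inverse:
  assumes "p > 2" shows "\<bar>slope p t\<bar> powr (p - 2) * slope p t = t"
proof (cases "t = 0")
  case False
  have "\<bar>slope p t\<bar> = \<bar>t\<bar> powr (1 / (p - 1))" using False by (simp add: slope_def abs_mult sgn_if)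
  then have "\<bar>slope p t\<bar> powr (p - 2) * slope p t
      = sgn t * (\<bar>t\<bar> powr ((1 / (p - 1)) * (p - 2)) * \<bar>t\<bar> powr (1 / (p - 1)))"
    by (simp add: powr_powr slope_def)
  also have "\<bar>t\<bar> powr ((1 / (p - 1)) * (p - 2)) * \<bar>t\<bar> powr (1 / (p - 1)) = \<bar>t\<bar> powr ((1 / (p - 1)) * (p - 2) + 1 / (p - 1))"
    by (simp only: powr_add)
  also have "(1 / (p - 1)) * (p - 2) + 1 / (p - 1) = 1" using assms by (simp add: field_simps)
  finally show ?thesis using False by (simp add: sgn_if)
qed simp

text \<open>The value of \<open>Ep_inv p\<close> at \<open>t\<^sup>2\<close> is the power of \<open>|t|\<close> with exponent \<open>(p - 2) / (p - 1)\<close>; dividing by it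
  leaves exponent \<open>1 / (p - 1)\<close>.\<close>

lemma quotient_Ep_inv:
  assumes p: "p > 2" and t: "t\<^sup>2 \<in> {0..1}"
  shows "t / Ep_inv p (t\<^sup>2) = slope p t"
proof (cases "t = 0")
  case False
  define e where "e = (2 * p - 2) / (p - 2)"
  define y where "y = \<bar>t\<bar> powr ((p - 2) / (p - 1))"
  have e: "e > 0" using p by (simp add: e_def)
  have t1: "\<bar>t\<bar> \<le> 1" using t by (simp add: abs_square_le_1)
  have y: "0 < y" "y \<le> 1" using p False t1 by (auto simp: y_def intro!: powr_le1)
  have inj: "inj_on (Ep p) {0..1}"
  proof (rule inj_onI)
    fix a b :: real assume ab: "a \<in> {0..1}" "b \<in> {0..1}" "Ep p a = Ep p b"
    then have "a powr e = b powr e" by (simp add: Ep_def e_def)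
    then show "a = b" using ab(1,2) e powr_less_mono2[of e a b] powr_less_mono2[of e b a]
      by (metis atLeastAtMost_iff less_irrefl linorder_neqE_linordered_idom)
  qed
  have "Ep p y = \<bar>t\<bar> powr ((p - 2) / (p - 1) * e)" by (simp add: Ep_def e_def y_def powr_powr)
  also have "(p - 2) / (p - 1) * e = 2"
  proof -
    have "b / a * (2 * a / b) = 2" if "a \<noteq> 0" "b \<noteq> 0" for a b :: real using that by simp
    from this[of "p - 1" "p - 2"] have "(p - 2) / (p - 1) * (2 * (p - 1) / (p - 2)) = 2" using p by simp
    moreover have "2 * (p - 1) = 2 * p - 2" by simp
    ultimately show ?thesis unfolding e_def by (simp only:)
  qed
  also have "\<bar>t\<bar> powr 2 = t\<^sup>2" using False by simp
  finally have "Ep_inv p (t\<^sup>2) = y"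
    unfolding Ep_inv_def using y by (intro the_inv_into_f_eq[OF inj]) auto
  moreover have "slope p t * y = sgn t * (\<bar>t\<bar> powr (1 / (p - 1)) * \<bar>t\<bar> powr ((p - 2) / (p - 1)))"
    by (simp add: slope_def y_def)
  moreover have "\<bar>t\<bar> powr (1 / (p - 1)) * \<bar>t\<bar> powr ((p - 2) / (p - 1)) = \<bar>t\<bar> powr (1 / (p - 1) + (p - 2) / (p - 1))"
    by (simp only: powr_add)
  moreover have "1 / (p - 1) + (p - 2) / (p - 1) = 1" using p by (simp add: add_divide_distrib[symmetric])
  ultimately show ?thesis using False y by (simp add: field_simps sgn_if split: if_splits)
qed simp

definition radial_mass :: "nat \<Rightarrow> (real \<Rightarrow> real) \<Rightarrow> real \<Rightarrow> real" where
  "radial_mass n k r = (LINT \<rho>:{0..r}|lborel. k \<rho> * \<rho> ^ (n - 1))"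

text \<open>The signed strength at distance \<open>r\<close> of the ray field of the radial density \<open>k\<close>. It vanishes
  for \<open>r \<le> 0\<close>, so that it is continuous on the whole line.\<close>

definition radial_flux :: "nat \<Rightarrow> (real \<Rightarrow> real) \<Rightarrow> real \<Rightarrow> real" where
  "radial_flux n k r = - radial_mass n k r / r ^ (n - 1)"

lemma bounded_interval_integrable:
  fixes k :: "real \<Rightarrow> real"
  assumes [measurable]: "k \<in> borel_measurable borel" and "\<And>r. \<bar>k r\<bar> \<le> M"
  shows "set_integrable lborel {a..b} (\<lambda>\<rho>. k \<rho> * \<rho> ^ m)"
proof -
  have "set_integrable lborel {a..b} (\<lambda>\<rho>. \<rho> ^ m)"
    by (intro borel_integrable_atLeastAtMost') (auto intro!: continuous_intros)
  then have "integrable lborel (\<lambda>\<rho>. k \<rho> *\<^sub>R (indicator {a..b} \<rho> *\<^sub>R \<rho> ^ m))"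
    unfolding set_integrable_def
    using assms by (intro integrable_bounded_mult[of k _ M]) auto
  then show ?thesis unfolding set_integrable_def by (simp add: mult.left_commute)
qed

lemma radial_mass_bound:
  assumes k: "k \<in> borel_measurable borel" "\<And>r. \<bar>k r\<bar> \<le> M" and r: "0 \<le> r"
  shows "\<bar>radial_mass n k r\<bar> \<le> M * r * r ^ (n - 1)"
proof -
  have i: "set_integrable lborel {0..r} (\<lambda>\<rho>. M * r ^ (n - 1))"
    by (intro borel_integrable_atLeastAtMost') (auto intro!: continuous_intros)
  have M0: "0 \<le> M" using k(2)[of 0] by linarith
  have "\<bar>radial_mass n k r\<bar> \<le> (LINT \<rho>:{0..r}|lborel. \<bar>k \<rho> * \<rho> ^ (n - 1)\<bar>)"
    unfolding radial_mass_def using set_integral_norm_bound[OF bounded_interval_integrable[OF k, of 0 r "n - 1"]] by simp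
  also have "\<dots> \<le> (LINT \<rho>:{0..r}|lborel. M * r ^ (n - 1))"
  proof (rule set_integral_mono[OF _ i])
    show "set_integrable lborel {0..r} (\<lambda>\<rho>. \<bar>k \<rho> * \<rho> ^ (n - 1)\<bar>)"
      by (intro set_integrable_abs bounded_interval_integrable[OF k])
    show "\<bar>k \<rho> * \<rho> ^ (n - 1)\<bar> \<le> M * r ^ (n - 1)" if "\<rho> \<in> {0..r}" for \<rho>
      unfolding abs_mult using that k(2) M0 by (intro mult_mono) (auto intro!: power_mono simp: power_abs)
  qed
  also have "\<dots> = M * r * r ^ (n - 1)" using r by (simp add: set_lebesgue_integral_def)
  finally show ?thesis .
qed

lemma radial_flux_bound:
  assumes k: "k \<in> borel_measurable borel" "\<And>r. \<bar>k r\<bar> \<le> M"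
  shows "\<bar>radial_flux n k r\<bar> \<le> M * \<bar>r\<bar>"
proof (cases "r > 0")
  case True
  have "\<bar>radial_mass n k r\<bar> \<le> M * r * r ^ (n - 1)" using True by (intro radial_mass_bound[OF k]) auto
  then show ?thesis using True by (simp add: radial_flux_def abs_mult power_abs pos_divide_le_eq)
next
  case False
  have M0: "0 \<le> M" using k(2)[of 0] by linarith
  have "radial_mass n k r = 0"
  proof (cases "r = 0")
    case True
    then show ?thesis using radial_mass_bound[OF k, of 0 n] by simp
  next
    case False
    then show ?thesis using \<open>\<not> r > 0\<close> by (simp add: radial_mass_def set_lebesgue_integral_def)
  qed
  then show ?thesis using M0 by (simp add: radial_flux_def)
qed

lemma continuous_radial_flux:
  assumes k: "k \<in> borel_measurable borel" "\<And>r. \<bar>k r\<bar> \<le> M"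
  shows "continuous_on UNIV (radial_flux n k)"
proof -
  have "isCont (radial_flux n k) r" for r
  proof (cases "r > 0")
    case True
    define h where "h = (\<lambda>\<rho>. k \<rho> * \<rho> ^ (n - 1))"
    have h: "set_integrable lborel {0..r + 1} h" unfolding h_def by (rule bounded_interval_integrable[OF k])
    have "h integrable_on {0..r + 1}" using set_borel_integral_eq_integral(1)[OF h] .
    then have "continuous_on {0..r + 1} (\<lambda>x. integral {0..x} h)" by (rule indefinite_integral_continuous_1)
    moreover have "integral {0..x} h = radial_mass n k x" for x
      unfolding radial_mass_def h_def
      by (rule set_borel_integral_eq_integral(2)[OF bounded_interval_integrable[OF k], symmetric])
    ultimately have "continuous_on {0..r + 1} (radial_mass n k)" by simp
    then have "isCont (radial_mass n k) r"
      using True by (intro continuous_on_interior[of "{0..r + 1}"]) auto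
    then show ?thesis unfolding radial_flux_def using True by (intro continuous_intros) auto
  next
    case False
    have z: "radial_flux n k r = 0" if "r \<le> 0" for r
    proof (cases "r = 0")
      case True then show ?thesis using radial_flux_bound[OF k, of n 0] by simp
    next
      case False then show ?thesis using that by (simp add: radial_flux_def radial_mass_def set_lebesgue_integral_def)
    qed
    have "((\<lambda>x. M * \<bar>max 0 x\<bar>) \<longlongrightarrow> M * \<bar>max 0 r\<bar>) (at r)" by (intro tendsto_intros)
    then have m: "((\<lambda>x. M * \<bar>max 0 x\<bar>) \<longlongrightarrow> 0) (at r)" using False by simp
    have "((\<lambda>x. radial_flux n k x) \<longlongrightarrow> 0) (at r)"
    proof (rule tendsto_rabs_zero_cancel, rule tendsto_sandwich[OF _ _ tendsto_const m])
      show "\<forall>\<^sub>F x in at r. \<bar>radial_flux n k x\<bar> \<le> M * \<bar>max 0 x\<bar>"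
      proof (intro always_eventually allI)
        fix x show "\<bar>radial_flux n k x\<bar> \<le> M * \<bar>max 0 x\<bar>"
          using radial_flux_bound[OF k, of n x] z[of x] by (cases "x \<le> 0") auto
      qed
    qed simp
    then show ?thesis using z[of r] False by (simp add: isCont_def)
  qed
  then show ?thesis using continuous_at_imp_continuous_on by blast
qed

lemma ray_field_radial:
  fixes c :: "'a::euclidean_space"
  assumes [measurable]: "k \<in> borel_measurable borel"
  shows "ray_field c (\<lambda>x. k (dist c x)) x = (radial_flux DIM('a) k (dist c x) / dist c x) *\<^sub>R (x - c)"
proof (cases "x = c")
  case False
  define r where "r = dist c x"
  have r: "r > 0" using False by (simp add: r_def)
  let ?n = "DIM('a)"
  have "radial_mass ?n k r = (\<integral>\<rho>. indicator {0..r} \<rho> * (k \<rho> * \<rho> ^ (?n - 1)) \<partial>lborel)"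
    by (simp add: radial_mass_def set_lebesgue_integral_def)
  also have "\<dots> = r * (\<integral>t. indicator {0..r} (r * t) * (k (r * t) * (r * t) ^ (?n - 1)) \<partial>lborel)"
    using lborel_integral_real_affine[of r "\<lambda>\<rho>. indicator {0..r} \<rho> * (k \<rho> * \<rho> ^ (?n - 1))" 0] r by simp
  also have "(\<integral>t. indicator {0..r} (r * t) * (k (r * t) * (r * t) ^ (?n - 1)) \<partial>lborel)
      = (\<integral>t. r ^ (?n - 1) * (indicator {0..1} t * (t ^ (?n - 1) * k (dist c (c + t *\<^sub>R (x - c))))) \<partial>lborel)"
  proof (intro Bochner_Integration.integral_cong refl)
    fix t :: real
    have "indicator {0..r} (r * t) = (indicator {0..1} t :: real)"
      using r by (auto simp: indicator_def zero_le_mult_iff mult_le_cancel_left1)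
    moreover have "dist c (c + t *\<^sub>R (x - c)) = r * t" if "t \<in> {0..1}"
      using that by (simp add: r_def dist_norm norm_minus_commute mult.commute)
    ultimately show "indicator {0..r} (r * t) * (k (r * t) * (r * t) ^ (?n - 1))
      = r ^ (?n - 1) * (indicator {0..1} t * (t ^ (?n - 1) * k (dist c (c + t *\<^sub>R (x - c)))))"
      by (auto simp: indicator_def power_mult_distrib)
  qed
  also have "\<dots> = r ^ (?n - 1) * (\<integral>t. indicator {0..1} t * (t ^ (?n - 1) * k (dist c (c + t *\<^sub>R (x - c)))) \<partial>lborel)"
    by (rule integral_mult_right_zero)
  finally have "radial_flux ?n k r / r = - (\<integral>t. indicator {0..1} t * (t ^ (?n - 1) * k (dist c (c + t *\<^sub>R (x - c)))) \<partial>lborel)"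
    using r by (simp add: radial_flux_def)
  then show ?thesis by (simp add: ray_field_def r_def)
qed (simp add: ray_field_def)

definition potential :: "(real \<Rightarrow> real) \<Rightarrow> real \<Rightarrow> real \<Rightarrow> real" where
  "potential s b r = (LBINT \<rho>=ereal b..ereal r. s \<rho>)"

lemma DERIV_potential:
  assumes "continuous_on UNIV s"
  shows "(potential s b has_real_derivative s r) (at r)"
proof -
  (* the interval [l, h] contains both end points of the integral, and r in its interior *)
  define l h where "l = min b r - 1" and "h = max b r + 1"
  have "((\<lambda>u. LBINT y=ereal b..ereal u. s y) has_vector_derivative s r) (at r within {l..h})"
    by (rule interval_integral_FTC2) (use assms in \<open>auto simp: l_def h_def intro: continuous_on_subset\<close>)
  moreover have "at r within {l..h} = at r" by (rule at_within_interior) (auto simp: l_def h_def)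
  ultimately show ?thesis
    by (simp add: potential_def[abs_def] has_real_derivative_iff_has_vector_derivative)
qed

lemma potential_base [simp]: "potential s b b = 0"
  by (simp add: potential_def)

text \<open>Differentiability at the centre is where \<open>s 0 = 0\<close> is needed.\<close>

lemma GDERIV_radial:
  fixes c x :: "'a::euclidean_space"
  assumes D: "\<And>r. (\<phi> has_real_derivative s r) (at r)" and s0: "s 0 = 0"
  shows "GDERIV (\<lambda>x. \<phi> (dist c x)) x :> s (dist c x) *\<^sub>R sgn (x - c)"
proof (cases "x = c")
  case False
  have "GDERIV (\<lambda>x. norm (x - c)) x :> sgn (x - c)"
  proof -
    have 1: "((\<lambda>y. norm y) has_derivative (\<lambda>h. h \<bullet> sgn (x - c))) (at (x - c))"
      using GDERIV_norm[of "x - c"] False unfolding gderiv_def by simp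
    have 2: "((\<lambda>x. x - c) has_derivative (\<lambda>h. h)) (at x)" by (auto intro!: derivative_eq_intros)
    show ?thesis unfolding gderiv_def using has_derivative_compose[OF 2 1] .
  qed
  then have "GDERIV (\<lambda>x. dist c x) x :> sgn (x - c)" by (simp add: dist_norm norm_minus_commute)
  from GDERIV_DERIV_compose[OF this D] show ?thesis .
next
  case True
  have "(\<phi> has_derivative (\<lambda>h. 0)) (at 0)" using D[of 0] s0
    by (simp add: has_field_derivative_def lambda_zero)
  then have b: "\<And>e. e > 0 \<Longrightarrow> \<exists>d>0. \<forall>y. norm y < d \<longrightarrow> norm (\<phi> y - \<phi> 0) \<le> e * norm y"
    unfolding has_derivative_at_alt by auto
  have "((\<lambda>x. \<phi> (dist c x)) has_derivative (\<lambda>h. 0)) (at c)"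
    unfolding has_derivative_at_alt
  proof (intro conjI allI impI)
    fix e :: real assume "0 < e"
    then obtain d where d: "d > 0" "\<And>y. norm y < d \<Longrightarrow> norm (\<phi> y - \<phi> 0) \<le> e * norm y" using b by blast
    show "\<exists>d>0. \<forall>y. norm (y - c) < d \<longrightarrow> norm (\<phi> (dist c y) - \<phi> (dist c c) - 0) \<le> e * norm (y - c)"
      using d(1) d(2)[of "dist c _"] by (intro exI[of _ d]) (auto simp: dist_norm norm_minus_commute)
  qed simp
  then show ?thesis using True by (simp add: gderiv_def)
qed

lemma continuous_radial_gradient:
  fixes c :: "'a::euclidean_space"
  assumes s: "continuous_on UNIV s" and s0: "s 0 = 0"
  shows "continuous_on UNIV (\<lambda>x. s (dist c x) *\<^sub>R sgn (x - c))"
proof -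
  have cs: "isCont (\<lambda>x. s (dist c x)) x" for x
  proof -
    have "continuous_on UNIV (\<lambda>x. s (dist c x))"
      by (rule continuous_on_compose2[OF s]) (auto intro!: continuous_intros)
    then show ?thesis by (simp add: continuous_on_eq_continuous_at)
  qed
  have "isCont (\<lambda>x. s (dist c x) *\<^sub>R sgn (x - c)) x" for x
  proof (cases "x = c")
    case False
    have "isCont (\<lambda>x. sgn (x - c)) x" using False unfolding sgn_div_norm by (intro continuous_intros) auto
    then show ?thesis using cs by (intro continuous_scaleR)
  next
    case True
    have m: "((\<lambda>x. \<bar>s (dist c x)\<bar>) \<longlongrightarrow> 0) (at c)"
      using tendsto_rabs[OF cs[of c, unfolded isCont_def]] s0 by simp
    have "((\<lambda>x. s (dist c x) *\<^sub>R sgn (x - c)) \<longlongrightarrow> 0) (at c)"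
    proof (rule tendsto_norm_zero_cancel, rule tendsto_sandwich[OF _ _ tendsto_const m])
      show "\<forall>\<^sub>F x in at c. norm (s (dist c x) *\<^sub>R sgn (x - c)) \<le> \<bar>s (dist c x)\<bar>"
        by (intro always_eventually) (auto simp: norm_sgn)
    qed simp
    then show ?thesis using True by (simp add: isCont_def s0)
  qed
  then show ?thesis by (simp add: continuous_on_eq_continuous_at)
qed

lemma p_flux_radial:
  fixes c :: "'a::euclidean_space"
  assumes p: "p > 2" and k: "k \<in> borel_measurable borel"
  shows "p_flux p (slope p (radial_flux DIM('a) k (dist c x)) *\<^sub>R sgn (x - c)) = ray_field c (\<lambda>x. k (dist c x)) x"
proof (cases "x = c")
  case False
  let ?t = "radial_flux DIM('a) k (dist c x)"
  have "p_flux p (slope p ?t *\<^sub>R sgn (x - c)) = (\<bar>slope p ?t\<bar> powr (p - 2) * slope p ?t) *\<^sub>R sgn (x - c)"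
    using False by (simp add: p_flux_def norm_sgn)
  also have "\<dots> = ?t *\<^sub>R sgn (x - c)" by (simp only: slope_inverse[OF p])
  finally show ?thesis
    unfolding ray_field_radial[OF k] by (simp add: sgn_div_norm dist_norm norm_minus_commute divide_inverse)
qed (simp add: ray_field_def)

text \<open>All that is needed of the radial solution of the equation with source \<open>k\<close>, for balls and shells
  alike: a potential of class $C^1$ on the whole space whose \<open>p\<close>-flux is a ray field. Only its
  restriction to a ball or a shell will be used.\<close>

locale radial_source =
  fixes p N b :: real and c :: "'a::euclidean_space" and k :: "real \<Rightarrow> real"
  assumes p: "p > 2" and k: "k \<in> borel_measurable borel" "\<And>r. \<bar>k r\<bar> \<le> N"
begin

definition s :: "real \<Rightarrow> real" where "s r = slope p (radial_flux DIM('a) k r)"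
definition \<phi> :: "real \<Rightarrow> real" where "\<phi> = potential s b"
definition grad :: "'a \<Rightarrow> 'a" where "grad x = s (dist c x) *\<^sub>R sgn (x - c)"
definition F :: "'a \<Rightarrow> real" where "F x = k (dist c x)"
definition field :: "real \<Rightarrow> 'a \<Rightarrow> 'a" where "field R x = indicator (ball c R) x *\<^sub>R ray_field c F x"

lemma s_zero: "s 0 = 0"
  using radial_flux_bound[OF k, of "DIM('a)" 0] by (simp add: s_def)

lemma continuous_s: "continuous_on UNIV s"
  unfolding s_def[abs_def]
  by (rule continuous_on_compose2[OF continuous_slope[OF p] continuous_radial_flux[OF k]]) simp

lemma DERIV_\<phi>: "(\<phi> has_real_derivative s r) (at r)"
  unfolding \<phi>_def by (rule DERIV_potential[OF continuous_s])

lemma \<phi>_base: "\<phi> b = 0" by (simp add: \<phi>_def)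

lemma continuous_\<phi>:
  assumes "continuous_on UNIV h" shows "continuous_on UNIV (\<lambda>x. \<phi> (h x))"
proof (rule continuous_on_compose2[OF _ assms])
  show "continuous_on UNIV \<phi>" by (meson DERIV_isCont DERIV_\<phi> continuous_at_imp_continuous_on)
qed simp

lemma GDERIV_\<phi>: "GDERIV (\<lambda>x. \<phi> (dist c x)) x :> grad x"
  unfolding grad_def by (rule GDERIV_radial[OF DERIV_\<phi> s_zero])

lemma continuous_grad: "continuous_on S grad"
  unfolding grad_def[abs_def]
  by (rule continuous_on_subset[OF continuous_radial_gradient[OF continuous_s s_zero]]) simp

lemma norm_grad:
  assumes "x \<noteq> c \<Longrightarrow> \<bar>radial_flux DIM('a) k (dist c x)\<bar> \<le> 1" shows "norm (grad x) \<le> 1"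
proof (cases "x = c")
  case False
  then have "\<bar>s (dist c x)\<bar> \<le> 1" unfolding s_def using assms by (intro slope_bound[OF p]) auto
  then show ?thesis by (simp add: grad_def norm_sgn)
qed (simp add: grad_def)

lemma F_measurable: "F \<in> borel_measurable borel"
  unfolding F_def[abs_def] by (rule measurable_compose[OF _ k(1)]) simp

lemma F_bound: "\<bar>F x\<bar> \<le> N" by (simp add: F_def k(2))

lemma N_nonneg: "0 \<le> N" using k(2)[of 0] by linarith

lemma p_flux_grad: "x \<in> ball c R \<Longrightarrow> p_flux p (grad x) = field R x"
  using p_flux_radial[OF p k(1), of c x] by (simp add: grad_def field_def F_def[abs_def] s_def)

lemma field_measurable: "field R \<in> borel_measurable borel"
  unfolding field_def[abs_def]
  by (intro borel_measurable_scaleR borel_measurable_indicator ray_field_measurable F_measurable) simp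

lemma field_bound:
  assumes "0 < R" shows "norm (field R x) \<le> N * R"
proof (cases "x \<in> ball c R")
  case True
  have "norm (ray_field c F x) \<le> N * dist c x" by (rule ray_field_bound[OF F_measurable F_bound])
  also have "\<dots> \<le> N * R" using True N_nonneg by (intro mult_left_mono) auto
  finally show ?thesis using True by (simp add: field_def)
qed (use N_nonneg assms in \<open>simp add: field_def\<close>)

end

section \<open>Cutoffs on shells\<close>

text \<open>A $C^1$ step, \<open>0\<close> on the negative axis and \<open>1\<close> from \<open>1\<close> on, made of two squares of positive parts.\<close>

definition smooth_step :: "real \<Rightarrow> real" where "smooth_step t = (max 0 (1 - (max 0 (1 - t))\<^sup>2))\<^sup>2"
definition smooth_step_deriv :: "real \<Rightarrow> real" where "smooth_step_deriv t = 4 * max 0 (1 - (max 0 (1 - t))\<^sup>2) * max 0 (1 - t)"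

lemma DERIV_smooth_step: "(smooth_step has_real_derivative smooth_step_deriv t) (at t)"
proof -
  have 1: "((\<lambda>t. 1 - t) has_real_derivative - 1) (at t)" by (auto intro!: derivative_eq_intros)
  have 2: "((\<lambda>t. 1 - (max 0 (1 - t))\<^sup>2) has_real_derivative 0 - (2 * max 0 (1 - t)) * (- 1)) (at t)"
    by (rule DERIV_diff[OF DERIV_const DERIV_chain2[OF DERIV_positive_part_square 1]])
  from DERIV_chain2[OF DERIV_positive_part_square 2]
  show ?thesis unfolding smooth_step_def[abs_def] smooth_step_deriv_def by (simp add: algebra_simps)
qed

lemma smooth_step_bounds: "0 \<le> smooth_step t" "smooth_step t \<le> 1" "0 \<le> smooth_step_deriv t" "smooth_step_deriv t \<le> 4"
proof -
  have m: "0 \<le> max 0 (1 - (max 0 (1 - t))\<^sup>2)" "max 0 (1 - (max 0 (1 - t))\<^sup>2) \<le> 1" by auto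
  show "0 \<le> smooth_step t" by (simp add: smooth_step_def)
  show "smooth_step t \<le> 1" unfolding smooth_step_def using m by (intro power_le_one)
  show "0 \<le> smooth_step_deriv t" by (simp add: smooth_step_deriv_def)
  show "smooth_step_deriv t \<le> 4"
  proof (cases "t \<le> 0")
    case True
    then have "1 \<le> (1 - t)\<^sup>2" by (intro one_le_power) auto
    then show ?thesis using True by (simp add: smooth_step_deriv_def)
  next
    case False
    have "max 0 (1 - (max 0 (1 - t))\<^sup>2) * max 0 (1 - t) \<le> 1 * 1" using m False by (intro mult_mono) auto
    then show ?thesis by (simp add: smooth_step_deriv_def)
  qed
qed

lemma smooth_step_0: "t \<le> 0 \<Longrightarrow> smooth_step t = 0" "t \<le> 0 \<Longrightarrow> smooth_step_deriv t = 0"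
proof -
  assume "t \<le> 0"
  then have "1 \<le> (1 - t)\<^sup>2" by (intro one_le_power) auto
  then show "smooth_step t = 0" "smooth_step_deriv t = 0" using \<open>t \<le> 0\<close> by (auto simp: smooth_step_def smooth_step_deriv_def)
qed

lemma smooth_step_1: "1 \<le> t \<Longrightarrow> smooth_step t = 1" "1 \<le> t \<Longrightarrow> smooth_step_deriv t = 0"
  by (auto simp: smooth_step_def smooth_step_deriv_def)

lemma continuous_smooth_step: "continuous_on UNIV smooth_step" "continuous_on UNIV smooth_step_deriv"
  unfolding smooth_step_def[abs_def] smooth_step_deriv_def[abs_def] by (intro continuous_intros)+

text \<open>Factor \<open>sqrt t ^ n - sqrt s ^ n\<close> as a difference of powers, then \<open>sqrt t - sqrt s\<close> as
  \<open>(t - s) / (sqrt t + sqrt s)\<close>.\<close>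

lemma shell_volume:
  fixes c :: "'a::euclidean_space"
  assumes "0 < s" "s \<le> t"
  shows "measure lborel {x. s \<le> (dist c x)\<^sup>2 \<and> (dist c x)\<^sup>2 \<le> t}
     \<le> unit_ball_vol (real DIM('a)) * (real DIM('a) * sqrt t ^ (DIM('a) - 1)) * ((t - s) / sqrt s)"
proof -
  let ?n = "DIM('a)"
  have eq: "{x. s \<le> (dist c x)\<^sup>2 \<and> (dist c x)\<^sup>2 \<le> t} = cball c (sqrt t) - ball c (sqrt s)"
  proof -
    have "(dist c x)\<^sup>2 \<le> t \<longleftrightarrow> dist c x \<le> sqrt t" for x
      using real_le_rsqrt sqrt_le_D[of t] by (metis real_sqrt_le_iff real_sqrt_unique zero_le_dist)
    moreover have "s \<le> (dist c x)\<^sup>2 \<longleftrightarrow> sqrt s \<le> dist c x" for x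
      by (metis real_sqrt_le_iff real_sqrt_unique zero_le_dist)
    ultimately show ?thesis by auto
  qed
  have st: "sqrt s \<le> sqrt t" using assms by simp
  have "measure lborel (cball c (sqrt t) - ball c (sqrt s)) = measure lborel (cball c (sqrt t)) - measure lborel (ball c (sqrt s))"
  proof (rule measure_Diff)
    show "emeasure lborel (cball c (sqrt t)) \<noteq> \<infinity>" using emeasure_lborel_cball_finite[of c "sqrt t"] by simp
    show "ball c (sqrt s) \<subseteq> cball c (sqrt t)" using st by (intro order_trans[OF ball_subset_cball] subset_cball)
  qed auto
  also have "\<dots> = unit_ball_vol (real ?n) * (sqrt t ^ ?n - sqrt s ^ ?n)"
    using assms by (simp add: content_ball content_cball right_diff_distrib)
  finally have vol: "measure lborel (cball c (sqrt t) - ball c (sqrt s)) = unit_ball_vol (real ?n) * (sqrt t ^ ?n - sqrt s ^ ?n)" .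
  have p1: "sqrt t ^ ?n - sqrt s ^ ?n \<le> (real ?n * sqrt t ^ (?n - 1)) * (sqrt t - sqrt s)"
  proof -
    have eq: "sqrt t ^ ?n - sqrt s ^ ?n = (sqrt t - sqrt s) * (\<Sum>i<?n. sqrt s ^ (?n - Suc i) * sqrt t ^ i)"
      by (rule power_diff_sumr2)
    have "(\<Sum>i<?n. sqrt s ^ (?n - Suc i) * sqrt t ^ i) \<le> (\<Sum>i<?n. sqrt t ^ (?n - 1))"
    proof (rule sum_mono)
      fix i assume "i \<in> {..<?n}"
      then have "sqrt s ^ (?n - Suc i) * sqrt t ^ i \<le> sqrt t ^ (?n - Suc i) * sqrt t ^ i"
        using st assms by (intro mult_right_mono power_mono) auto
      also have "\<dots> = sqrt t ^ (?n - 1)" using \<open>i \<in> {..<?n}\<close> by (simp add: power_add[symmetric])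
      finally show "sqrt s ^ (?n - Suc i) * sqrt t ^ i \<le> sqrt t ^ (?n - 1)" .
    qed
    then have "(\<Sum>i<?n. sqrt s ^ (?n - Suc i) * sqrt t ^ i) \<le> real ?n * sqrt t ^ (?n - 1)" by simp
    then have "(sqrt t - sqrt s) * (\<Sum>i<?n. sqrt s ^ (?n - Suc i) * sqrt t ^ i)
        \<le> (sqrt t - sqrt s) * (real ?n * sqrt t ^ (?n - 1))"
      using st by (intro mult_left_mono) auto
    then show ?thesis using eq by (simp only: mult.commute)
  qed
  have p2: "sqrt t - sqrt s \<le> (t - s) / sqrt s"
  proof -
    have "(sqrt t - sqrt s) * sqrt s \<le> (sqrt t - sqrt s) * (sqrt t + sqrt s)"
      using st assms by (intro mult_left_mono) auto
    also have "\<dots> = t - s" using assms by (simp add: algebra_simps)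
    finally show ?thesis using assms by (simp add: pos_le_divide_eq)
  qed
  have "sqrt t ^ ?n - sqrt s ^ ?n \<le> (real ?n * sqrt t ^ (?n - 1)) * ((t - s) / sqrt s)"
    using assms by (intro order_trans[OF p1 mult_left_mono[OF p2]]) auto
  then have "unit_ball_vol (real ?n) * (sqrt t ^ ?n - sqrt s ^ ?n)
      \<le> unit_ball_vol (real ?n) * ((real ?n * sqrt t ^ (?n - 1)) * ((t - s) / sqrt s))"
    by (intro mult_left_mono) auto
  then show ?thesis unfolding eq vol by (simp only: mult.assoc)
qed

text \<open>A layer of width of order \<open>1 / K\<close> at a nondegenerate sphere has volume of order \<open>1 / K\<close>. At scales
  \<open>K < 4 / |\<gamma>|\<close> a trivial bound suffices; beyond them the layer keeps away from the centre, where the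
  square root is not Lipschitz, or is empty if \<open>\<gamma> < 0\<close>.\<close>

lemma layer_volume:
  fixes c :: "'a::euclidean_space"
  assumes \<gamma>: "\<gamma> \<noteq> 0"
  shows "\<exists>C\<ge>0. \<forall>K\<ge>1. K * measure lborel {x. \<gamma> - 2 / K \<le> (dist c x)\<^sup>2 \<and> (dist c x)\<^sup>2 \<le> \<gamma> + 2 / K} \<le> C"
proof -
  let ?S = "\<lambda>K. {x. \<gamma> - 2 / K \<le> (dist c x)\<^sup>2 \<and> (dist c x)\<^sup>2 \<le> \<gamma> + 2 / K}"
  define v where "v = unit_ball_vol (real DIM('a)) * (real DIM('a) * sqrt (\<bar>\<gamma>\<bar> + 2) ^ (DIM('a) - 1))"
  define C1 where "C1 = 4 / \<bar>\<gamma>\<bar> * measure lborel (cball c (sqrt (\<bar>\<gamma>\<bar> + 2)))"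
  define C2 where "C2 = v * (4 / sqrt (\<bar>\<gamma>\<bar> / 2))"
  have v0: "0 \<le> v" by (simp add: v_def)
  have C0: "0 \<le> C1" "0 \<le> C2" using v0 by (auto simp: C1_def C2_def)
  have "K * measure lborel (?S K) \<le> C1 + C2" if K: "K \<ge> 1" for K
  proof (cases "K < 4 / \<bar>\<gamma>\<bar>")
    case True
    have "?S K \<subseteq> cball c (sqrt (\<bar>\<gamma>\<bar> + 2))"
    proof
      fix x assume "x \<in> ?S K"
      moreover have "2 / K \<le> 2" using K by (simp add: field_simps)
      ultimately have "(dist c x)\<^sup>2 \<le> \<bar>\<gamma>\<bar> + 2" by auto
      then show "x \<in> cball c (sqrt (\<bar>\<gamma>\<bar> + 2))" using real_le_rsqrt by auto
    qed
    moreover have "cball c (sqrt (\<bar>\<gamma>\<bar> + 2)) \<in> fmeasurable lborel"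
      by (intro fmeasurableI) (use emeasure_lborel_cball_finite[of c] in auto)
    ultimately have "measure lborel (?S K) \<le> measure lborel (cball c (sqrt (\<bar>\<gamma>\<bar> + 2)))"
      by (intro measure_mono_fmeasurable) (auto intro: borel_closed closed_Collect_conj closed_Collect_le continuous_intros)
    then have "K * measure lborel (?S K) \<le> C1" unfolding C1_def using True K by (intro mult_mono) auto
    then show ?thesis using C0 by linarith
  next
    case False
    then have K2: "2 / K \<le> \<bar>\<gamma>\<bar> / 2" using \<gamma> K by (simp add: field_simps)
    show ?thesis
    proof (cases "\<gamma> > 0")
      case True
      have s: "0 < \<gamma> - 2 / K" "\<bar>\<gamma>\<bar> / 2 \<le> \<gamma> - 2 / K" using K2 True by auto
      have t: "\<gamma> + 2 / K \<le> \<bar>\<gamma>\<bar> + 2" "\<gamma> - 2 / K \<le> \<gamma> + 2 / K" using K True by (auto simp: field_simps)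
      have "measure lborel (?S K) \<le> unit_ball_vol (real DIM('a)) * (real DIM('a) * sqrt (\<gamma> + 2 / K) ^ (DIM('a) - 1))
          * ((\<gamma> + 2 / K - (\<gamma> - 2 / K)) / sqrt (\<gamma> - 2 / K))"
        by (rule shell_volume[OF s(1) t(2)])
      also have "\<dots> \<le> v * ((4 / K) / sqrt (\<bar>\<gamma>\<bar> / 2))"
        unfolding v_def using s t K True
        by (intro mult_mono frac_le power_mono) auto
      finally have "K * measure lborel (?S K) \<le> K * (v * ((4 / K) / sqrt (\<bar>\<gamma>\<bar> / 2)))"
        using K by (intro mult_left_mono) auto
      also have "\<dots> = C2" using K by (simp add: C2_def)
      finally show ?thesis using C0 by linarith
    next
      case False
      have "\<gamma> + 2 / K < 0" using K2 False \<gamma> by linarith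
      then have "\<not> (dist c x)\<^sup>2 \<le> \<gamma> + 2 / K" for x by (metis linorder_not_less order.strict_trans1 zero_le_power2 order_trans)
      then have "?S K = {}" by auto
      then have "measure lborel (?S K) = 0" by (simp only: measure_empty)
      then show ?thesis using C0 by simp
    qed
  qed
  then show ?thesis using C0 by (intro exI[of _ "C1 + C2"]) auto
qed

text \<open>In terms of the squared distance the cutoffs are of class $C^1$ also at the centre. A negative
  \<open>\<alpha>\<close> gives a ball. The gradient at scale \<open>K\<close> is of order \<open>K\<close> on layers of width of order \<open>1 / K\<close>.\<close>

lemma shell_cutoffs:
  fixes c :: "'a::euclidean_space"
  assumes ab: "\<alpha> \<noteq> 0" "0 < \<beta>"
  shows "\<exists>\<eta> d\<eta> C. cutoffs {x. \<alpha> < (dist c x)\<^sup>2 \<and> (dist c x)\<^sup>2 < \<beta>} \<eta> d\<eta> C"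
proof -
  let ?V = "{x. \<alpha> < (dist c x)\<^sup>2 \<and> (dist c x)\<^sup>2 < \<beta>}"
  define K where "K = (\<lambda>k::nat. real k + 1)"
  have K: "1 \<le> K k" "0 < K k" for k by (auto simp: K_def)
  define A B where "A = (\<lambda>k x. K k * ((dist c x)\<^sup>2 - \<alpha>) - 1)" and "B = (\<lambda>k x. K k * (\<beta> - (dist c x)\<^sup>2) - 1)"
  define \<eta> where "\<eta> = (\<lambda>k x. smooth_step (A k x) * smooth_step (B k x))"
  define d\<eta> where "d\<eta> = (\<lambda>k x. smooth_step (A k x) *\<^sub>R smooth_step_deriv (B k x) *\<^sub>R K k *\<^sub>R (0 - 2 *\<^sub>R (x - c))
       + smooth_step (B k x) *\<^sub>R smooth_step_deriv (A k x) *\<^sub>R K k *\<^sub>R (2 *\<^sub>R (x - c) - 0))"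
  have cA: "continuous_on UNIV (A k)" "continuous_on UNIV (B k)" for k
    unfolding A_def B_def by (intro continuous_intros)+
  have T: "test_function ?V (\<eta> k) (d\<eta> k)" for k
    unfolding test_function_def
  proof (intro conjI allI exI)
    fix x
    have lin: "((\<lambda>y. K k * y - 1) has_real_derivative K k) (at y)" for y
      by (auto intro!: derivative_eq_intros)
    have "GDERIV (\<lambda>x. (dist c x)\<^sup>2 - \<alpha>) x :> 2 *\<^sub>R (x - c) - 0"
      by (rule GDERIV_diff[OF GDERIV_dist_square GDERIV_const])
    from GDERIV_DERIV_compose[OF this lin] have gA: "GDERIV (A k) x :> K k *\<^sub>R (2 *\<^sub>R (x - c) - 0)"
      unfolding A_def .
    have "GDERIV (\<lambda>x. \<beta> - (dist c x)\<^sup>2) x :> 0 - 2 *\<^sub>R (x - c)"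
      by (rule GDERIV_diff[OF GDERIV_const GDERIV_dist_square])
    from GDERIV_DERIV_compose[OF this lin] have gB: "GDERIV (B k) x :> K k *\<^sub>R (0 - 2 *\<^sub>R (x - c))"
      unfolding B_def .
    show "GDERIV (\<eta> k) x :> d\<eta> k x"
      unfolding \<eta>_def d\<eta>_def
      by (rule GDERIV_mult[OF GDERIV_DERIV_compose[OF gA DERIV_smooth_step] GDERIV_DERIV_compose[OF gB DERIV_smooth_step]])
    show "continuous_on UNIV (d\<eta> k)"
      unfolding d\<eta>_def
      by (intro continuous_intros continuous_on_compose2[OF continuous_smooth_step(1)] continuous_on_compose2[OF continuous_smooth_step(2)] cA) auto
    let ?K = "{x. \<alpha> + 1 / K k \<le> (dist c x)\<^sup>2 \<and> (dist c x)\<^sup>2 \<le> \<beta> - 1 / K k}"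
    have "bounded ?K"
    proof (rule bounded_subset[of "cball c (sqrt \<beta>)"])
      show "?K \<subseteq> cball c (sqrt \<beta>)"
      proof
        fix x assume "x \<in> ?K"
        moreover have "0 < 1 / K k" using K by simp
        ultimately have "(dist c x)\<^sup>2 \<le> \<beta>" by (simp only: mem_Collect_eq) linarith
        then show "x \<in> cball c (sqrt \<beta>)" using real_le_rsqrt by auto
      qed
    qed simp
    moreover have "closed ?K"
      by (intro closed_Collect_conj closed_Collect_le continuous_intros)
    ultimately show "compact ?K" by (simp add: compact_eq_bounded_closed)
    have "0 < 1 / K k" using K by simp
    then show "?K \<subseteq> ?V" by (intro Collect_mono) linarith
    show "x \<notin> ?K \<longrightarrow> \<eta> k x = 0" for x
    proof
      assume "x \<notin> ?K"
      then have "(dist c x)\<^sup>2 - \<alpha> < 1 / K k \<or> \<beta> - (dist c x)\<^sup>2 < 1 / K k" by auto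
      then have "A k x \<le> 0 \<or> B k x \<le> 0" using K[of k] by (auto simp: A_def B_def field_simps)
      then show "\<eta> k x = 0" unfolding \<eta>_def by (auto simp: smooth_step_0)
    qed
  qed
  have bd: "0 \<le> \<eta> k x \<and> \<eta> k x \<le> 1" for k x
    unfolding \<eta>_def using smooth_step_bounds by (auto intro: mult_le_one)
  have ex: "\<forall>\<^sub>F k in sequentially. \<forall>x\<in>Q. \<eta> k x = 1 \<and> d\<eta> k x = 0" if Q: "compact Q" "Q \<subseteq> ?V" for Q
  proof (cases "Q = {}")
    case False
    have "continuous_on Q (\<lambda>x. min ((dist c x)\<^sup>2 - \<alpha>) (\<beta> - (dist c x)\<^sup>2))" by (intro continuous_intros)
    from continuous_attains_inf[OF Q(1) False this]
    obtain z where z: "z \<in> Q" "\<And>y. y \<in> Q \<Longrightarrow> min ((dist c z)\<^sup>2 - \<alpha>) (\<beta> - (dist c z)\<^sup>2) \<le> min ((dist c y)\<^sup>2 - \<alpha>) (\<beta> - (dist c y)\<^sup>2)"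
      by blast
    define \<delta> where "\<delta> = min ((dist c z)\<^sup>2 - \<alpha>) (\<beta> - (dist c z)\<^sup>2)"
    have \<delta>: "\<delta> > 0" using z(1) Q(2) by (auto simp: \<delta>_def)
    have "\<forall>\<^sub>F k in sequentially. 2 / \<delta> \<le> real k"
      using filterlim_real_sequentially by (auto simp: filterlim_at_top)
    then show ?thesis
    proof eventually_elim
      case (elim k)
      show ?case
      proof
        fix y assume "y \<in> Q"
        then have y: "\<delta> \<le> (dist c y)\<^sup>2 - \<alpha>" "\<delta> \<le> \<beta> - (dist c y)\<^sup>2" using z(2)[of y] by (auto simp: \<delta>_def)
        have "2 / \<delta> \<le> K k" using elim by (simp add: K_def)
        then have "2 \<le> K k * \<delta>" using \<delta> by (simp add: field_simps)
        then have "2 \<le> K k * ((dist c y)\<^sup>2 - \<alpha>)" "2 \<le> K k * (\<beta> - (dist c y)\<^sup>2)"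
          using y K[of k] by (auto intro: order_trans[OF _ mult_left_mono])
        then have "1 \<le> A k y" "1 \<le> B k y" by (auto simp: A_def B_def)
        then show "\<eta> k y = 1 \<and> d\<eta> k y = 0" unfolding \<eta>_def d\<eta>_def by (simp add: smooth_step_1)
      qed
    qed
  qed simp
  obtain C1 where C1: "\<And>K. K \<ge> 1 \<Longrightarrow> K * measure lborel {x. \<alpha> - 2 / K \<le> (dist c x)\<^sup>2 \<and> (dist c x)\<^sup>2 \<le> \<alpha> + 2 / K} \<le> C1"
    using layer_volume[OF ab(1), of c] by blast
  obtain C2 where C2: "\<And>K. K \<ge> 1 \<Longrightarrow> K * measure lborel {x. \<beta> - 2 / K \<le> (dist c x)\<^sup>2 \<and> (dist c x)\<^sup>2 \<le> \<beta> + 2 / K} \<le> C2"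
    using layer_volume[of \<beta> c] ab(2) by blast
  have tv: "(LINT x|lebesgue. norm (d\<eta> k x)) \<le> 8 * sqrt \<beta> * (C1 + C2)" for k
  proof -
    define S1 S2 where "S1 = {x. \<alpha> - 2 / K k \<le> (dist c x)\<^sup>2 \<and> (dist c x)\<^sup>2 \<le> \<alpha> + 2 / K k}"
      and "S2 = {x. \<beta> - 2 / K k \<le> (dist c x)\<^sup>2 \<and> (dist c x)\<^sup>2 \<le> \<beta> + 2 / K k}"
    have sets: "S1 \<in> sets borel" "S2 \<in> sets borel" unfolding S1_def S2_def
      by (intro borel_closed closed_Collect_conj closed_Collect_le continuous_intros)+
    have fin: "emeasure lborel S < \<infinity>" if "S \<subseteq> {x. (dist c x)\<^sup>2 \<le> \<gamma>}" for S \<gamma>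
    proof (rule emeasure_bounded_finite, rule bounded_subset[of "cball c (sqrt \<gamma>)"])
      show "S \<subseteq> cball c (sqrt \<gamma>)" using that real_le_rsqrt by auto
    qed simp
    have f1: "emeasure lborel S1 < \<infinity>" by (rule fin[of _ "\<alpha> + 2 / K k"]) (auto simp: S1_def)
    have f2: "emeasure lborel S2 < \<infinity>" by (rule fin[of _ "\<beta> + 2 / K k"]) (auto simp: S2_def)
    have i: "integrable lborel (indicator S1 :: 'a \<Rightarrow> real)" "integrable lborel (indicator S2 :: 'a \<Rightarrow> real)"
      using sets f1 f2 by auto
    have pt: "norm (d\<eta> k x) \<le> (8 * K k * sqrt \<beta>) * (indicator S1 x + indicator S2 x)" for x
    proof (cases "x \<in> ?V")
      case False
      then have "d\<eta> k x = 0" using test_function_vanishes(2)[OF T] by blast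
      then show ?thesis using K[of k] ab by simp
    next
      case True
      then have "norm (x - c) \<le> sqrt \<beta>" by (auto simp: dist_norm norm_minus_commute intro!: real_le_rsqrt)
      moreover have "smooth_step_deriv (A k x) \<le> 4 * indicator S1 x"
      proof (cases "x \<in> S1")
        case False
        have "0 < 2 / K k" using K by simp
        then have "(dist c x)\<^sup>2 > \<alpha> + 2 / K k" using False True by (auto simp: S1_def)
        then have "1 \<le> A k x" using K[of k] by (simp add: A_def field_simps)
        then show ?thesis using False by (simp add: smooth_step_1)
      qed (simp add: smooth_step_bounds)
      moreover have "smooth_step_deriv (B k x) \<le> 4 * indicator S2 x"
      proof (cases "x \<in> S2")
        case False
        have "0 < 2 / K k" using K by simp
        then have "(dist c x)\<^sup>2 < \<beta> - 2 / K k" using False True by (auto simp: S2_def)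
        then have "1 \<le> B k x" using K[of k] by (simp add: B_def field_simps)
        then show ?thesis using False by (simp add: smooth_step_1)
      qed (simp add: smooth_step_bounds)
      ultimately have nn: "norm (x - c) * smooth_step_deriv (A k x) \<le> sqrt \<beta> * (4 * indicator S1 x)"
        "norm (x - c) * smooth_step_deriv (B k x) \<le> sqrt \<beta> * (4 * indicator S2 x)"
        using ab smooth_step_bounds by (auto intro!: mult_mono)
      have n1: "norm (smooth_step t *\<^sub>R smooth_step_deriv r *\<^sub>R K k *\<^sub>R w) \<le> K k * (norm w * smooth_step_deriv r)" for t r and w :: 'a
      proof -
        have "smooth_step t * (smooth_step_deriv r * (K k * norm w)) \<le> 1 * (smooth_step_deriv r * (K k * norm w))"
          using smooth_step_bounds K[of k] by (intro mult_right_mono) auto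
        then show ?thesis using smooth_step_bounds K[of k] by (simp add: algebra_simps)
      qed
      have "norm (d\<eta> k x) \<le> K k * (norm (0 - 2 *\<^sub>R (x - c)) * smooth_step_deriv (B k x)) + K k * (norm (2 *\<^sub>R (x - c) - 0) * smooth_step_deriv (A k x))"
        unfolding d\<eta>_def by (rule order_trans[OF norm_triangle_ineq add_mono[OF n1 n1]])
      also have "\<dots> = 2 * K k * (norm (x - c) * smooth_step_deriv (B k x)) + 2 * K k * (norm (x - c) * smooth_step_deriv (A k x))"
        by simp
      also have "\<dots> \<le> 2 * K k * (sqrt \<beta> * (4 * indicator S2 x)) + 2 * K k * (sqrt \<beta> * (4 * indicator S1 x))"
        using nn K[of k] by (intro add_mono mult_left_mono) auto
      also have "\<dots> = (8 * K k * sqrt \<beta>) * (indicator S1 x + indicator S2 x)" by (simp add: algebra_simps)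
      finally show ?thesis .
    qed
    have "(LINT x|lebesgue. norm (d\<eta> k x)) = (LINT x|lborel. norm (d\<eta> k x))"
      using test_function_continuous(4)[OF T[of k]] by (intro integral_completion) auto
    also have "\<dots> \<le> (LINT x|lborel. (8 * K k * sqrt \<beta>) * (indicator S1 x + indicator S2 x))"
      using test_function_integrable(2)[OF T[of k]] i pt by (intro Bochner_Integration.integral_mono) auto
    also have "\<dots> = (8 * sqrt \<beta>) * (K k * measure lborel S1 + K k * measure lborel S2)"
      using i f1 f2 sets by (simp add: algebra_simps)
    also have "\<dots> \<le> (8 * sqrt \<beta>) * (C1 + C2)"
      using C1[OF K(1)[of k]] C2[OF K(1)[of k]] ab unfolding S1_def S2_def by (intro mult_left_mono add_mono) auto
    finally show ?thesis by simp
  qed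
  have "cutoffs ?V \<eta> d\<eta> (8 * sqrt \<beta> * (C1 + C2))"
    unfolding cutoffs_def using T bd ex tv by blast
  then show ?thesis by blast
qed

section \<open>Integrals of radial functions\<close>

lemma inv_sphere_area_eq:
  assumes "0 < n" shows "inv_sphere_area n * (real n * unit_ball_vol (real n)) = 1"
proof -
  have G: "Gamma (real n / 2 + 1) = real n / 2 * Gamma (real n / 2)"
    using assms by (subst Gamma_plus1) auto
  have "0 < Gamma (real n / 2)" using assms by (intro Gamma_real_pos) simp
  then have "Gamma (real n / 2) \<noteq> 0" by (rule less_imp_neq[symmetric])
  then show ?thesis using assms unfolding inv_sphere_area_def unit_ball_vol_def G by simp
qed

text \<open>The law of the distance to \<open>c\<close> under Lebesgue measure on a ball, from the volumes of balls.\<close>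

lemma distr_dist_ball:
  fixes c :: "'a::euclidean_space"
  assumes R: "0 < R"
  shows "distr (density lborel (indicator (cball c R))) borel (dist c)
     = density lborel (\<lambda>r. ennreal (real DIM('a) * unit_ball_vol (real DIM('a)) * r ^ (DIM('a) - 1)) * indicator {0..R} r)"
    (is "?M = ?N")
proof (rule measure_eqI_lessThan)
  let ?n = "DIM('a)" and ?v = "unit_ball_vol (real DIM('a))"
  have v: "0 \<le> ?v" by simp
  have fin: "emeasure lborel (cball c r - S) \<noteq> \<infinity>" for r S
  proof -
    have "emeasure lborel (cball c r - S) \<le> emeasure lborel (cball c r)" by (intro emeasure_mono) auto
    then show ?thesis using emeasure_lborel_cball_finite[of c r] by (auto simp: top_unique)
  qed
  have M: "emeasure ?M {x<..} = emeasure lborel (cball c R - cball c x)" for x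
  proof -
    have B: "cball c R \<in> sets borel" by simp
    have S: "dist c -` {x<..} \<in> sets borel"
      by (intro borel_open open_vimage continuous_intros)
    have "emeasure ?M {x<..} = emeasure (density lborel (indicator (cball c R))) (dist c -` {x<..})"
      by (subst emeasure_distr) auto
    also have "\<dots> = (\<integral>\<^sup>+y. indicator (cball c R) y * indicator (dist c -` {x<..}) y \<partial>lborel)"
      by (subst emeasure_density) (use S B in \<open>auto intro: borel_measurable_indicator\<close>)
    also have "\<dots> = (\<integral>\<^sup>+y. indicator (cball c R - cball c x) y \<partial>lborel)"
      by (intro nn_integral_cong) (auto simp: indicator_def)
    also have "\<dots> = emeasure lborel (cball c R - cball c x)" by (rule nn_integral_indicator) auto
    finally show ?thesis .
  qed
  show "emeasure ?M {x<..} < \<infinity>" for x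
    unfolding M using fin by (simp add: less_top)
  show "emeasure ?M {x<..} = emeasure ?N {x<..}" for x
  proof -
    have N: "emeasure ?N {x<..} = (\<integral>\<^sup>+r. (ennreal (real ?n * ?v * r ^ (?n - 1)) * indicator {0..R} r) * indicator {x<..} r \<partial>lborel)"
      by (subst emeasure_density) auto
    (* distances are nonnegative, so a negative x counts as 0 *)
    define y where "y = max x 0"
    show ?thesis
    proof (cases "y \<le> R")
      case True
      have "emeasure ?N {x<..} = (\<integral>\<^sup>+r. ennreal (real ?n * ?v * r ^ (?n - 1)) * indicator {y..R} r \<partial>lborel)"
        unfolding N
      proof (rule nn_integral_cong_AE)
        have "AE r in lborel. r \<noteq> x" by (rule AE_lborel_singleton)
        then show "AE r in lborel. ennreal (real ?n * ?v * r ^ (?n - 1)) * indicator {0..R} r * indicator {x<..} r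
            = ennreal (real ?n * ?v * r ^ (?n - 1)) * indicator {y..R} r"
          by eventually_elim (auto simp: indicator_def y_def)
      qed
      also have "\<dots> = ennreal (?v * R ^ ?n - ?v * y ^ ?n)"
      proof (rule nn_integral_FTC_Icc)
        show "((\<lambda>r. ?v * r ^ ?n) has_real_derivative real ?n * ?v * r ^ (?n - 1)) (at r)" for r
          by (auto intro!: derivative_eq_intros simp: mult_ac)
      qed (use True in \<open>auto simp: y_def\<close>)
      also have "?v * R ^ ?n - ?v * y ^ ?n = measure lborel (cball c R - cball c x)"
      proof (cases "x < 0")
        case True
        then show ?thesis using R by (simp add: y_def content_cball)
      next
        case False
        have le: "x \<le> R" "y = x" using True False by (simp_all add: y_def)
        have "measure lborel (cball c R - cball c x) = measure lborel (cball c R) - measure lborel (cball c x)"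
          using le fin[of R "{}"] by (intro measure_Diff) (auto intro: subset_cball)
        then show ?thesis using R False le by (simp add: content_cball)
      qed
      also have "ennreal \<dots> = emeasure lborel (cball c R - cball c x)"
        using fin[of R "cball c x"] by (intro emeasure_eq_ennreal_measure[symmetric]) simp
      finally show ?thesis unfolding M by simp
    next
      case False
      then have x: "x > R" "x > 0" using R by (auto simp: y_def max_def split: if_splits)
      then have e: "cball c R - cball c x = {}" by auto
      have z: "e * indicator {0..R} r * indicator {x<..} r = (0::ennreal)" for e r
        using x by (auto simp: indicator_def)
      show ?thesis unfolding M N z e by simp
    qed
  qed
qed auto

lemma radial_integral:
  fixes c :: "'a::euclidean_space"
  assumes [measurable]: "k \<in> borel_measurable borel" and R: "0 < R"
  shows "(LINT x:ball c R|lebesgue. k (dist c x)) = (real DIM('a) * unit_ball_vol (real DIM('a))) * radial_mass DIM('a) k R"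
proof -
  let ?n = "DIM('a)" and ?v = "unit_ball_vol (real DIM('a))"
  have B[measurable]: "cball c R \<in> sets borel" by simp
  have K[measurable]: "(\<lambda>x. k (dist c x)) \<in> borel_measurable borel"
    by (rule measurable_compose[OF _ assms(1)]) simp
  have "(LINT x:ball c R|lebesgue. k (dist c x)) = (LINT x|lebesgue. indicator (cball c R) x *\<^sub>R k (dist c x))"
    unfolding set_lebesgue_integral_def
  proof (rule integral_cong_AE)
    have "AE x in lebesgue. x \<notin> sphere c R"
      by (rule AE_not_in) (simp add: negligible_iff_null_sets[symmetric] negligible_sphere)
    then show "AE x in lebesgue. indicator (ball c R) x *\<^sub>R k (dist c x) = indicator (cball c R) x *\<^sub>R k (dist c x)"
      by eventually_elim (auto simp: indicator_def)
    have m: "(\<lambda>x. indicator S x *\<^sub>R k (dist c x)) \<in> borel_measurable lebesgue" if "S \<in> sets borel" for S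
      by (intro lebesgue_measurable_borel borel_measurable_scaleR borel_measurable_indicator that
            measurable_compose[OF _ assms(1)]) simp
    show "(\<lambda>x. indicator (ball c R) x *\<^sub>R k (dist c x)) \<in> borel_measurable lebesgue"
      "(\<lambda>x. indicator (cball c R) x *\<^sub>R k (dist c x)) \<in> borel_measurable lebesgue"
      by (rule m; simp)+
  qed
  also have "\<dots> = (LINT x|lborel. indicator (cball c R) x *\<^sub>R k (dist c x))" by (rule integral_completion) measurable
  also have "\<dots> = (LINT x|density lborel (indicator (cball c R)). k (dist c x))"
  proof -
    have "(LINT x|density lborel (\<lambda>x. ennreal (indicator (cball c R) x)). k (dist c x)) = (LINT x|lborel. indicator (cball c R) x *\<^sub>R k (dist c x))"
      by (rule integral_density) (use B K in \<open>auto intro: borel_measurable_indicator\<close>)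
    then show ?thesis by (simp add: ennreal_indicator)
  qed
  also have "\<dots> = (LINT r|distr (density lborel (indicator (cball c R))) borel (dist c). k r)"
    by (subst integral_distr) auto
  also have "\<dots> = (LINT r|density lborel (\<lambda>r. ennreal ((real ?n * ?v * r ^ (?n - 1)) * indicator {0..R} r)). k r)"
    unfolding distr_dist_ball[OF R]
    by (intro arg_cong2[where f="integral\<^sup>L"] density_cong AE_I2 refl) (auto simp: indicator_def)
  also have "\<dots> = (LINT r|lborel. ((real ?n * ?v * r ^ (?n - 1)) * indicator {0..R} r) *\<^sub>R k r)"
    by (rule integral_density) (auto simp: indicator_def)
  also have "\<dots> = (LINT r|lborel. (real ?n * ?v) * (indicator {0..R} r *\<^sub>R (k r * r ^ (?n - 1))))"
    by (intro Bochner_Integration.integral_cong refl) (simp add: mult_ac)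
  also have "\<dots> = (real ?n * ?v) * radial_mass ?n k R"
    unfolding radial_mass_def set_lebesgue_integral_def by (rule integral_mult_right_zero)
  finally show ?thesis .
qed

lemma integral_pos:
  fixes f :: "real \<Rightarrow> real"
  assumes "a < b" "continuous_on {a..b} f" "\<And>x. a < x \<Longrightarrow> x < b \<Longrightarrow> 0 < f x"
  shows "0 < integral {a..b} f"
  using integral_less[of a b "\<lambda>_. 0" f] assms by (simp add: box_real)

lemma LBINT_integral:
  fixes f :: "real \<Rightarrow> real"
  assumes "a \<le> b" "continuous_on {a..b} f"
  shows "(LBINT x=ereal a..ereal b. f x) = integral {a..b} f"
  using assms by (intro interval_integral_eq_integral borel_integrable_atLeastAtMost')

section \<open>The explicit profiles\<close>

text \<open>Only the open interval between \<open>s\<close> and \<open>r\<close> matters for the integrals; so, with \<open>a = 0\<close>, the singularity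
  of \<open>\<Phi>\<close> at the centre does no harm.\<close>

lemma profile_potential:
  assumes p: "p > 2"
    and \<Phi>: "\<And>\<rho>. a < \<rho> \<Longrightarrow> \<rho> < b \<Longrightarrow> \<Phi> \<rho> * \<rho> = H \<rho>" "\<And>\<rho>. a < \<rho> \<Longrightarrow> \<rho> < b \<Longrightarrow> (\<Phi> \<rho>)\<^sup>2 * \<rho>\<^sup>2 \<in> {0..1}"
    and "s \<in> {a..b}" "r \<in> {a..b}"
  shows "profile p \<Phi> s r = potential (\<lambda>\<rho>. slope p (H \<rho>)) s r"
  unfolding profile_def potential_def
proof (rule interval_integral_cong)
  fix \<rho> assume "\<rho> \<in> einterval (min (ereal s) (ereal r)) (max (ereal s) (ereal r))"
  then have \<rho>: "a < \<rho>" "\<rho> < b" using assms(4,5) by (auto simp: einterval_def min_def max_def split: if_splits)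
  have "(\<Phi> \<rho>)\<^sup>2 * \<rho>\<^sup>2 = (\<Phi> \<rho> * \<rho>)\<^sup>2" by (simp add: power_mult_distrib)
  then show "\<Phi> \<rho> * \<rho> / Ep_inv p ((\<Phi> \<rho>)\<^sup>2 * \<rho>\<^sup>2) = slope p (H \<rho>)"
    using quotient_Ep_inv[OF p, of "\<Phi> \<rho> * \<rho>"] \<Phi>[OF \<rho>] by simp
qed

lemma set_LINT_uminus: "(LINT x:S|M. - f x) = - (LINT x:S|M. (f x :: real))"
  by (simp add: set_lebesgue_integral_def)

lemma radial_flux_uminus: "radial_flux n (\<lambda>r. - k r) r = - radial_flux n k r"
  by (simp add: radial_flux_def radial_mass_def set_LINT_uminus)

lemma radial_mass_cong:
  assumes "\<And>\<rho>. 0 \<le> \<rho> \<Longrightarrow> \<rho> \<le> r \<Longrightarrow> k \<rho> = d \<rho>"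
  shows "radial_mass n k r = radial_mass n d r"
  unfolding radial_mass_def by (rule set_lebesgue_integral_cong) (use assms in auto)

lemma radial_mass_integral:
  assumes "continuous_on {0..r} d"
  shows "radial_mass n d r = integral {0..r} (\<lambda>\<rho>. d \<rho> * \<rho> ^ (n - 1))"
  unfolding radial_mass_def using assms
  by (intro set_borel_integral_eq_integral borel_integrable_atLeastAtMost' continuous_intros)

text \<open>By the normalization of the total mass, the constant in \<open>F_fun\<close> and the mass beyond \<open>r\<close> combine to
  minus the mass inside \<open>r\<close>, which is the flux that leaves the centre free of a source.\<close>

lemma F_fun_flux:
  assumes d: "continuous_on {0..R} d" and total: "radial_mass n d R = inv_sphere_area n"
    and k: "\<And>r. 0 \<le> r \<Longrightarrow> r \<le> R \<Longrightarrow> k r = d r" and r: "0 < r" "r \<le> R" and n: "0 < n"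
  shows "F_fun n R d r * r = radial_flux n k r"
proof -
  let ?h = "\<lambda>\<rho>. d \<rho> * \<rho> ^ (n - 1)"
  have ch: "continuous_on {0..R} ?h" using d by (intro continuous_intros)
  have "(LBINT \<rho>=ereal r..ereal R. d \<rho> * \<rho> ^ (n - 1) / r ^ n) = (LBINT \<rho>=ereal r..ereal R. ?h \<rho>) / r ^ n" by simp
  also have "(LBINT \<rho>=ereal r..ereal R. ?h \<rho>) = integral {r..R} ?h"
    using r ch by (intro LBINT_integral) (auto intro: continuous_on_subset)
  also have "\<dots> = radial_mass n d R - radial_mass n d r"
  proof -
    have "radial_mass n d R = integral {0..R} ?h" "radial_mass n d r = integral {0..r} ?h"
      using r by (intro radial_mass_integral continuous_on_subset[OF d]; simp)+
    moreover have "integral {0..r} ?h + integral {r..R} ?h = integral {0..R} ?h"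
      using r ch by (intro Henstock_Kurzweil_Integration.integral_combine integrable_continuous_interval) auto
    ultimately show ?thesis by linarith
  qed
  finally have "F_fun n R d r = - radial_mass n d r / r ^ n"
    unfolding F_fun_def total by (simp add: diff_divide_distrib)
  moreover have "radial_mass n k r = radial_mass n d r" by (rule radial_mass_cong) (use k r in auto)
  moreover have "r ^ n = r ^ (n - 1) * r" using n by (metis power_minus_mult)
  ultimately show ?thesis using r by (simp add: radial_flux_def)
qed

lemma G_fun_eq: "G_fun n R d r = - F_fun n R d r"
  by (simp add: G_fun_def F_fun_def)

lemma Gp_fun_eq: "Gp_fun n R d D r = - Fp_fun n R d D r"
  by (simp add: Gp_fun_def Fp_fun_def)

text \<open>The constant term of \<open>Fp_fun\<close> is the flux produced by a uniform source \<open>- n * C\<close> on the inner ball.\<close>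

lemma Fp_fun_flux:
  assumes d: "continuous_on {a..b} d" and ab: "0 < a" "a \<le> r" "r \<le> b" and n: "0 < n"
    and k: "k \<in> borel_measurable borel" "\<And>r. \<bar>k r\<bar> \<le> M"
    and k1: "\<And>r. r < a \<Longrightarrow> 0 \<le> r \<Longrightarrow> k r = - (real n * C)" and k2: "\<And>r. a \<le> r \<Longrightarrow> r \<le> b \<Longrightarrow> k r = d r"
  shows "Fp_fun n a d C r * r = radial_flux n k r"
    and "Fp_fun n a d C r * r = (C * a ^ n - integral {a..r} (\<lambda>\<rho>. d \<rho> * \<rho> ^ (n - 1))) / r ^ (n - 1)"
proof -
  let ?h = "\<lambda>\<rho>. d \<rho> * \<rho> ^ (n - 1)" and ?k = "\<lambda>\<rho>. k \<rho> * \<rho> ^ (n - 1)"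
  have ch: "continuous_on {a..b} ?h" using d by (intro continuous_intros)
  have rn: "r ^ n = r ^ (n - 1) * r" using n by (metis power_minus_mult)
  have "(LBINT \<rho>=ereal a..ereal r. d \<rho> * \<rho> ^ (n - 1) / r ^ n) = (LBINT \<rho>=ereal a..ereal r. ?h \<rho>) / r ^ n" by simp
  also have "(LBINT \<rho>=ereal a..ereal r. ?h \<rho>) = integral {a..r} ?h"
    using ab ch by (intro LBINT_integral) (auto intro: continuous_on_subset)
  finally have F: "Fp_fun n a d C r = (C * a ^ n - integral {a..r} ?h) / r ^ n"
    unfolding Fp_fun_def by (simp add: diff_divide_distrib)
  then show F2: "Fp_fun n a d C r * r = (C * a ^ n - integral {a..r} ?h) / r ^ (n - 1)"
    using ab by (simp add: rn)
  have "radial_mass n k r = integral {0..r} ?k" "?k integrable_on {0..r}"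
    unfolding radial_mass_def
    using set_borel_integral_eq_integral[OF bounded_interval_integrable[OF k, of 0 r "n - 1"]] by auto
  moreover from this(2) have "integral {0..a} ?k + integral {a..r} ?k = integral {0..r} ?k"
    using ab by (intro Henstock_Kurzweil_Integration.integral_combine) auto
  moreover have "integral {a..r} ?k = integral {a..r} ?h"
    by (rule Henstock_Kurzweil_Integration.integral_cong) (use k2 ab in auto)
  moreover have "integral {0..a} ?k = - C * a ^ n"
  proof -
    have "((\<lambda>\<rho>. - (real n * C) * \<rho> ^ (n - 1)) has_integral (- C * a ^ n - - C * 0 ^ n)) {0..a}"
    proof (rule fundamental_theorem_of_calculus)
      fix x :: real assume "x \<in> {0..a}"
      have "((\<lambda>\<rho>. - C * \<rho> ^ n) has_real_derivative - (real n * C) * x ^ (n - 1)) (at x within {0..a})"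
        by (auto intro!: derivative_eq_intros simp: mult_ac)
      then show "((\<lambda>\<rho>. - C * \<rho> ^ n) has_vector_derivative - (real n * C) * x ^ (n - 1)) (at x within {0..a})"
        by (simp add: has_real_derivative_iff_has_vector_derivative)
    qed (use ab in simp)
    from integral_unique[OF this] have "integral {0..a} (\<lambda>\<rho>. - (real n * C) * \<rho> ^ (n - 1)) = - C * a ^ n"
      using n by (simp only: zero_power mult_zero_right diff_zero)
    moreover have "integral {0..a} ?k = integral {0..a} (\<lambda>\<rho>. - (real n * C) * \<rho> ^ (n - 1))"
    proof (rule integral_spike[of "{a}"])
      show "- (real n * C) * \<rho> ^ (n - 1) = ?k \<rho>" if "\<rho> \<in> {0..a} - {a}" for \<rho> using that k1[of \<rho>] by auto
    qed simp
    ultimately show ?thesis by simp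
  qed
  ultimately have "radial_mass n k r = - (C * a ^ n - integral {a..r} ?h)" by simp
  then show "Fp_fun n a d C r * r = radial_flux n k r" unfolding F2 by (simp add: radial_flux_def)
qed

text \<open>Shooting: the end value depends continuously on \<open>C\<close>. It is negative for \<open>C = 0\<close>, and positive when
  the flux \<open>C * a ^ n\<close> is the total mass, which exceeds the mass of the shell.\<close>

lemma shooting_constant:
  assumes p: "p > 2" and ab: "0 < a" "a < b" and n: "0 < n"
    and d: "continuous_on {0..b} d" "\<And>r. 0 \<le> r \<Longrightarrow> r < b \<Longrightarrow> 0 < d r"
  shows "\<exists>C. 0 < C \<and> C < radial_mass n d b / a ^ n \<and> returns_to_zero p (Fp_fun n a d C) a b"
proof -
  let ?h = "\<lambda>\<rho>. d \<rho> * \<rho> ^ (n - 1)"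
  define m where "m = (\<lambda>r. integral {a..r} ?h)"
  have ch: "continuous_on {0..b} ?h" using d(1) by (intro continuous_intros)
  have hpos: "0 < ?h \<rho>" if "0 < \<rho>" "\<rho> < b" for \<rho> using that d(2)[of \<rho>] by simp
  have cm: "continuous_on {a..b} m" unfolding m_def
    by (intro indefinite_integral_continuous_1 integrable_continuous_interval continuous_on_subset[OF ch]) (use ab in auto)
  have mpos: "0 < m r" if "a < r" "r \<le> b" for r
    unfolding m_def using that ab by (intro integral_pos continuous_on_subset[OF ch] hpos) auto
  have ma: "m a = 0" by (simp add: m_def)
  define I where "I = radial_mass n d b"
  have mI: "m r < I" if "a \<le> r" "r \<le> b" for r
  proof -
    have I: "I = integral {0..b} ?h" unfolding I_def by (rule radial_mass_integral[OF d(1)])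
    have int: "?h integrable_on {0..b}" by (rule integrable_continuous_interval[OF ch])
    have "0 < integral {0..a} ?h"
      using ab by (intro integral_pos continuous_on_subset[OF ch] hpos) auto
    moreover have "0 \<le> integral {r..b} ?h"
    proof (cases "r = b")
      case False
      then show ?thesis using that ab by (intro less_imp_le[OF integral_pos] continuous_on_subset[OF ch] hpos) auto
    qed simp
    moreover have "integral {0..a} ?h + integral {a..b} ?h = integral {0..b} ?h"
      using ab int by (intro Henstock_Kurzweil_Integration.integral_combine) auto
    moreover have "integral {a..r} ?h + integral {r..b} ?h = integral {a..b} ?h"
      using ab that by (intro Henstock_Kurzweil_Integration.integral_combine integrable_continuous_interval continuous_on_subset[OF ch]) auto
    ultimately show ?thesis unfolding I m_def by linarith
  qed
  define q where "q = (\<lambda>C r. slope p ((C * a ^ n - m r) / r ^ (n - 1)))"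
  define J where "J = (\<lambda>C. integral {a..b} (q C))"
  have contq: "continuous_on (UNIV \<times> {a..b}) (\<lambda>(C, r). q C r)"
    unfolding q_def split_beta
  proof (rule continuous_on_compose2[OF continuous_slope[OF p]])
    show "continuous_on (UNIV \<times> {a..b}) (\<lambda>x. (fst x * a ^ n - m (snd x)) / snd x ^ (n - 1))"
      using ab by (intro continuous_intros continuous_on_compose2[OF cm]) auto
  qed simp
  have cq: "continuous_on {a..b} (q C)" for C
  proof -
    have "continuous_on {a..b} (\<lambda>r. (\<lambda>(C, r). q C r) (C, r))"
      by (rule continuous_on_compose2[OF contq]) (auto intro!: continuous_intros)
    then show ?thesis by simp
  qed
  have cJ: "continuous_on UNIV J"
    unfolding J_def using integral_continuous_on_param[of UNIV a b q] contq by (simp add: cbox_interval)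
  have ret: "returns_to_zero p (Fp_fun n a d C) a b \<longleftrightarrow> J C = 0" for C
  proof -
    have "(LBINT \<rho>=ereal a..ereal b. slope p (Fp_fun n a d C \<rho> * \<rho>)) = (LBINT \<rho>=ereal a..ereal b. q C \<rho>)"
    proof (rule interval_integral_cong)
      fix \<rho> assume "\<rho> \<in> einterval (min (ereal a) (ereal b)) (max (ereal a) (ereal b))"
      then have \<rho>: "a \<le> \<rho>" "\<rho> \<le> b" using ab by (auto simp: einterval_def min_def max_def split: if_splits)
      have rn: "\<rho> ^ n = \<rho> ^ (n - 1) * \<rho>" using n by (metis power_minus_mult)
      have "(LBINT x=ereal a..ereal \<rho>. ?h x) = m \<rho>"
        unfolding m_def using \<rho> ab by (intro LBINT_integral continuous_on_subset[OF ch]) auto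
      then have "Fp_fun n a d C \<rho> = (C * a ^ n - m \<rho>) / \<rho> ^ n"
        unfolding Fp_fun_def by (simp add: diff_divide_distrib)
      then show "slope p (Fp_fun n a d C \<rho> * \<rho>) = q C \<rho>" using \<rho> ab by (simp add: q_def rn)
    qed
    also have "\<dots> = J C" unfolding J_def using ab cq by (intro LBINT_integral) auto
    finally show ?thesis by (simp add: returns_to_zero_def)
  qed
  have spos: "0 < slope p t" if "0 < t" for t using that p by (simp add: slope_def)
  have J0: "J 0 < 0"
  proof -
    have "0 < integral {a..b} (\<lambda>r. - q 0 r)"
    proof (rule integral_pos[OF ab(2)])
      show "continuous_on {a..b} (\<lambda>r. - q 0 r)" by (intro continuous_intros cq)
      fix r assume "a < r" "r < b"
      then show "0 < - q 0 r"
        unfolding q_def using ab mpos[of r] by (simp add: slope_minus[symmetric] spos)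
    qed
    then show ?thesis by (simp add: J_def)
  qed
  have I0: "0 < I" using mI[of b] mpos[of b] ab by auto
  have J1: "0 < J (I / a ^ n)" unfolding J_def
  proof (rule integral_pos[OF ab(2) cq])
    fix r assume "a < r" "r < b"
    then show "0 < q (I / a ^ n) r" unfolding q_def using ab mI[of r] by (intro spos) auto
  qed
  have "\<exists>C\<ge>0. C \<le> I / a ^ n \<and> J C = 0"
    using J0 J1 I0 ab by (intro IVT' continuous_on_subset[OF cJ]) auto
  then obtain C where C: "0 \<le> C" "C \<le> I / a ^ n" "J C = 0" by blast
  then have "C \<noteq> 0" "C \<noteq> I / a ^ n" using J0 J1 by auto
  then show ?thesis using C ret[of C] unfolding I_def by (intro exI[of _ C]) auto
qed

section \<open>Solutions from calibrations\<close>

definition unique_minimizing_solution ::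
  "('a::euclidean_space \<Rightarrow> real) set \<Rightarrow> real \<Rightarrow> 'a set \<Rightarrow> 'a set \<Rightarrow> ('a \<Rightarrow> real) \<Rightarrow> ('a \<Rightarrow> real) \<Rightarrow> bool" where
  "unique_minimizing_solution A p U V f u \<longleftrightarrow> u \<in> A \<and> euler_lagrange_dirichlet p V f u \<and>
     (\<forall>v \<in> A. euler_lagrange_dirichlet p V f v \<longrightarrow> (\<forall>x\<in>closure U. v x = u x)) \<and>
     (\<forall>w \<in> A. energy p U f u \<le> energy p U f w)"

text \<open>A function that is of class $C^1$ on \<open>V\<close> and zero elsewhere is approximated by its cutoffs. Hence it is
  admissible and the calibration criterion applies.\<close>

lemma calibrated_solution:
  fixes O1 O2 :: "'a::euclidean_space" and u f F :: "'a \<Rightarrow> real" and g X :: "'a \<Rightarrow> 'a"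
  assumes U_def: "U = ball O1 R1 \<union> ball O2 R2"
    and V_def: "V = (ball O1 R1 \<union> ball O2 R2) - closure (ball O1 R1 \<inter> ball O2 R2)"
    and p: "p > 2" and cut: "cutoffs V \<eta> d\<eta> C"
    and u: "continuous_on UNIV u" "\<And>x. x \<notin> V \<Longrightarrow> u x = 0"
    and radial: "radial_on (ball O1 R1) O1 u" "radial_on (ball O2 R2) O2 u"
    and g: "\<And>x. x \<in> V \<Longrightarrow> GDERIV u x :> g x" "continuous_on V g" "\<And>x. x \<in> V \<Longrightarrow> norm (g x) \<le> 1"
    and X: "X \<in> borel_measurable borel" "\<And>x. norm (X x) \<le> M"
    and F: "F \<in> borel_measurable borel" "\<And>x. \<bar>F x\<bar> \<le> N"
    and divergence: "\<And>\<psi> d\<psi>. test_function U \<psi> d\<psi> \<Longrightarrow> (LINT x|lborel. X x \<bullet> d\<psi> x) = (LINT x|lborel. F x * \<psi> x)"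
    and X_V: "\<And>x. x \<in> V \<Longrightarrow> X x = p_flux p (g x)" and F_V: "\<And>x. x \<in> V \<Longrightarrow> F x = f x"
    and f: "(\<lambda>x. indicator U x * f x) \<in> borel_measurable borel" "\<And>x. x \<in> U \<Longrightarrow> \<bar>f x\<bar> \<le> N"
  shows "unique_minimizing_solution (admissible O1 R1 O2 R2) p U V f u"
proof -
  define Z where "Z = ball O1 R1 \<inter> ball O2 R2"
  have V_eq: "V = U - closure Z" by (simp add: U_def V_def Z_def)
  have U: "open U" "bounded U" by (auto simp: U_def)
  have V: "open V" "V \<subseteq> U" "bounded V" using U unfolding V_eq by (auto intro: open_Diff bounded_subset)
  have Z: "open Z" "Z \<subseteq> U" "Z \<inter> V = {}" unfolding V_eq using closure_subset[of Z] by (auto simp: Z_def U_def)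
  have "U - V - Z \<subseteq> frontier Z" unfolding V_eq frontier_def using Z(1) by (auto simp: interior_open)
  moreover have "negligible (frontier Z)" unfolding Z_def by (intro negligible_convex_frontier convex_Int) auto
  ultimately have N0: "negligible (U - V - Z)" by (rule negligible_subset[rotated])
  define h where "h = (\<lambda>x. indicator V x *\<^sub>R g x)"
  have uV: "indicator V x * u x = u x" for x using u(2)[of x] by (cases "x \<in> V") auto
  have fr: "u x = 0" if "x \<in> frontier V" for x
    using that u(2) V(1) by (auto simp: frontier_def interior_open)
  have hm: "h \<in> borel_measurable lebesgue"
    unfolding h_def using V(1) g(2) by (intro lebesgue_measurable_borel borel_measurable_continuous_on_indicator) auto
  have hb: "norm (h x) \<le> 1" for x using g(3)[of x] by (auto simp: h_def indicator_def)
  have "set_integrable lebesgue V g"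
    by (rule set_integrable_bounded_lebesgue[where B=1]) (use hm V g(3) in \<open>auto simp: h_def\<close>)
  then have hi: "integrable lebesgue (\<lambda>x. indicator V x *\<^sub>R g x)" by (simp add: set_integrable_def)
  have T: "test_function V (\<eta> k) (d\<eta> k)" for k using cut unfolding cutoffs_def by blast
  have "zero_trace V (\<lambda>x. indicator V x * u x) (\<lambda>x. indicator V x *\<^sub>R g x)"
  proof (rule zero_trace_from_cutoffs[OF V(1) V(3) cut _ fr hi])
    show "continuous_on (closure V) u" using u(1) continuous_on_subset by blast
    fix k
    have "zero_trace V (\<lambda>x. if x \<in> V then \<eta> k x * u x else 0) (\<lambda>x. if x \<in> V then \<eta> k x *\<^sub>R g x + u x *\<^sub>R d\<eta> k x else 0)"
      by (rule zero_trace_test[OF test_function_mult[OF T V(1) g(1,2)]])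
    moreover have "(\<lambda>x. if x \<in> V then \<eta> k x * u x else 0) = (\<lambda>x. \<eta> k x * (indicator V x * u x))"
      "(\<lambda>x. if x \<in> V then \<eta> k x *\<^sub>R g x + u x *\<^sub>R d\<eta> k x else 0)
       = (\<lambda>x. \<eta> k x *\<^sub>R indicator V x *\<^sub>R g x + (indicator V x * u x) *\<^sub>R d\<eta> k x)"
      by (auto simp: fun_eq_iff)
    ultimately show "zero_trace V (\<lambda>x. \<eta> k x * (indicator V x * u x))
       (\<lambda>x. \<eta> k x *\<^sub>R indicator V x *\<^sub>R g x + (indicator V x * u x) *\<^sub>R d\<eta> k x)" by simp
  qed
  then have zV: "zero_trace V u h" unfolding uV h_def .
  have zU: "zero_trace U u h" by (rule zero_trace_mono[OF zV V(2)])
  have wg: "weak_gradient U u h" by (rule zero_trace_weak_gradient[OF zU])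
  have W011: "u \<in> W011 U"
  proof (rule zero_trace_W011[OF zU U(1)])
    fix x assume "x \<notin> U"
    then have "x \<notin> V" using V(2) by blast
    then show "u x = 0" "h x = 0" by (simp_all add: u(2) h_def)
  qed
  have "compact (closure U)" using U(2) by simp
  then have "bounded (u ` closure U)"
    using u(1) by (intro compact_imp_bounded compact_continuous_image continuous_on_subset[OF u(1)]) auto
  then obtain B where B: "\<And>x. x \<in> closure U \<Longrightarrow> \<bar>u x\<bar> \<le> B" unfolding bounded_iff by auto
  have W1: "u \<in> W1_inf U"
  proof -
    have "\<bar>u x\<bar> \<le> max B 1 \<and> norm (h x) \<le> max B 1" if "x \<in> U" for x
      using B[of x] hb[of x] that closure_subset[of U] by (auto simp: le_max_iff_disj)
    then show ?thesis unfolding W1_inf_def using wg by (auto intro!: exI[of _ h] exI[of _ "max B 1"])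
  qed
  have "AE x\<in>U in lebesgue. h x = wgrad U u x"
    by (rule weak_gradient_unique[OF U(1) wg weak_gradient_wgrad[OF wg] refl])
  then have sl: "AE x\<in>U in lebesgue. norm (wgrad U u x) \<le> 1"
    by eventually_elim (use hb in metis)
  have u0: "u x = 0" if "x \<in> closure Z" for x using that u(2) unfolding V_eq by blast
  have uA: "u \<in> admissible O1 R1 O2 R2"
    unfolding admissible_def Let_def U_def[symmetric] Z_def[symmetric] W01_inf_def
    using W1 W011 sl radial u0 continuous_on_subset[OF u(1)] by auto
  have adm: "w \<in> W011 U" "continuous_on (closure U) w" "AE x\<in>U in lebesgue. norm (wgrad U w x) \<le> 1"
      "\<And>x. x \<in> U - V \<Longrightarrow> w x = 0" if "w \<in> admissible O1 R1 O2 R2" for w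
    using that unfolding admissible_def Let_def U_def[symmetric] Z_def[symmetric] W01_inf_def V_eq by blast+
  have leb: "(LINT x|lebesgue. X x \<bullet> d\<psi> x) = (LINT x|lebesgue. F x * \<psi> x)" if T: "test_function U \<psi> d\<psi>" for \<psi> d\<psi>
  proof -
    note [measurable] = test_function_continuous(3,4)[OF T] X(1) F(1)
    have "(LINT x|lebesgue. X x \<bullet> d\<psi> x) = (LINT x|lborel. X x \<bullet> d\<psi> x)" by (rule integral_completion) measurable
    also have "\<dots> = (LINT x|lborel. F x * \<psi> x)" by (rule divergence[OF T])
    also have "\<dots> = (LINT x|lebesgue. F x * \<psi> x)" by (rule integral_completion[symmetric]) measurable
    finally show ?thesis .
  qed
  interpret cal: calibration p U V Z "admissible O1 R1 O2 R2" u h X f F M N C \<eta> d\<eta>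
  proof
    show "X x = p_flux p (h x)" if "x \<in> V" for x using X_V[OF that] that by (simp add: h_def)
  qed (use p U V Z N0 adm cut uA wg fr hb X F leb F_V f in \<open>auto intro: lebesgue_measurable_borel\<close>)
  show ?thesis unfolding unique_minimizing_solution_def using uA cal.solution cal.unique cal.minimal by blast
qed

text \<open>A test function on the union of two disjoint open sets is a sum of test functions on them, because
  its compact support splits into two compact pieces. So ray fields with different centres can be
  placed side by side.\<close>

lemma ray_field_cut_divergence:
  fixes \<psi> :: "'a::euclidean_space \<Rightarrow> real"
  assumes T: "test_function (V \<union> W) \<psi> d\<psi>" and VW: "open V" "open W" "V \<inter> W = {}"
    and F: "F \<in> borel_measurable borel" "\<And>x. \<bar>F x\<bar> \<le> M"
  shows "(LINT x|lborel. (indicator V x *\<^sub>R ray_field c F x) \<bullet> d\<psi> x) = (LINT x|lborel. (indicator V x * F x) * \<psi> x)"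
proof -
  obtain K where K: "compact K" "K \<subseteq> V \<union> W" "\<And>x. x \<notin> K \<Longrightarrow> \<psi> x = 0" "\<And>x. x \<notin> K \<Longrightarrow> d\<psi> x = 0"
    using T by (rule test_functionE) blast
  have D: "\<And>x. GDERIV \<psi> x :> d\<psi> x" "continuous_on UNIV d\<psi>" using T unfolding test_function_def by blast+
  let ?\<psi> = "\<lambda>x. if x \<in> V then \<psi> x else 0" and ?d = "\<lambda>x. if x \<in> V then d\<psi> x else 0"
  have "K - W = K \<inter> V" using K(2) VW(3) by blast
  then have KV: "compact (K \<inter> V)" using compact_diff[OF K(1) VW(2)] by simp
  have op: "open (- (K \<inter> V))" using KV compact_imp_closed by blast
  have "test_function V ?\<psi> ?d" unfolding test_function_def
  proof (intro conjI allI exI)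
    show "GDERIV ?\<psi> x :> ?d x" for x
    proof (cases "x \<in> V")
      case True
      have "GDERIV ?\<psi> x :> d\<psi> x" by (rule GDERIV_transform_open[OF D(1) VW(1) True]) auto
      then show ?thesis using True by simp
    next
      case False
      have "GDERIV ?\<psi> x :> 0"
        by (rule GDERIV_transform_open[OF GDERIV_const op, of _ 0]) (use False K(3) in auto)
      then show ?thesis using False by simp
    qed
    have "continuous_on (V \<union> - (K \<inter> V)) ?d"
    proof (rule continuous_on_open_Un[OF VW(1) op])
      show "continuous_on V ?d" by (rule continuous_on_eq[OF continuous_on_subset[OF D(2)]]) auto
      show "continuous_on (- (K \<inter> V)) ?d"
        by (rule continuous_on_eq[OF continuous_on_const[of _ 0]]) (use K(4) in auto)
    qed
    moreover have "V \<union> - (K \<inter> V) = UNIV" by blast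
    ultimately show "continuous_on UNIV ?d" by simp
    show "compact (K \<inter> V)" by (rule KV)
  qed (use K(3) in auto)
  from ray_field_divergence[OF this F, of c]
  have "(LINT x|lborel. ray_field c F x \<bullet> ?d x) = (LINT x|lborel. F x * ?\<psi> x)" .
  moreover have "ray_field c F x \<bullet> ?d x = (indicator V x *\<^sub>R ray_field c F x) \<bullet> d\<psi> x" for x by simp
  moreover have "F x * ?\<psi> x = (indicator V x * F x) * \<psi> x" for x by simp
  ultimately show ?thesis by simp
qed

lemma cutoffs_union:
  fixes V W :: "'a::euclidean_space set"
  assumes V: "cutoffs V \<eta> d\<eta> C" and W: "cutoffs W \<theta> d\<theta> D" and op: "open V" "open W" and dis: "V \<inter> W = {}"
  shows "cutoffs (V \<union> W) (\<lambda>k x. \<eta> k x + \<theta> k x) (\<lambda>k x. d\<eta> k x + d\<theta> k x) (C + D)"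
proof -
  have TV: "\<And>k. test_function V (\<eta> k) (d\<eta> k)" and bV: "\<And>k x. 0 \<le> \<eta> k x \<and> \<eta> k x \<le> 1"
    and eV: "\<And>K. compact K \<Longrightarrow> K \<subseteq> V \<Longrightarrow> \<forall>\<^sub>F k in sequentially. \<forall>x\<in>K. \<eta> k x = 1 \<and> d\<eta> k x = 0"
    and tV: "\<And>k. (LINT x|lebesgue. norm (d\<eta> k x)) \<le> C"
    using V unfolding cutoffs_def by auto
  have TW: "\<And>k. test_function W (\<theta> k) (d\<theta> k)" and bW: "\<And>k x. 0 \<le> \<theta> k x \<and> \<theta> k x \<le> 1"
    and eW: "\<And>K. compact K \<Longrightarrow> K \<subseteq> W \<Longrightarrow> \<forall>\<^sub>F k in sequentially. \<forall>x\<in>K. \<theta> k x = 1 \<and> d\<theta> k x = 0"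
    and tW: "\<And>k. (LINT x|lebesgue. norm (d\<theta> k x)) \<le> D"
    using W unfolding cutoffs_def by auto
  have T: "test_function (V \<union> W) (\<lambda>x. \<eta> k x + \<theta> k x) (\<lambda>x. d\<eta> k x + d\<theta> k x)" for k
  proof -
    obtain K where K: "compact K" "K \<subseteq> V" "\<And>x. x \<notin> K \<Longrightarrow> \<eta> k x = 0" using TV by (rule test_functionE) blast
    obtain L where L: "compact L" "L \<subseteq> W" "\<And>x. x \<notin> L \<Longrightarrow> \<theta> k x = 0" using TW by (rule test_functionE) blast
    have D: "\<And>x. GDERIV (\<eta> k) x :> d\<eta> k x" "continuous_on UNIV (d\<eta> k)"
      "\<And>x. GDERIV (\<theta> k) x :> d\<theta> k x" "continuous_on UNIV (d\<theta> k)"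
      using TV TW unfolding test_function_def by blast+
    show ?thesis unfolding test_function_def
    proof (intro conjI allI exI)
      show "GDERIV (\<lambda>x. \<eta> k x + \<theta> k x) x :> d\<eta> k x + d\<theta> k x" for x by (intro GDERIV_add D)
      show "continuous_on UNIV (\<lambda>x. d\<eta> k x + d\<theta> k x)" by (intro continuous_intros D)
      show "compact (K \<union> L)" by (intro compact_Un K L)
    qed (use K L in auto)
  qed
  have b: "0 \<le> \<eta> k x + \<theta> k x \<and> \<eta> k x + \<theta> k x \<le> 1" for k x
  proof (cases "x \<in> V")
    case True
    then have "x \<notin> W" using dis by blast
    then show ?thesis using bV[of k x] test_function_vanishes(1)[OF TW, of x k] by simp
  next
    case False
    then show ?thesis using bW[of k x] test_function_vanishes(1)[OF TV, of x k] by simp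
  qed
  have ev: "\<forall>\<^sub>F k in sequentially. \<forall>x\<in>K. \<eta> k x + \<theta> k x = 1 \<and> d\<eta> k x + d\<theta> k x = 0"
    if K: "compact K" "K \<subseteq> V \<union> W" for K
  proof -
    have "compact (K - W)" "compact (K - V)" "K - W \<subseteq> V" "K - V \<subseteq> W"
      using K op by (auto intro: compact_diff)
    then have "\<forall>\<^sub>F k in sequentially. \<forall>x\<in>K - W. \<eta> k x = 1 \<and> d\<eta> k x = 0"
      "\<forall>\<^sub>F k in sequentially. \<forall>x\<in>K - V. \<theta> k x = 1 \<and> d\<theta> k x = 0"
      using eV[of "K - W"] eW[of "K - V"] by blast+
    then show ?thesis
    proof eventually_elim
      case (elim k)
      show ?case
      proof
        fix x assume x: "x \<in> K"
        show "\<eta> k x + \<theta> k x = 1 \<and> d\<eta> k x + d\<theta> k x = 0"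
        proof (cases "x \<in> W")
          case True
          then have "x \<notin> V" using dis by blast
          then show ?thesis using elim(2) x test_function_vanishes[OF TV, of x k] by auto
        next
          case False
          then show ?thesis using elim(1) x test_function_vanishes[OF TW, of x k] by auto
        qed
      qed
    qed
  qed
  have tv: "(LINT x|lebesgue. norm (d\<eta> k x + d\<theta> k x)) \<le> C + D" for k
  proof -
    note i = test_function_integrable_lebesgue(2)[OF TV, of k] test_function_integrable_lebesgue(2)[OF TW, of k]
    have "(LINT x|lebesgue. norm (d\<eta> k x + d\<theta> k x)) \<le> (LINT x|lebesgue. norm (d\<eta> k x) + norm (d\<theta> k x))"
      using i by (intro Bochner_Integration.integral_mono) (auto intro: norm_triangle_ineq)
    also have "\<dots> = (LINT x|lebesgue. norm (d\<eta> k x)) + (LINT x|lebesgue. norm (d\<theta> k x))" using i by simp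
    also have "\<dots> \<le> C + D" by (rule add_mono[OF tV tW])
    finally show ?thesis .
  qed
  show ?thesis unfolding cutoffs_def using T b ev tv by blast
qed

lemma shell_cutoffs_radius:
  fixes c :: "'a::euclidean_space"
  assumes "0 < a" "0 < b"
  shows "\<exists>\<eta> d\<eta> C. cutoffs {x. a < dist c x \<and> dist c x < b} \<eta> d\<eta> C"
proof -
  have "{x. a < dist c x \<and> dist c x < b} = {x. a\<^sup>2 < (dist c x)\<^sup>2 \<and> (dist c x)\<^sup>2 < b\<^sup>2}"
  proof -
    have "a\<^sup>2 < (dist c x)\<^sup>2 \<longleftrightarrow> a < dist c x" "(dist c x)\<^sup>2 < b\<^sup>2 \<longleftrightarrow> dist c x < b" for x
      using assms abs_le_square_iff[of "dist c x" a] abs_le_square_iff[of b "dist c x"] by (simp_all add: not_le[symmetric])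
    then show ?thesis by simp
  qed
  then show ?thesis using shell_cutoffs[of "a\<^sup>2" "b\<^sup>2" c] assms by simp
qed

lemma ball_cutoffs:
  fixes c :: "'a::euclidean_space"
  assumes "0 < b"
  shows "\<exists>\<eta> d\<eta> C. cutoffs (ball c b) \<eta> d\<eta> C"
proof -
  have neg: "(-1::real) < (dist c x)\<^sup>2" for x by (rule less_le_trans[of _ 0]) auto
  have "ball c b = {x. -1 < (dist c x)\<^sup>2 \<and> (dist c x)\<^sup>2 < b\<^sup>2}"
  proof -
    have "(dist c x)\<^sup>2 < b\<^sup>2 \<longleftrightarrow> dist c x < b" for x
      using assms abs_le_square_iff[of b "dist c x"] by (simp add: not_le[symmetric])
    then show ?thesis using neg by (simp add: ball_def)
  qed
  then show ?thesis using shell_cutoffs[of "-1" "b\<^sup>2" c] assms by simp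
qed

section \<open>Concentric balls\<close>

text \<open>Here one ray field is used on the whole larger ball: its source on the inner ball, where admissible
  functions vanish, is free. The potential is continued by the constant \<open>0\<close> on both sides of the shell.\<close>

lemma annulus_solution:
  fixes c :: "'a::euclidean_space"
  assumes p: "p > 2" and ab: "0 < a" "a < b" and R: "(R1 = b \<and> R2 = a) \<or> (R1 = a \<and> R2 = b)"
    and k: "k \<in> borel_measurable borel" "\<And>r. \<bar>k r\<bar> \<le> N"
    and H1: "\<And>r. a < r \<Longrightarrow> r < b \<Longrightarrow> \<bar>radial_flux DIM('a) k r\<bar> \<le> 1"
    and zero: "potential (\<lambda>r. slope p (radial_flux DIM('a) k r)) a b = 0"
    and U: "U = ball c R1 \<union> ball c R2" and V: "V = (ball c R1 \<union> ball c R2) - closure (ball c R1 \<inter> ball c R2)"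
    and f: "(\<lambda>x. indicator U x * f x) \<in> borel_measurable borel" "\<And>x. x \<in> U \<Longrightarrow> \<bar>f x\<bar> \<le> N"
    and fk: "\<And>x. a < dist c x \<Longrightarrow> dist c x < b \<Longrightarrow> f x = k (dist c x)"
  shows "\<exists>u. unique_minimizing_solution (admissible c R1 c R2) p U V f u \<and>
      (\<forall>x. dist c x \<in> {a..b} \<longrightarrow> u x = potential (\<lambda>r. slope p (radial_flux DIM('a) k r)) a (dist c x))"
proof -
  interpret S: radial_source p N a c k using p k by unfold_locales
  define u where "u = (\<lambda>x. S.\<phi> (min b (max a (dist c x))))"
  have sub: "ball c a \<subseteq> ball c b" using ab by (intro subset_ball) simp
  have Ub: "U = ball c b" using R sub unfolding U by blast
  have "ball c R1 \<inter> ball c R2 = ball c a" using R sub by blast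
  then have Vb: "V = {x. a < dist c x \<and> dist c x < b}" unfolding V U[symmetric] Ub using ab by (auto simp: closure_ball)
  have \<phi>0: "S.\<phi> a = 0" "S.\<phi> b = 0" using zero S.\<phi>_base by (simp_all add: S.\<phi>_def S.s_def[abs_def])
  obtain \<eta> d\<eta> C where cut: "cutoffs V \<eta> d\<eta> C" using shell_cutoffs_radius[of a b c] ab unfolding Vb by auto
  have "unique_minimizing_solution (admissible c R1 c R2) p U V f u"
  proof -
    have 1: "continuous_on UNIV u" unfolding u_def by (intro S.continuous_\<phi> continuous_intros)
    have 2: "u x = 0" if "x \<notin> V" for x
    proof -
      have "min b (max a (dist c x)) = a \<or> min b (max a (dist c x)) = b"
        using that ab unfolding Vb by (auto simp: min_def max_def)
      then show ?thesis unfolding u_def using \<phi>0 by metis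
    qed
    have 3: "radial_on S c u" for S unfolding radial_on_def u_def by simp
    have oV: "open V" unfolding V by (intro open_Diff) auto
    have 4: "GDERIV u x :> S.grad x" if "x \<in> V" for x
      by (rule GDERIV_transform_open[OF S.GDERIV_\<phi> oV that]) (use ab in \<open>simp add: Vb u_def\<close>)
    have 5: "norm (S.grad x) \<le> 1" if "x \<in> V" for x
      using that H1 by (intro S.norm_grad) (simp add: Vb)
    have 6: "(LINT x|lborel. S.field b x \<bullet> d\<psi> x) = (LINT x|lborel. S.F x * \<psi> x)" if T: "test_function U \<psi> d\<psi>" for \<psi> d\<psi>
    proof -
      have "S.field b x \<bullet> d\<psi> x = ray_field c S.F x \<bullet> d\<psi> x" for x
        using test_function_vanishes(2)[OF T, of x] by (cases "x \<in> U") (auto simp: S.field_def Ub)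
      then show ?thesis using ray_field_divergence[OF T S.F_measurable S.F_bound, of c] by simp
    qed
    have 7: "S.field b x = p_flux p (S.grad x)" if "x \<in> V" for x
      using that by (intro S.p_flux_grad[symmetric]) (simp add: Vb)
    have 8: "S.F x = f x" if "x \<in> V" for x using that fk[of x] unfolding Vb by (simp add: S.F_def)
    have b: "0 < b" using ab by simp
    show ?thesis
      by (rule calibrated_solution[OF U V p cut 1 2 3[of "ball c R1"] 3[of "ball c R2"] 4 S.continuous_grad 5
        S.field_measurable S.field_bound[OF b] S.F_measurable S.F_bound 6 7 8 f])
  qed
  moreover have "u x = potential (\<lambda>r. slope p (radial_flux DIM('a) k r)) a (dist c x)" if "dist c x \<in> {a..b}" for x
    using that by (simp add: u_def S.\<phi>_def S.s_def[abs_def])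
  ultimately show ?thesis by blast
qed

section \<open>Disjoint balls\<close>

text \<open>Each ball carries its own ray field, cut off at its sphere; each potential is continued by \<open>0\<close>. Where
  the balls touch, both potentials vanish, so that the sum is continuous.\<close>

lemma disjoint_solution:
  fixes c1 c2 :: "'a::euclidean_space"
  assumes p: "p > 2" and R: "0 < R1" "0 < R2" and dis: "ball c1 R1 \<inter> ball c2 R2 = {}"
    and k1: "k1 \<in> borel_measurable borel" "\<And>r. \<bar>k1 r\<bar> \<le> N"
    and k2: "k2 \<in> borel_measurable borel" "\<And>r. \<bar>k2 r\<bar> \<le> N"
    and H1: "\<And>r. 0 < r \<Longrightarrow> r < R1 \<Longrightarrow> \<bar>radial_flux DIM('a) k1 r\<bar> \<le> 1"
    and H2: "\<And>r. 0 < r \<Longrightarrow> r < R2 \<Longrightarrow> \<bar>radial_flux DIM('a) k2 r\<bar> \<le> 1"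
    and U: "U = ball c1 R1 \<union> ball c2 R2" and V: "V = (ball c1 R1 \<union> ball c2 R2) - closure (ball c1 R1 \<inter> ball c2 R2)"
    and f: "(\<lambda>x. indicator U x * f x) \<in> borel_measurable borel" "\<And>x. x \<in> U \<Longrightarrow> \<bar>f x\<bar> \<le> N"
    and f1: "\<And>x. x \<in> ball c1 R1 \<Longrightarrow> f x = k1 (dist c1 x)"
    and f2: "\<And>x. x \<in> ball c2 R2 \<Longrightarrow> f x = k2 (dist c2 x)"
  shows "\<exists>u. unique_minimizing_solution (admissible c1 R1 c2 R2) p U V f u \<and>
      (\<forall>x\<in>cball c1 R1. u x = potential (\<lambda>r. slope p (radial_flux DIM('a) k1 r)) R1 (dist c1 x)) \<and>
      (\<forall>x\<in>cball c2 R2. u x = potential (\<lambda>r. slope p (radial_flux DIM('a) k2 r)) R2 (dist c2 x))"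
proof -
  let ?B1 = "ball c1 R1" and ?B2 = "ball c2 R2"
  interpret S1: radial_source p N R1 c1 k1 using p k1 by unfold_locales
  interpret S2: radial_source p N R2 c2 k2 using p k2 by unfold_locales
  define u1 u2 where "u1 = (\<lambda>x. S1.\<phi> (min R1 (dist c1 x)))" and "u2 = (\<lambda>x. S2.\<phi> (min R2 (dist c2 x)))"
  define u where "u = (\<lambda>x. u1 x + u2 x)"
  define g where "g = (\<lambda>x. if x \<in> ?B1 then S1.grad x else S2.grad x)"
  have VU: "V = U" unfolding V U dis by simp
  have cl: "closure ?B1 \<inter> ?B2 = {}" "?B1 \<inter> closure ?B2 = {}"
    using dis open_Int_closure_eq_empty[of ?B2 ?B1] open_Int_closure_eq_empty[of ?B1 ?B2] by (auto simp: Int_commute)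
  have u1_0: "u1 x = 0" if "x \<notin> ?B1" for x using that S1.\<phi>_base by (simp add: u1_def)
  have u2_0: "u2 x = 0" if "x \<notin> ?B2" for x using that S2.\<phi>_base by (simp add: u2_def)
  have u_1: "u x = S1.\<phi> (dist c1 x)" if "x \<in> cball c1 R1" for x
  proof -
    have "x \<notin> ?B2" using that cl(1) R by (auto simp: closure_ball)
    then show ?thesis using that u2_0[of x] by (simp add: u_def u1_def)
  qed
  have u_2: "u x = S2.\<phi> (dist c2 x)" if "x \<in> cball c2 R2" for x
  proof -
    have "x \<notin> ?B1" using that cl(2) R by (auto simp: closure_ball)
    then show ?thesis using that u1_0[of x] by (simp add: u_def u2_def)
  qed
  have one: "(x \<in> ?B1 \<and> x \<notin> ?B2) \<or> (x \<in> ?B2 \<and> x \<notin> ?B1)" if "x \<in> V" for x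
    using that[unfolded VU U] dis by blast
  obtain \<eta> d\<eta> C where cut1: "cutoffs ?B1 \<eta> d\<eta> C" using ball_cutoffs[OF R(1)] by blast
  obtain \<theta> d\<theta> D where cut2: "cutoffs ?B2 \<theta> d\<theta> D" using ball_cutoffs[OF R(2)] by blast
  have cut: "cutoffs V (\<lambda>k x. \<eta> k x + \<theta> k x) (\<lambda>k x. d\<eta> k x + d\<theta> k x) (C + D)"
    unfolding VU U by (rule cutoffs_union[OF cut1 cut2 open_ball open_ball dis])
  define X where "X = (\<lambda>x. S1.field R1 x + S2.field R2 x)"
  define F where "F = (\<lambda>x. indicator ?B1 x * S1.F x + indicator ?B2 x * S2.F x)"
  have "unique_minimizing_solution (admissible c1 R1 c2 R2) p U V f u"
  proof -
    have 1: "continuous_on UNIV u" unfolding u_def u1_def u2_def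
      by (intro continuous_on_add S1.continuous_\<phi> S2.continuous_\<phi> continuous_intros)
    have 2: "u x = 0" if "x \<notin> V" for x
      using that u1_0[of x] u2_0[of x] by (simp add: VU U u_def)
    have 3: "radial_on ?B1 c1 u" "radial_on ?B2 c2 u" unfolding radial_on_def using u_1 u_2 by simp_all
    have 4: "GDERIV u x :> g x" if "x \<in> V" for x
      using one[OF that]
    proof (elim disjE conjE)
      assume x: "x \<in> ?B1"
      have "GDERIV u x :> S1.grad x"
        by (rule GDERIV_transform_open[OF S1.GDERIV_\<phi> open_ball x]) (simp add: u_1)
      then show ?thesis using x by (simp add: g_def)
    next
      assume x: "x \<in> ?B2" "x \<notin> ?B1"
      have "GDERIV u x :> S2.grad x"
        by (rule GDERIV_transform_open[OF S2.GDERIV_\<phi> open_ball x(1)]) (simp add: u_2)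
      then show ?thesis using x by (simp add: g_def)
    qed
    have "continuous_on ?B1 g" by (rule continuous_on_eq[OF S1.continuous_grad]) (simp add: g_def)
    moreover have "continuous_on ?B2 g"
      by (rule continuous_on_eq[OF S2.continuous_grad]) (use dis in \<open>auto simp: g_def simp del: mem_ball\<close>)
    ultimately have 5: "continuous_on V g" unfolding VU U by (rule continuous_on_open_Un[OF open_ball open_ball])
    have 6: "norm (g x) \<le> 1" if "x \<in> V" for x
      using one[OF that] H1 H2 unfolding g_def
      by (auto intro!: S1.norm_grad S2.norm_grad)
    have 7: "X \<in> borel_measurable borel" unfolding X_def
      by (intro borel_measurable_add S1.field_measurable S2.field_measurable)
    have 8: "norm (X x) \<le> N * R1 + N * R2" for x
      unfolding X_def by (intro norm_triangle_mono S1.field_bound S2.field_bound R)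
    have Fm: "F \<in> borel_measurable borel" unfolding F_def
      using S1.F_measurable S2.F_measurable
      by (intro borel_measurable_add borel_measurable_times borel_measurable_indicator) auto
    have 9: "\<bar>F x\<bar> \<le> N" for x
    proof -
      have "\<not> (x \<in> ?B1 \<and> x \<in> ?B2)" using dis by blast
      then show ?thesis using S1.F_bound[of x] S2.F_bound[of x] S1.N_nonneg
        by (auto simp: F_def indicator_def simp del: mem_ball)
    qed
    have 10: "(LINT x|lborel. X x \<bullet> d\<psi> x) = (LINT x|lborel. F x * \<psi> x)" if T: "test_function U \<psi> d\<psi>" for \<psi> d\<psi>
    proof -
      have iX: "integrable lborel (\<lambda>x. S1.field R1 x \<bullet> d\<psi> x)" "integrable lborel (\<lambda>x. S2.field R2 x \<bullet> d\<psi> x)"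
        using S1.field_measurable S2.field_measurable test_function_integrable(2)[OF T]
        by (auto intro!: integrable_bounded_inner AE_I2 S1.field_bound S2.field_bound R)
      have iF: "integrable lborel (\<lambda>x. indicator ?B1 x * S1.F x * \<psi> x)" "integrable lborel (\<lambda>x. indicator ?B2 x * S2.F x * \<psi> x)"
        by (rule test_function_integrable(3)[OF T, of _ N];
            use S1.F_measurable S2.F_measurable S1.F_bound S2.F_bound S1.N_nonneg
            in \<open>auto simp: indicator_def intro!: borel_measurable_times borel_measurable_indicator\<close>)+
      have T2: "test_function (?B2 \<union> ?B1) \<psi> d\<psi>" using T by (simp add: U Un_commute)
      have dis2: "?B2 \<inter> ?B1 = {}" using dis by blast
      have "(LINT x|lborel. X x \<bullet> d\<psi> x) = (LINT x|lborel. S1.field R1 x \<bullet> d\<psi> x) + (LINT x|lborel. S2.field R2 x \<bullet> d\<psi> x)"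
        unfolding X_def inner_add_left by (rule Bochner_Integration.integral_add[OF iX])
      also have "(LINT x|lborel. S1.field R1 x \<bullet> d\<psi> x) = (LINT x|lborel. indicator ?B1 x * S1.F x * \<psi> x)"
        unfolding S1.field_def by (rule ray_field_cut_divergence[OF T[unfolded U] open_ball open_ball dis S1.F_measurable S1.F_bound])
      also have "(LINT x|lborel. S2.field R2 x \<bullet> d\<psi> x) = (LINT x|lborel. indicator ?B2 x * S2.F x * \<psi> x)"
        unfolding S2.field_def by (rule ray_field_cut_divergence[OF T2 open_ball open_ball dis2 S2.F_measurable S2.F_bound])
      also have "(LINT x|lborel. indicator ?B1 x * S1.F x * \<psi> x) + (LINT x|lborel. indicator ?B2 x * S2.F x * \<psi> x)
          = (LINT x|lborel. F x * \<psi> x)"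
        unfolding F_def distrib_right by (rule Bochner_Integration.integral_add[OF iF, symmetric])
      finally show ?thesis .
    qed
    have 11: "X x = p_flux p (g x)" if "x \<in> V" for x
      using one[OF that]
    proof (elim disjE conjE)
      assume x: "x \<in> ?B1" "x \<notin> ?B2"
      then show ?thesis using S1.p_flux_grad[OF x(1)] by (simp add: X_def g_def S2.field_def)
    next
      assume x: "x \<in> ?B2" "x \<notin> ?B1"
      then show ?thesis using S2.p_flux_grad[OF x(1)] by (simp add: X_def g_def S1.field_def)
    qed
    have 12: "F x = f x" if "x \<in> V" for x
      using one[OF that] by (elim disjE conjE) (simp_all add: F_def S1.F_def S2.F_def f1 f2)
    show ?thesis
      by (rule calibrated_solution[OF U V p cut 1 2 3 4 5 6 7 8 Fm 9 10 11 12 f])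
  qed
  then show ?thesis using u_1 u_2 by (auto simp: S1.\<phi>_def S1.s_def[abs_def] S2.\<phi>_def S2.s_def[abs_def])
qed

section \<open>The two configurations\<close>

lemma radial_density:
  fixes c :: "'a::euclidean_space" and G :: "'a \<Rightarrow> real"
  assumes R: "0 < R" and G: "continuous_on (closure (ball c R)) G"
    and d: "\<And>x. x \<in> closure (ball c R) \<Longrightarrow> G x = d (dist c x)"
  shows "continuous_on {0..R} d"
    and "\<exists>N. \<forall>r\<in>{0..R}. \<bar>d r\<bar> \<le> N"
    and "(\<And>x. x \<in> ball c R \<Longrightarrow> 0 < G x) \<Longrightarrow> 0 \<le> r \<Longrightarrow> r < R \<Longrightarrow> 0 < d r"
    and "(LINT x:ball c R|lebesgue. G x) = 1 \<Longrightarrow> radial_mass DIM('a) d R = inv_sphere_area DIM('a)"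
    and "(\<lambda>x. indicator (ball c R) x * G x) \<in> borel_measurable borel"
proof -
  have cb: "closure (ball c R) = cball c R" using R by (simp add: closure_ball)
  obtain e :: 'a where e: "norm e = 1" using vector_choose_size[of 1] by (metis zero_le_one)
  have de: "dist c (c + r *\<^sub>R e) = r" if "0 \<le> r" for r using that e by (simp add: dist_norm)
  have eq: "G (c + r *\<^sub>R e) = d r" if "r \<in> {0..R}" for r
    using that d[of "c + r *\<^sub>R e"] de[of r] unfolding cb by simp
  have "continuous_on {0..R} (\<lambda>r. G (c + r *\<^sub>R e))"
    by (rule continuous_on_compose2[OF G]) (auto intro!: continuous_intros simp: cb de)
  then show cd: "continuous_on {0..R} d" by (rule continuous_on_eq) (rule eq)
  have "bounded (d ` {0..R})" using cd by (intro compact_imp_bounded compact_continuous_image) auto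
  then show "\<exists>N. \<forall>r\<in>{0..R}. \<bar>d r\<bar> \<le> N" unfolding bounded_iff by auto
  show "0 < d r" if "\<And>x. x \<in> ball c R \<Longrightarrow> 0 < G x" "0 \<le> r" "r < R"
    using that(1)[of "c + r *\<^sub>R e"] that(2,3) de[of r] eq[of r] by simp
  have sub: "ball c R \<subseteq> closure (ball c R)" by (rule closure_subset)
  show "(\<lambda>x. indicator (ball c R) x * G x) \<in> borel_measurable borel"
    using borel_measurable_continuous_on_indicator[OF _ continuous_on_subset[OF G sub]] by simp
  assume one: "(LINT x:ball c R|lebesgue. G x) = 1"
  define k where "k = (\<lambda>r. indicator {0..R} r *\<^sub>R d r)"
  have k: "k \<in> borel_measurable borel" unfolding k_def
    by (rule borel_measurable_continuous_on_indicator[OF _ cd]) simp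
  have "(LINT x:ball c R|lebesgue. G x) = (LINT x:ball c R|lebesgue. k (dist c x))"
    unfolding set_lebesgue_integral_def
    by (intro Bochner_Integration.integral_cong refl) (use d cb in \<open>auto simp: indicator_def k_def\<close>)
  also have "\<dots> = (real DIM('a) * unit_ball_vol (real DIM('a))) * radial_mass DIM('a) k R" by (rule radial_integral[OF k R])
  also have "radial_mass DIM('a) k R = radial_mass DIM('a) d R" by (rule radial_mass_cong) (simp add: k_def)
  finally have "(real DIM('a) * unit_ball_vol (real DIM('a))) * radial_mass DIM('a) d R = 1" using one by simp
  moreover have "inv_sphere_area DIM('a) * (real DIM('a) * unit_ball_vol (real DIM('a))) = 1"
    by (rule inv_sphere_area_eq) simp
  ultimately show "radial_mass DIM('a) d R = inv_sphere_area DIM('a)"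
    by (metis mult.assoc mult.commute mult_1)
qed

lemma net_density_regular:
  fixes O1 O2 :: "'a::euclidean_space"
  assumes R: "0 < R1" "0 < R2"
    and cont: "continuous_on (closure (ball O1 R1)) fplus" "continuous_on (closure (ball O2 R2)) fminus"
    and U: "U = ball O1 R1 \<union> ball O2 R2" and f: "f = net_density (ball O1 R1) (ball O2 R2) fplus fminus"
  shows "(\<lambda>x. indicator U x * f x) \<in> borel_measurable borel" "\<exists>N. \<forall>x. \<bar>f x\<bar> \<le> N"
proof -
  have m: "(\<lambda>x. indicator (ball c R) x * G x) \<in> borel_measurable borel"
    if "continuous_on (closure (ball c R)) G" for c :: 'a and R and G :: "'a \<Rightarrow> real"
    using borel_measurable_continuous_on_indicator[OF _ continuous_on_subset[OF that closure_subset]] by simp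
  have "(\<lambda>x. indicator U x * f x) = (\<lambda>x. indicator (ball O1 R1) x * fplus x - indicator (ball O2 R2) x * fminus x)"
    unfolding U f net_density_def by (auto simp: fun_eq_iff indicator_def)
  then show "(\<lambda>x. indicator U x * f x) \<in> borel_measurable borel"
    using m[OF cont(1)] m[OF cont(2)] by simp
  have b: "\<exists>N. \<forall>x\<in>ball c R. \<bar>G x\<bar> \<le> N" if "continuous_on (closure (ball c R)) G" for c :: 'a and R and G :: "'a \<Rightarrow> real"
  proof -
    have "compact (closure (ball c R))" by simp
    then have "bounded (G ` closure (ball c R))"
      using that by (intro compact_imp_bounded compact_continuous_image)
    then obtain N where "\<And>x. x \<in> closure (ball c R) \<Longrightarrow> \<bar>G x\<bar> \<le> N" unfolding bounded_iff by auto
    then show ?thesis using closure_subset[of "ball c R"] by blast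
  qed
  obtain N1 where N1: "\<And>x. x \<in> ball O1 R1 \<Longrightarrow> \<bar>fplus x\<bar> \<le> N1" using b[OF cont(1)] by blast
  obtain N2 where N2: "\<And>x. x \<in> ball O2 R2 \<Longrightarrow> \<bar>fminus x\<bar> \<le> N2" using b[OF cont(2)] by blast
  have "\<bar>f x\<bar> \<le> \<bar>N1\<bar> + \<bar>N2\<bar>" for x
    using N1[of x] N2[of x] unfolding f net_density_def by (auto simp del: mem_ball)
  then show "\<exists>N. \<forall>x. \<bar>f x\<bar> \<le> N" by blast
qed

lemma in_domain_bound:
  assumes "in_Ep_inv_domain \<Phi> S" "\<rho> \<in> S" "\<Phi> \<rho> * \<rho> = t"
  shows "\<bar>t\<bar> \<le> 1" "(\<Phi> \<rho>)\<^sup>2 * \<rho>\<^sup>2 \<in> {0..1}"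
proof -
  show d: "(\<Phi> \<rho>)\<^sup>2 * \<rho>\<^sup>2 \<in> {0..1}" using assms unfolding in_Ep_inv_domain_def by blast
  then have "t\<^sup>2 \<le> 1" unfolding assms(3)[symmetric] by (simp add: power_mult_distrib)
  then show "\<bar>t\<bar> \<le> 1" by (simp add: abs_square_le_1)
qed

text \<open>The flux on the shell need not vanish on the inner sphere. It is continued into the inner ball as the
  linear field with the constant source \<open>- n * C\<close>, in the definition of \<open>k0\<close>.\<close>

lemma concentric_solution:
  fixes c :: "'a::euclidean_space"
  assumes p: "p > 2" and ab: "0 < a" "a < b" and R: "(R1 = b \<and> R2 = a) \<or> (R1 = a \<and> R2 = b)"
    and d: "continuous_on {a..b} d" and \<sigma>: "\<sigma> = 1 \<or> \<sigma> = -1"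
    and \<Phi>: "\<And>\<rho>. \<Phi> \<rho> = \<sigma> * Fp_fun DIM('a) a d C \<rho>"
    and dom: "in_Ep_inv_domain \<Phi> {a..b}" and ret: "returns_to_zero p \<Phi> a b"
    and U: "U = ball c R1 \<union> ball c R2" and V: "V = (ball c R1 \<union> ball c R2) - closure (ball c R1 \<inter> ball c R2)"
    and f: "(\<lambda>x. indicator U x * f x) \<in> borel_measurable borel" "\<exists>N. \<forall>x. \<bar>f x\<bar> \<le> N"
    and fd: "\<And>x. a < dist c x \<Longrightarrow> dist c x < b \<Longrightarrow> f x = \<sigma> * d (dist c x)"
  shows "\<exists>u. unique_minimizing_solution (admissible c R1 c R2) p U V f u \<and>
      (\<forall>x. dist c x \<in> {a..b} \<longrightarrow> u x = profile p \<Phi> a (dist c x))"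
proof -
  let ?n = "DIM('a)"
  define k0 where "k0 = (\<lambda>r. indicator {..<a} r * (- (real ?n * C)) + indicator {a..b} r *\<^sub>R d r)"
  define k where "k = (\<lambda>r. \<sigma> * k0 r)"
  have k0m: "k0 \<in> borel_measurable borel" unfolding k0_def
    by (intro borel_measurable_add borel_measurable_continuous_on_indicator[OF _ d]) auto
  then have km: "k \<in> borel_measurable borel" unfolding k_def by simp
  obtain N1 where N1: "\<And>x. \<bar>f x\<bar> \<le> N1" using f(2) by blast
  have "bounded (d ` {a..b})" using d by (intro compact_imp_bounded compact_continuous_image) auto
  then obtain N2 where N2: "\<And>r. r \<in> {a..b} \<Longrightarrow> \<bar>d r\<bar> \<le> N2"
    unfolding bounded_iff by (metis imageI real_norm_def)
  define N where "N = \<bar>N1\<bar> + \<bar>N2\<bar> + \<bar>real ?n * C\<bar>"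
  have k0b: "\<bar>k0 r\<bar> \<le> N" for r
    using N2[of r] unfolding k0_def N_def by (auto simp: indicator_def)
  then have kb: "\<bar>k r\<bar> \<le> N" for r using \<sigma> by (auto simp: k_def)
  have flux: "\<Phi> r * r = radial_flux ?n k r" if "a \<le> r" "r \<le> b" for r
  proof -
    have "Fp_fun ?n a d C r * r = radial_flux ?n k0 r"
      using that ab by (intro Fp_fun_flux(1)[OF d ab(1) _ _ _ k0m k0b]) (auto simp: k0_def)
    then have "\<Phi> r * r = \<sigma> * radial_flux ?n k0 r" unfolding \<Phi> by simp
    also have "\<dots> = radial_flux ?n k r" using \<sigma> radial_flux_uminus[of ?n k0 r] by (auto simp: k_def)
    finally show ?thesis .
  qed
  have dm: "(\<Phi> r)\<^sup>2 * r\<^sup>2 \<in> {0..1}" if "a < r" "r < b" for r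
    using in_domain_bound(2)[OF dom _ refl, of r] that by simp
  have pot: "profile p \<Phi> a r = potential (\<lambda>r. slope p (radial_flux ?n k r)) a r" if "r \<in> {a..b}" for r
    by (rule profile_potential[OF p _ _ _ that]) (use flux dm ab in auto)
  have zero: "potential (\<lambda>r. slope p (radial_flux ?n k r)) a b = 0"
  proof -
    have "potential (\<lambda>r. slope p (radial_flux ?n k r)) a b = (LBINT \<rho>=ereal a..ereal b. slope p (\<Phi> \<rho> * \<rho>))"
      unfolding potential_def
      by (rule interval_integral_cong) (use flux ab in \<open>auto simp: einterval_def min_def max_def\<close>)
    then show ?thesis using ret by (simp add: returns_to_zero_def)
  qed
  have H1: "\<bar>radial_flux ?n k r\<bar> \<le> 1" if "a < r" "r < b" for r
    using in_domain_bound(1)[OF dom _ flux] that by simp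
  have fN: "\<bar>f x\<bar> \<le> N" for x using N1[of x] unfolding N_def by linarith
  have fk: "f x = k (dist c x)" if "a < dist c x" "dist c x < b" for x
    using that by (simp add: fd k_def k0_def)
  show ?thesis
    using annulus_solution[OF p ab R km kb H1 zero U V f(1) fN fk] pot by simp
qed

theorem theorem1p1:
  fixes O1 O2 :: "real ^ 'n"
    and R1 R2 p :: real
    and fplus fminus :: "real ^ 'n \<Rightarrow> real"
    and fp fm :: "real \<Rightarrow> real"
  defines "n \<equiv> CARD('n)"
    and "\<Omega> \<equiv> ball O1 R1"
    and "\<Omega>s \<equiv> ball O2 R2"
    and "A \<equiv> admissible O1 R1 O2 R2"
    and "f \<equiv> net_density (ball O1 R1) (ball O2 R2) fplus fminus"
    and "U \<equiv> ball O1 R1 \<union> ball O2 R2"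
    and "V \<equiv> (ball O1 R1 \<union> ball O2 R2) - closure (ball O1 R1 \<inter> ball O2 R2)"
  assumes p: "p > 2"
    and radii: "R1 > 0" "R2 > 0"
    and configuration: "\<Omega> \<inter> \<Omega>s = {} \<or> (O1 = O2 \<and> R1 \<noteq> R2)"
    and cont: "continuous_on (closure \<Omega>) fplus" "continuous_on (closure \<Omega>s) fminus"
    and pos: "\<And>x. x \<in> \<Omega> \<Longrightarrow> fplus x > 0" "\<And>x. x \<in> \<Omega>s \<Longrightarrow> fminus x > 0"
    and radial: "\<And>x. x \<in> closure \<Omega> \<Longrightarrow> fplus x = fp (dist O1 x)"
                "\<And>x. x \<in> closure \<Omega>s \<Longrightarrow> fminus x = fm (dist O2 x)"
    and balance: "(LINT x:\<Omega>|lebesgue. fplus x) = 1" "(LINT x:\<Omega>s|lebesgue. fminus x) = 1"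
    and domain_disjoint: "\<Omega> \<inter> \<Omega>s = {} \<Longrightarrow>
          in_Ep_inv_domain (F_fun n R1 fp) {0<..R1} \<and> in_Ep_inv_domain (G_fun n R2 fm) {0<..R2}"
    and domain_inner: "\<And>C. O1 = O2 \<Longrightarrow> R1 > R2 \<Longrightarrow>
          returns_to_zero p (Fp_fun n R2 fp C) R2 R1 \<Longrightarrow> in_Ep_inv_domain (Fp_fun n R2 fp C) {R2..R1}"
    and domain_outer: "\<And>D. O1 = O2 \<Longrightarrow> R2 > R1 \<Longrightarrow>
          returns_to_zero p (Gp_fun n R1 fm D) R1 R2 \<Longrightarrow> in_Ep_inv_domain (Gp_fun n R1 fm D) {R1..R2}"
  shows "\<exists>u \<in> A.
      euler_lagrange_dirichlet p V f u \<and>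
      (\<forall>v \<in> A. euler_lagrange_dirichlet p V f v \<longrightarrow> (\<forall>x\<in>closure U. v x = u x)) \<and>
      (\<forall>w \<in> A. energy p U f u \<le> energy p U f w) \<and>
      (\<Omega> \<inter> \<Omega>s = {} \<longrightarrow>
         (\<forall>x\<in>closure \<Omega>. u x = profile p (F_fun n R1 fp) R1 (dist O1 x)) \<and>
         (\<forall>x\<in>closure \<Omega>s. u x = profile p (G_fun n R2 fm) R2 (dist O2 x))) \<and>
      (O1 = O2 \<and> R1 > R2 \<longrightarrow>
         (\<exists>C. 0 < C \<and> C < inv_sphere_area n / R2 ^ n \<and>
            (\<forall>x. dist O1 x \<in> {R2..R1} \<longrightarrow> u x = profile p (Fp_fun n R2 fp C) R2 (dist O1 x)))) \<and>
      (O1 = O2 \<and> R2 > R1 \<longrightarrow>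
         (\<exists>D. 0 < D \<and> D < inv_sphere_area n / R1 ^ n \<and>
            (\<forall>x. dist O1 x \<in> {R1..R2} \<longrightarrow> u x = profile p (Gp_fun n R1 fm D) R1 (dist O1 x))))"
proof -
  have n: "DIM(real ^ 'n) = n" "0 < n" by (simp_all add: n_def)
  note R = radii
  note d1 = radial_density[OF R(1) cont(1)[unfolded \<Omega>_def] radial(1)[unfolded \<Omega>_def]]
  note d2 = radial_density[OF R(2) cont(2)[unfolded \<Omega>s_def] radial(2)[unfolded \<Omega>s_def]]
  have cd: "continuous_on {0..R1} fp" "continuous_on {0..R2} fm" using d1(1) d2(1) by blast+
  have mass: "radial_mass n fp R1 = inv_sphere_area n" "radial_mass n fm R2 = inv_sphere_area n"
    using d1(4) d2(4) balance unfolding \<Omega>_def \<Omega>s_def n by blast+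
  have pos': "0 < fp r" if "0 \<le> r" "r < R1" for r using d1(3) pos(1) that unfolding \<Omega>_def by blast
  have pos2': "0 < fm r" if "0 \<le> r" "r < R2" for r using d2(3) pos(2) that unfolding \<Omega>s_def by blast
  have f_eq: "f = net_density (ball O1 R1) (ball O2 R2) fplus fminus" by (simp add: f_def)
  have U_eq: "U = ball O1 R1 \<union> ball O2 R2" by (simp add: U_def)
  have V_eq: "V = (ball O1 R1 \<union> ball O2 R2) - closure (ball O1 R1 \<inter> ball O2 R2)" by (simp add: V_def)
  note fr = net_density_regular[OF R cont[unfolded \<Omega>_def \<Omega>s_def] U_eq f_eq]
  have fplus: "fplus x = fp (dist O1 x)" if "dist O1 x < R1" for x
    using radial(1)[of x] that closure_subset[of \<Omega>] unfolding \<Omega>_def by auto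
  have fminus: "fminus x = fm (dist O2 x)" if "dist O2 x < R2" for x
    using radial(2)[of x] that closure_subset[of \<Omega>s] unfolding \<Omega>s_def by auto
  (* balls with a common centre meet, so the configurations exclude each other *)
  consider (disjoint) "\<Omega> \<inter> \<Omega>s = {}" "O1 \<noteq> O2" | (inner) "O1 = O2" "R2 < R1" "\<Omega> \<inter> \<Omega>s \<noteq> {}"
    | (outer) "O1 = O2" "R1 < R2" "\<Omega> \<inter> \<Omega>s \<noteq> {}"
  proof -
    have "O1 \<in> \<Omega> \<inter> \<Omega>s" if "O1 = O2" using that R by (simp add: \<Omega>_def \<Omega>s_def)
    then show thesis using configuration disjoint inner outer by (metis empty_iff linorder_neqE_linordered_idom)
  qed
  then show ?thesis
  proof cases
    case disjoint
    obtain N1 where N1: "\<And>r. r \<in> {0..R1} \<Longrightarrow> \<bar>fp r\<bar> \<le> N1" using d1(2) by blast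
    obtain N2 where N2: "\<And>r. r \<in> {0..R2} \<Longrightarrow> \<bar>fm r\<bar> \<le> N2" using d2(2) by blast
    obtain N3 where N3: "\<And>x. \<bar>f x\<bar> \<le> N3" using fr(2) by blast
    define N where "N = \<bar>N1\<bar> + \<bar>N2\<bar> + \<bar>N3\<bar>"
    define k1 k2 where "k1 = (\<lambda>r. indicator {0..R1} r *\<^sub>R fp r)" and "k2 = (\<lambda>r. indicator {0..R2} r *\<^sub>R fm r)"
    have km: "k1 \<in> borel_measurable borel" "k2 \<in> borel_measurable borel" unfolding k1_def k2_def
      by (rule borel_measurable_continuous_on_indicator[OF _ cd(1)], simp)
        (rule borel_measurable_continuous_on_indicator[OF _ cd(2)], simp)
    have kb: "\<bar>k1 r\<bar> \<le> N" "\<bar>- k2 r\<bar> \<le> N" for r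
      using N1[of r] N2[of r] unfolding k1_def k2_def N_def by (auto simp: indicator_def)
    have km2: "(\<lambda>r. - k2 r) \<in> borel_measurable borel" using km(2) by simp
    have fl1: "F_fun n R1 fp r * r = radial_flux n k1 r" if "0 < r" "r \<le> R1" for r
      by (rule F_fun_flux[OF cd(1) mass(1) _ that n(2)]) (simp add: k1_def)
    have fl2: "G_fun n R2 fm r * r = radial_flux n (\<lambda>r. - k2 r) r" if "0 < r" "r \<le> R2" for r
    proof -
      have "F_fun n R2 fm r * r = radial_flux n k2 r"
        by (rule F_fun_flux[OF cd(2) mass(2) _ that n(2)]) (simp add: k2_def)
      then show ?thesis by (simp add: G_fun_eq radial_flux_uminus)
    qed
    have dom1: "in_Ep_inv_domain (F_fun n R1 fp) {0<..R1}" and dom2: "in_Ep_inv_domain (G_fun n R2 fm) {0<..R2}"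
      using domain_disjoint[OF disjoint(1)] by blast+
    have H1: "\<bar>radial_flux DIM(real ^ 'n) k1 r\<bar> \<le> 1" if "0 < r" "r < R1" for r
      using in_domain_bound(1)[OF dom1 _ fl1] that unfolding n by simp
    have H2: "\<bar>radial_flux DIM(real ^ 'n) (\<lambda>r. - k2 r) r\<bar> \<le> 1" if "0 < r" "r < R2" for r
      using in_domain_bound(1)[OF dom2 _ fl2] that unfolding n by simp
    have fN: "\<bar>f x\<bar> \<le> N" for x using N3[of x] unfolding N_def by linarith
    have dis: "ball O1 R1 \<inter> ball O2 R2 = {}" using disjoint(1) by (simp add: \<Omega>_def \<Omega>s_def)
    have f1: "f x = k1 (dist O1 x)" if "x \<in> ball O1 R1" for x
    proof -
      have "x \<notin> ball O2 R2" using dis that by blast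
      then show ?thesis using that fplus[of x] by (simp add: f_eq net_density_def k1_def)
    qed
    have f2: "f x = - k2 (dist O2 x)" if "x \<in> ball O2 R2" for x
    proof -
      have "x \<notin> ball O1 R1" using dis that by blast
      then show ?thesis using that fminus[of x] by (simp add: f_eq net_density_def k2_def)
    qed
    have pr1: "profile p (F_fun n R1 fp) R1 r = potential (\<lambda>r. slope p (radial_flux DIM(real ^ 'n) k1 r)) R1 r" if "r \<in> {0..R1}" for r
      unfolding n by (rule profile_potential[OF p, where a=0 and b=R1])
        (use fl1 in_domain_bound(2)[OF dom1 _ refl] that R in auto)
    have pr2: "profile p (G_fun n R2 fm) R2 r = potential (\<lambda>r. slope p (radial_flux DIM(real ^ 'n) (\<lambda>r. - k2 r) r)) R2 r" if "r \<in> {0..R2}" for r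
      unfolding n by (rule profile_potential[OF p, where a=0 and b=R2])
        (use fl2 in_domain_bound(2)[OF dom2 _ refl] that R in auto)
    have cl: "closure \<Omega> = cball O1 R1" "closure \<Omega>s = cball O2 R2"
      using R by (simp_all add: \<Omega>_def \<Omega>s_def closure_ball)
    obtain u where u: "unique_minimizing_solution A p U V f u"
      "\<forall>x\<in>cball O1 R1. u x = potential (\<lambda>r. slope p (radial_flux DIM(real ^ 'n) k1 r)) R1 (dist O1 x)"
      "\<forall>x\<in>cball O2 R2. u x = potential (\<lambda>r. slope p (radial_flux DIM(real ^ 'n) (\<lambda>r. - k2 r) r)) R2 (dist O2 x)"
      using disjoint_solution[OF p R dis km(1) kb(1) km2 kb(2) H1 H2 U_eq V_eq fr(1) fN f1 f2]
      unfolding A_def by blast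
    have e1: "\<forall>x\<in>closure \<Omega>. u x = profile p (F_fun n R1 fp) R1 (dist O1 x)"
      using u(2) pr1 unfolding cl by simp
    have e2: "\<forall>x\<in>closure \<Omega>s. u x = profile p (G_fun n R2 fm) R2 (dist O2 x)"
      using u(3) pr2 unfolding cl by simp
    show ?thesis using u(1) e1 e2 disjoint(2) unfolding unique_minimizing_solution_def by blast
  next
    case inner
    obtain C where C: "0 < C" "C < radial_mass n fp R1 / R2 ^ n" "returns_to_zero p (Fp_fun n R2 fp C) R2 R1"
      using shooting_constant[OF p R(2) inner(2) n(2) cd(1) pos'] by blast
    have d: "continuous_on {R2..R1} fp" using R by (intro continuous_on_subset[OF cd(1)]) auto
    have fd: "f x = 1 * fp (dist O1 x)" if "R2 < dist O1 x" "dist O1 x < R1" for x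
      using that fplus[of x] inner(1) by (simp add: f_eq net_density_def)
    have "\<exists>u. unique_minimizing_solution A p U V f u \<and>
      (\<forall>x. dist O1 x \<in> {R2..R1} \<longrightarrow> u x = profile p (Fp_fun n R2 fp C) R2 (dist O1 x))"
      unfolding A_def inner(1)[symmetric]
    proof (rule concentric_solution[OF p R(2) inner(2) _ d])
      show "R1 = R1 \<and> R2 = R2 \<or> R1 = R2 \<and> R2 = R1" by simp
      show "(1::real) = 1 \<or> (1::real) = -1" by simp
      show "Fp_fun n R2 fp C \<rho> = 1 * Fp_fun DIM(real ^ 'n) R2 fp C \<rho>" for \<rho>
        unfolding n by (simp add: Gp_fun_eq)
      show "in_Ep_inv_domain (Fp_fun n R2 fp C) {R2..R1}" by (rule domain_inner[OF inner(1,2) C(3)])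
      show "returns_to_zero p (Fp_fun n R2 fp C) R2 R1" by (rule C(3))
      show "U = ball O1 R1 \<union> ball O1 R2" "V = (ball O1 R1 \<union> ball O1 R2) - closure (ball O1 R1 \<inter> ball O1 R2)"
        using U_eq V_eq unfolding inner(1)[symmetric] .
      show "(\<lambda>x. indicator U x * f x) \<in> borel_measurable borel" "\<exists>N. \<forall>x. \<bar>f x\<bar> \<le> N" by (rule fr)+
    qed (rule fd)
    then obtain u where u: "unique_minimizing_solution A p U V f u"
      "\<forall>x. dist O1 x \<in> {R2..R1} \<longrightarrow> u x = profile p (Fp_fun n R2 fp C) R2 (dist O1 x)" by blast
    have "C < inv_sphere_area n / R2 ^ n" using C(2) unfolding mass(1) .
    moreover have "\<not> R1 < R2" using inner(2) by simp
    ultimately show ?thesis using u C(1) inner(3) unfolding unique_minimizing_solution_def by blast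
  next
    case outer
    obtain D where D: "0 < D" "D < radial_mass n fm R2 / R1 ^ n" "returns_to_zero p (Fp_fun n R1 fm D) R1 R2"
      using shooting_constant[OF p R(1) outer(2) n(2) cd(2) pos2'] by blast
    have D3: "returns_to_zero p (Gp_fun n R1 fm D) R1 R2"
    proof -
      have "(LBINT \<rho>=ereal R1..ereal R2. slope p (Gp_fun n R1 fm D \<rho> * \<rho>))
         = - (LBINT \<rho>=ereal R1..ereal R2. slope p (Fp_fun n R1 fm D \<rho> * \<rho>))"
        by (simp add: Gp_fun_eq slope_minus interval_lebesgue_integral_uminus)
      then show ?thesis using D(3) by (simp add: returns_to_zero_def)
    qed
    have d: "continuous_on {R1..R2} fm" using R by (intro continuous_on_subset[OF cd(2)]) auto
    have fd: "f x = (-1) * fm (dist O1 x)" if "R1 < dist O1 x" "dist O1 x < R2" for x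
      using that fminus[of x] outer(1) by (simp add: f_eq net_density_def)
    have "\<exists>u. unique_minimizing_solution A p U V f u \<and>
      (\<forall>x. dist O1 x \<in> {R1..R2} \<longrightarrow> u x = profile p (Gp_fun n R1 fm D) R1 (dist O1 x))"
      unfolding A_def outer(1)[symmetric]
    proof (rule concentric_solution[OF p R(1) outer(2) _ d])
      show "R1 = R2 \<and> R2 = R1 \<or> R1 = R1 \<and> R2 = R2" by simp
      show "(-1::real) = 1 \<or> (-1::real) = -1" by simp
      show "Gp_fun n R1 fm D \<rho> = -1 * Fp_fun DIM(real ^ 'n) R1 fm D \<rho>" for \<rho>
        unfolding n by (simp add: Gp_fun_eq)
      show "in_Ep_inv_domain (Gp_fun n R1 fm D) {R1..R2}" by (rule domain_outer[OF outer(1,2) D3])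
      show "returns_to_zero p (Gp_fun n R1 fm D) R1 R2" by (rule D3)
      show "U = ball O1 R1 \<union> ball O1 R2" "V = (ball O1 R1 \<union> ball O1 R2) - closure (ball O1 R1 \<inter> ball O1 R2)"
        using U_eq V_eq unfolding outer(1)[symmetric] .
      show "(\<lambda>x. indicator U x * f x) \<in> borel_measurable borel" "\<exists>N. \<forall>x. \<bar>f x\<bar> \<le> N" by (rule fr)+
    qed (rule fd)
    then obtain u where u: "unique_minimizing_solution A p U V f u"
      "\<forall>x. dist O1 x \<in> {R1..R2} \<longrightarrow> u x = profile p (Gp_fun n R1 fm D) R1 (dist O1 x)" by blast
    have "D < inv_sphere_area n / R1 ^ n" using D(2) unfolding mass(2) .
    moreover have "\<not> R2 < R1" using outer(2) by simp
    ultimately show ?thesis using u D(1) outer(3) unfolding unique_minimizing_solution_def by blast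
  qed
qed

end
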